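(* Let $\mathcal H$ be a real Hilbert space. Let $f:\mathcal H\to\mathbb R$ be a differentiable function whose gradient $\nabla f$ is Lipschitz continuous on the bounded subsets of $\mathcal H$, and such that $\inf_{\mathcal H} f>-\infty$. Let $\phi:\mathcal H\to\mathbb R_+$ be a damping potential. Then, for any $x_0,x_1\in\mathcal H$, there exists a unique strong global solution $x:[0,+\infty[\to\mathcal H$ of the differential inclusion $$0\in \ddot x(t)+\partial\phi(\dot x(t))+\nabla f(x(t))$$ such that $x(0)=x_0$ and $\dot x(0)=x_1$.
   Context: A function $\phi:\mathcal H\to\mathbb R_+$ is a damping potential if: (i) $\phi$ is nonnegative, convex and continuous; (ii) $\phi(0)=0=\min_{\mathcal H}\phi$; (iii) for every $R>0$, $\sup_{\|u\|\le R}\|(\partial\phi)^0(u)\|<+\infty$, where $\partial\phi$ is the convex subdifferential and $(\partial\phi)^0(u)$ is the element of minimal norm of the nonempty closed convex set $\partial\phi(u)$. A function $x:[0,+\infty[\to\mathcal H$ is a strong global solution of the inclusion if: (i) $x\in\mathcal C^1([0,+\infty[;\mathcal H)$; (ii) for all $T>0$, $\dot x$ is Lipschitz continuous on $(0,T)$ and $\ddot x\in L^\infty(0,T;\mathcal H)$; (iii) the inclusion holds for almost every $t>0$. *)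

theory Defs
  imports "HOL-Analysis.Analysis"
begin

definition gradient :: "('a::real_inner \<Rightarrow> real) \<Rightarrow> 'a \<Rightarrow> 'a" where
  "gradient f u = (THE D. GDERIV f u :> D)"

definition subdifferential :: "('a::real_inner \<Rightarrow> real) \<Rightarrow> 'a \<Rightarrow> 'a set" where
  "subdifferential \<phi> u = {g. \<forall>v. \<phi> v \<ge> \<phi> u + inner g (v - u)}"

definition min_norm_subgradient :: "('a::real_inner \<Rightarrow> real) \<Rightarrow> 'a \<Rightarrow> 'a" where
  "min_norm_subgradient \<phi> u = (ARG_MIN norm g. g \<in> subdifferential \<phi> u)"

definition damping_potential :: "('a::real_inner \<Rightarrow> real) \<Rightarrow> bool" where
  "damping_potential \<phi> \<longleftrightarrow>
     (\<forall>u. 0 \<le> \<phi> u) \<and> convex_on UNIV \<phi> \<and> continuous_on UNIV \<phi> \<and>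
     \<phi> 0 = 0 \<and> (\<forall>u. \<phi> 0 \<le> \<phi> u) \<and>
     (\<forall>R>0. bdd_above ((\<lambda>u. norm (min_norm_subgradient \<phi> u)) ` cball 0 R))"

text \<open>
  Trajectories on the half-line are total functions on the reals of which only the values on
  \<open>{0..}\<close> matter. The velocity is therefore the derivative within \<open>{0..}\<close>, which is one-sided
  at \<open>0\<close> and two-sided at positive times.
\<close>

definition velocity :: "(real \<Rightarrow> 'a::real_normed_vector) \<Rightarrow> real \<Rightarrow> 'a" where
  "velocity x t = vector_derivative x (at t within {0..})"

text \<open>
  The second derivative is the almost everywhere derivative of the velocity. It is a meaningful
  value only where the velocity is differentiable, which \<open>strong_global_solution\<close> demands at almost
  every positive time. For a locally Lipschitz velocity with values in a Hilbert space it
  agrees with the distributional derivative.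
\<close>

definition acceleration :: "(real \<Rightarrow> 'a::real_normed_vector) \<Rightarrow> real \<Rightarrow> 'a" where
  "acceleration x t = vector_derivative (velocity x) (at t)"

text \<open>
  Membership in the Bochner space of essentially bounded functions. Since the target space need not
  be separable, measurability is strong measurability: almost everywhere a limit of simple functions.
\<close>

definition in_L_infinity :: "'s measure \<Rightarrow> ('s \<Rightarrow> 'a::real_normed_vector) \<Rightarrow> bool" where
  "in_L_infinity M a \<longleftrightarrow>
     (\<exists>s. (\<forall>i::nat. simple_function M (s i)) \<and> (AE t in M. (\<lambda>i. s i t) \<longlonglongrightarrow> a t)) \<and>
     (\<exists>C. AE t in M. norm (a t) \<le> C)"

definition strong_global_solution ::
    "('a::real_inner \<Rightarrow> real) \<Rightarrow> ('a \<Rightarrow> real) \<Rightarrow> (real \<Rightarrow> 'a) \<Rightarrow> bool" where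
  "strong_global_solution \<phi> f x \<longleftrightarrow>
     (\<forall>t\<ge>0. x differentiable (at t within {0..})) \<and> continuous_on {0..} (velocity x) \<and>
     (\<forall>T>0. (\<exists>L. L-lipschitz_on {0<..<T} (velocity x)) \<and>
            (AE t in lebesgue_on {0<..<T}. velocity x differentiable (at t)) \<and>
            in_L_infinity (lebesgue_on {0<..<T}) (acceleration x)) \<and>
     (AE t in lebesgue_on {0<..}.
        0 \<in> (\<lambda>g. acceleration x t + g + gradient f (x t)) ` subdifferential \<phi> (velocity x t))"

end

theory Submission
  imports Defs
begin

text \<open>
  Write the inclusion as a first order system \<open>z' \<in> F z\<close> for the state \<open>z = (x, v)\<close>, where \<open>F (x, v)\<close>
  consists of the vectors \<open>(v, - g - \<nabla>f x)\<close> with \<open>g \<in> \<partial>\<phi> v\<close>. On every ball \<open>F\<close> is bounded, by the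
  third condition on a damping potential, and one-sided Lipschitz,
  \<open>\<langle>F z - F z', z - z'\<rangle> \<le> 2 K \<parallel>z - z'\<parallel>\<^sup>2\<close>, because \<open>\<partial>\<phi>\<close> is monotone and \<open>\<nabla>f\<close> is Lipschitz there
  (\<open>velocity_field_one_sided_lipschitz\<close>). Everything rests on these two properties.

  Construction. Explicit Euler steps are taken with the subgradient of minimal norm. The energy
  \<open>\<parallel>v\<parallel>\<^sup>2 / 2 + f x\<close> grows in each step by at most a multiple of the square of the step size, so the polygons
  stay in one ball on \<open>[0, T]\<close> (\<open>euler_bounded\<close>). There the one-sided Lipschitz bound and Gronwall's
  inequality show that polygons with steps \<open>h\<close> and \<open>k\<close> differ by \<open>O (sqrt (h + k))\<close>
  (\<open>polygons_close\<close>), so they converge locally uniformly to a locally Lipschitz trajectory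
  \<open>(X, V)\<close>. Passing to the limit in the subgradient inequality gives an integrated variational
  inequality for \<open>V\<close> (\<open>velocity_variational_inequality\<close>).

  Differentiability of \<open>V\<close>. By the variational inequality, difference quotients of \<open>V\<close> at \<open>t\<close> are,
  up to sign and the term \<open>\<nabla>f (X t)\<close>, subgradients of \<open>\<phi>\<close> at \<open>V t\<close> with an error proportional to the
  increment. Let \<open>g0\<close> minimize \<open>\<parallel>g + \<nabla>f (X t)\<parallel>\<close> over \<open>g \<in> \<partial>\<phi> (V t)\<close>. An approximate
  subgradient that almost attains this minimum, or falls below it, is close to \<open>g0\<close>
  (\<open>approx_subgradient_near_minimal_subgradient\<close>), so the quotients converge
  as soon as their norms are asymptotically bounded by the minimum. For forward quotients
  this bound always holds, hence \<open>V\<close> has a right derivative everywhere, and it solves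
  the inclusion. Two solution curves separate at most exponentially, and applying
  this to the trajectory and its own time shift shows that \<open>exp (- 2 K t) * speed t\<close> is nonincreasing on \<open>[0, T)\<close>,
  where \<open>speed t\<close> is the norm of the right derivative of the state. A monotone function has
  only countably many discontinuities, and at every other time the backward quotients satisfy the norm
  bound as well, so \<open>V\<close> is differentiable off a countable set.

  Uniqueness. For two strong solutions the one-sided Lipschitz bound makes
  \<open>exp (- 4 K t) * \<parallel>z\<^sub>1 t - z\<^sub>2 t\<parallel>\<^sup>2\<close> a Lipschitz function with nonpositive derivative almost
  everywhere; such a function is nonincreasing, and it starts at \<open>0\<close>.
\<close>

section \<open>Convex minimization in a Hilbert space\<close>

lemma parallelogram_midpoint:
  fixes a b :: "'a::real_inner"
  shows "(norm (a - b))\<^sup>2 = 2 * (norm a)\<^sup>2 + 2 * (norm b)\<^sup>2 - 4 * (norm ((1/2) *\<^sub>R (a + b)))\<^sup>2"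
  unfolding power2_norm_eq_inner by (simp add: algebra_simps inner_commute)

lemma convex_midpoint:
  assumes "convex S" "a \<in> S" "b \<in> S"
  shows "(1/2) *\<^sub>R (a + b) \<in> S"
  using convexD[OF assms, of "1/2" "1/2"] by (simp add: algebra_simps)

text \<open>Points of almost least norm in the sets form a Cauchy sequence: the least norms increase
  to a limit, midpoints stay in the earlier set, and the parallelogram law bounds the
  distance of two points by the gap between their norms and the norm of the midpoint. This is the
  substitute for weak compactness in all that follows: minimizers, subgradients and limits of
  approximate subgradients are all obtained from it.\<close>

lemma nested_closed_convex_common_point:
  fixes C :: "nat \<Rightarrow> 'a::{real_inner, complete_space} set"
  assumes cl: "\<And>n. closed (C n)" and cv: "\<And>n. convex (C n)"
    and dec: "\<And>n. C (Suc n) \<subseteq> C n"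
    and pt: "\<And>n. \<exists>x\<in>C n. norm x \<le> m"
  shows "\<exists>x. (\<forall>n. x \<in> C n) \<and> norm x \<le> m"
proof -
  define d where "d n = infdist 0 (C n)" for n
  have ne: "C n \<noteq> {}" for n using pt by blast
  have dmono: "C l \<subseteq> C k" if "k \<le> l" for k l
    using that dec by (rule lift_Suc_antimono_le[rotated])
  have lower: "d n \<le> norm x" if "x \<in> C n" for n x
    using infdist_le[OF that, of 0] by (simp add: d_def)
  have inc: "d k \<le> d l" if "k \<le> l" for k l
    unfolding d_def using infdist_mono[OF dmono[OF that] ne] .
  have dm: "d n \<le> m" for n using pt[of n] lower by force
  have d0: "0 \<le> d n" for n by (simp add: d_def infdist_nonneg)
  have "\<exists>x\<in>C n. norm x < d n + 1 / real (Suc n)" for n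
  proof -
    have "Inf (dist 0 ` C n) < d n + 1 / real (Suc n)"
      using infdist_notempty[OF ne[of n]] by (simp add: d_def)
    then obtain y where "y \<in> dist 0 ` C n" "y < d n + 1 / real (Suc n)"
      using cInf_lessD[of "dist 0 ` C n"] ne[of n] by blast
    then show ?thesis by auto
  qed
  then obtain x where xC: "\<And>n. x n \<in> C n" and xn: "\<And>n. norm (x n) < d n + 1 / real (Suc n)"
    by metis
  have dconv: "convergent d"
    using inc dm d0 by (intro Bseq_monoseq_convergent BseqI'[of _ m] incseq_imp_monoseq)
      (auto simp: incseq_def)
  then obtain D where D: "d \<longlonglongrightarrow> D" by (auto simp: convergent_def)
  have dD: "d n \<le> D" for n using inc D by (intro incseq_le) (auto simp: incseq_def)
  have Dm: "D \<le> m" using D dm by (intro LIMSEQ_le_const2) auto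
  have D0: "0 \<le> D" using dD[of 0] d0[of 0] by linarith
  define e where "e n = 4 * ((D + 1 / real (Suc n))\<^sup>2 - (d n)\<^sup>2)" for n
  have "e \<longlonglongrightarrow> 4 * ((D + 0)\<^sup>2 - D\<^sup>2)"
    unfolding e_def using LIMSEQ_Suc[OF lim_1_over_n, where 'a1=real]
    by (intro tendsto_intros D) auto
  then have e0: "e \<longlonglongrightarrow> 0" by simp
  have key: "(norm (x k - x l))\<^sup>2 \<le> e k" if "k \<le> l" for k l
  proof -
    have "(1/2) *\<^sub>R (x k + x l) \<in> C k"
      using convex_midpoint[OF cv xC] dmono[OF that] xC by blast
    then have "d k \<le> norm ((1/2) *\<^sub>R (x k + x l))" by (rule lower)
    then have 1: "(d k)\<^sup>2 \<le> (norm ((1/2) *\<^sub>R (x k + x l)))\<^sup>2" using d0 by (simp add: power_mono)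
    have "norm (x l) \<le> D + 1 / real (Suc l)" using xn[of l] dD[of l] by linarith
    also have "\<dots> \<le> D + 1 / real (Suc k)" using that by (simp add: frac_le)
    finally have 2: "(norm (x l))\<^sup>2 \<le> (D + 1 / real (Suc k))\<^sup>2" by (simp add: power_mono)
    have "norm (x k) \<le> D + 1 / real (Suc k)" using xn[of k] dD[of k] by linarith
    then have 3: "(norm (x k))\<^sup>2 \<le> (D + 1 / real (Suc k))\<^sup>2" by (simp add: power_mono)
    show ?thesis unfolding parallelogram_midpoint[of "x k"] e_def using 1 2 3 by argo
  qed
  have "Cauchy x"
  proof (rule CauchyI')
    fix \<epsilon> :: real assume "0 < \<epsilon>"
    then have "\<forall>\<^sub>F n in sequentially. e n < \<epsilon>\<^sup>2"
      using e0 by (intro order_tendstoD) auto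
    then obtain N where N: "\<And>n. n \<ge> N \<Longrightarrow> e n < \<epsilon>\<^sup>2" by (auto simp: eventually_sequentially)
    show "\<exists>M. \<forall>m\<ge>M. \<forall>n>m. dist (x m) (x n) < \<epsilon>"
    proof (intro exI allI impI)
      fix k l assume "N \<le> k" "k < l"
      then have "(norm (x k - x l))\<^sup>2 < \<epsilon>\<^sup>2" using key[of k l] N[of k] by force
      then show "dist (x k) (x l) < \<epsilon>" using \<open>0 < \<epsilon>\<close> by (simp add: dist_norm power2_less_imp_less)
    qed
  qed
  then obtain y where y: "x \<longlonglongrightarrow> y" using Cauchy_convergent convergent_def by blast
  have "y \<in> C n" for n
  proof (rule Lim_in_closed_set[OF cl _ _ y])
    show "\<forall>\<^sub>F k in sequentially. x k \<in> C n"
      using eventually_ge_at_top[of n] by eventually_elim (use dmono xC in blast)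
  qed simp
  moreover have "norm y \<le> m"
  proof -
    have "(\<lambda>n. d n + 1 / real (Suc n)) \<longlonglongrightarrow> D + 0"
      using LIMSEQ_Suc[OF lim_1_over_n, where 'a1=real] by (intro tendsto_intros D) auto
    then have "norm y \<le> D"
      using LIMSEQ_le[OF tendsto_norm[OF y], of _ "D + 0"] xn by (auto intro: less_imp_le)
    then show ?thesis using Dm by linarith
  qed
  ultimately show ?thesis by blast
qed

text \<open>The sublevel sets just above the infimum are nested, closed, convex and, by coercivity, meet a
  fixed ball. Capping the levels at \<open>F 0\<close> makes coercivity applicable to all of them.\<close>

lemma convex_coercive_attains_minimum:
  fixes F :: "'a::{real_inner, complete_space} \<Rightarrow> real"
  assumes cv: "convex_on UNIV F" and ct: "continuous_on UNIV F"
    and bdd: "\<And>u. F u \<ge> b" and coercive: "\<And>u. F u \<le> F 0 \<Longrightarrow> norm u \<le> m"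
  shows "\<exists>u. \<forall>w. F u \<le> F w"
proof -
  define I where "I = Inf (range F)"
  have bb: "bdd_below (range F)" using bdd by (intro bdd_belowI2)
  have I: "I \<le> F w" for w unfolding I_def using bb by (auto intro: cInf_lower)
  define c where "c n = min (F 0) (I + 1 / real (Suc n))" for n
  define C where "C n = {u. F u \<le> c n}" for n
  have "\<exists>x. (\<forall>n. x \<in> C n) \<and> norm x \<le> m"
  proof (rule nested_closed_convex_common_point)
    show "closed (C n)" for n
      unfolding C_def using ct by (intro closed_Collect_le) auto
    show "convex (C n)" for n
      unfolding C_def convex_def
    proof (intro ballI allI impI, unfold mem_Collect_eq)
      fix x y and s t :: real
      assume a: "F x \<le> c n" "F y \<le> c n" "0 \<le> s" "0 \<le> t" "s + t = 1"
      have "F (s *\<^sub>R x + t *\<^sub>R y) \<le> s * F x + t * F y"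
        using cv a by (simp add: convex_on_def)
      also have "\<dots> \<le> s * c n + t * c n" using a by (intro add_mono mult_left_mono)
      also have "\<dots> = c n" using a by (metis distrib_right mult_1)
      finally show "F (s *\<^sub>R x + t *\<^sub>R y) \<le> c n" .
    qed
    show "C (Suc n) \<subseteq> C n" for n
    proof -
      have "1 / real (Suc (Suc n)) \<le> 1 / real (Suc n)" by (simp add: frac_le)
      then show ?thesis unfolding C_def c_def by (auto simp: min_def)
    qed
    show "\<exists>x\<in>C n. norm x \<le> m" for n
    proof -
      have "\<exists>u. F u \<le> c n"
      proof (cases "F 0 \<le> I + 1 / real (Suc n)")
        case True then show ?thesis by (auto simp: c_def)
      next
        case False
        have "I < I + 1 / real (Suc n)" by simp
        then obtain y where "y \<in> range F" "y < I + 1 / real (Suc n)"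
          unfolding I_def using cInf_lessD[of "range F"] by blast
        then show ?thesis using False by (auto simp: c_def intro!: less_imp_le)
      qed
      then show ?thesis using coercive by (auto simp: C_def c_def)
    qed
  qed
  then obtain u where u: "\<And>n. F u \<le> c n" by (auto simp: C_def)
  have "F u \<le> I + 0"
  proof (rule LIMSEQ_le_const)
    show "(\<lambda>n. I + 1 / real (Suc n)) \<longlonglongrightarrow> I + 0"
      using LIMSEQ_Suc[OF lim_1_over_n, where 'a1=real] by (intro tendsto_intros) auto
    show "\<exists>N. \<forall>n\<ge>N. F u \<le> I + 1 / real (Suc n)"
      using u by (auto simp: c_def)
  qed
  then show ?thesis using I by (metis add.right_neutral order_trans)
qed

lemma convex_on_scaled_norm_square:
  fixes u :: "'a::real_inner"
  assumes "0 \<le> c"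
  shows "convex_on UNIV (\<lambda>w. c * (norm (w - u))\<^sup>2)"
proof (rule convex_onI)
  fix t :: real and x y :: 'a assume t: "0 < t" "t < 1"
  have "(1 - t) * (c * (norm (x - u))\<^sup>2) + t * (c * (norm (y - u))\<^sup>2)
      - c * (norm ((1 - t) *\<^sub>R x + t *\<^sub>R y - u))\<^sup>2 = c * ((t * (1 - t)) * (norm (x - y))\<^sup>2)"
    unfolding power2_norm_eq_inner
    by (simp add: algebra_simps inner_commute)
  moreover have "\<dots> \<ge> 0" using t assms by simp
  ultimately show "c * (norm ((1 - t) *\<^sub>R x + t *\<^sub>R y - u))\<^sup>2
     \<le> (1 - t) * (c * (norm (x - u))\<^sup>2) + t * (c * (norm (y - u))\<^sup>2)" by linarith
qed simp

text \<open>The minimizer of \<open>\<parallel>w\<parallel>\<^sup>2 / 2 - l w\<close> represents \<open>l\<close>: the derivative in every direction vanishes there.\<close>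

lemma Riesz_representation:
  fixes l :: "'a::{real_inner, complete_space} \<Rightarrow> real"
  assumes "bounded_linear l"
  shows "\<exists>u. \<forall>w. l w = inner w u"
proof -
  interpret bounded_linear l by fact
  obtain B where B: "\<And>x. norm (l x) \<le> norm x * B" "B > 0" using pos_bounded by blast
  define F where "F w = (1/2) * (norm (w - 0))\<^sup>2 + - l w" for w
  have lB: "l w \<le> norm w * B" for w using B(1)[of w] by simp
  have lower: "F w \<ge> (1/2) * (norm w)\<^sup>2 - norm w * B" for w
    unfolding F_def using lB[of w] by simp
  have "\<exists>u. \<forall>w. F u \<le> F w"
  proof (rule convex_coercive_attains_minimum)
    show "convex_on UNIV F"
      unfolding F_def
      by (intro convex_on_add convex_on_scaled_norm_square convex_onI) (auto simp: add scaleR)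
    show "continuous_on UNIV F"
      unfolding F_def by (intro continuous_intros linear_continuous_on assms)
    show "F u \<ge> - B\<^sup>2" for u
    proof -
      have "0 \<le> (norm u - B)\<^sup>2" "0 \<le> B\<^sup>2" by simp_all
      then show ?thesis using lower[of u] unfolding power2_diff by argo
    qed
    show "norm u \<le> 2 * B" if "F u \<le> F 0" for u
    proof -
      have "norm u * norm u \<le> norm u * (2 * B)"
        using lower[of u] that by (simp add: F_def zero power2_eq_square)
      then show ?thesis using B(2) by (cases "u = 0") auto
    qed
  qed
  then obtain u where u: "\<And>w. F u \<le> F w" by blast
  have "l w = inner w u" for w
  proof -
    define p where "p t = F (u + t *\<^sub>R w)" for t
    have p: "p t = p 0 + t * (inner w u - l w) + t\<^sup>2 * (1/2 * (norm w)\<^sup>2)" for t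
      unfolding p_def F_def power2_norm_eq_inner
      by (simp add: algebra_simps inner_commute scaleR local.add power2_eq_square)
    have "(p has_real_derivative (inner w u - l w)) (at 0)"
      by (subst p[abs_def]) (auto intro!: derivative_eq_intros)
    then have "inner w u - l w = 0"
      by (rule DERIV_local_min[of _ _ _ 1]) (auto simp: p_def u)
    then show ?thesis by simp
  qed
  then show ?thesis by blast
qed

lemma gradient_has_derivative:
  fixes f :: "'a::{real_inner, complete_space} \<Rightarrow> real"
  assumes "f differentiable (at u)"
  shows "(f has_derivative (\<lambda>h. inner (gradient f u) h)) (at u)"
proof -
  obtain l where l: "(f has_derivative l) (at u)" using assms by (auto simp: differentiable_def)
  obtain D where "\<And>w. l w = inner w D"
    using Riesz_representation[OF has_derivative_bounded_linear[OF l]] by blast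
  then have "l = (\<lambda>h. inner h D)" by blast
  then have D: "GDERIV f u :> D" using l by (simp add: gderiv_def)
  have "gradient f u = D" unfolding gradient_def
  proof (rule the_equality)
    fix D' assume "GDERIV f u :> D'"
    then have "(\<lambda>h. inner h D') = (\<lambda>h. inner h D)"
      using D has_derivative_unique unfolding gderiv_def by blast
    then have "inner (D' - D) (D' - D) = 0" by (metis inner_diff_right right_minus_eq)
    then show "D' = D" by simp
  qed (rule D)
  then show ?thesis using D by (simp add: gderiv_def inner_commute)
qed

section \<open>Subgradients and approximate subgradients\<close>

text \<open>The error term is affine in the distance because this is the error that the difference
  quotients of the velocity produce; these sets remain closed and convex and shrink to the
  subdifferential as \<open>\<epsilon>\<close> tends to \<open>0\<close>.\<close>

definition approx_subdifferential :: "('a::real_inner \<Rightarrow> real) \<Rightarrow> real \<Rightarrow> 'a \<Rightarrow> 'a set" where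
  "approx_subdifferential \<phi> \<epsilon> u = {g. \<forall>w. \<phi> u + inner g (w - u) - \<epsilon> * (1 + norm (w - u)) \<le> \<phi> w}"

lemma approx_subdifferential_0: "approx_subdifferential \<phi> 0 u = subdifferential \<phi> u"
  by (simp add: approx_subdifferential_def subdifferential_def)

lemma approx_subdifferential_mono:
  assumes "\<epsilon> \<le> \<epsilon>'"
  shows "approx_subdifferential \<phi> \<epsilon> u \<subseteq> approx_subdifferential \<phi> \<epsilon>' u"
proof -
  have "\<epsilon> * (1 + norm (w - u)) \<le> \<epsilon>' * (1 + norm (w - u))" for w
    using assms by (intro mult_right_mono) auto
  then show ?thesis unfolding approx_subdifferential_def
    by (auto) (smt (verit))
qed

lemma closed_approx_subdifferential: "closed (approx_subdifferential \<phi> \<epsilon> u)"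
  unfolding approx_subdifferential_def
  by (intro closed_Collect_all closed_Collect_le continuous_intros)

lemma convex_approx_subdifferential: "convex (approx_subdifferential \<phi> \<epsilon> u)"
proof -
  have "approx_subdifferential \<phi> \<epsilon> u =
      (\<Inter>w. {g. inner (w - u) g \<le> \<phi> w - \<phi> u + \<epsilon> * (1 + norm (w - u))})"
    unfolding approx_subdifferential_def by (auto simp: inner_commute algebra_simps)
  then show ?thesis by (simp add: convex_INT convex_halfspace_le)
qed

lemma subgradient_of_approx_subgradients:
  assumes "\<And>n. g \<in> approx_subdifferential \<phi> (1 / real (Suc n)) u"
  shows "g \<in> subdifferential \<phi> u"
  unfolding subdifferential_def
proof (intro CollectI allI)
  fix w
  have "(\<lambda>n. \<phi> u + inner g (w - u) - 1 / real (Suc n) * (1 + norm (w - u)))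
      \<longlonglongrightarrow> \<phi> u + inner g (w - u) - 0 * (1 + norm (w - u))"
    using LIMSEQ_Suc[OF lim_1_over_n, where 'a1=real] by (intro tendsto_intros) auto
  then have "\<phi> u + inner g (w - u) - 0 * (1 + norm (w - u)) \<le> \<phi> w"
    by (rule LIMSEQ_le_const2) (use assms in \<open>auto simp: approx_subdifferential_def\<close>)
  then show "\<phi> u + inner g (w - u) \<le> \<phi> w" by simp
qed

lemma bounded_approx_subgradients_imp_subgradient:
  fixes \<phi> :: "'a::{real_inner, complete_space} \<Rightarrow> real"
  assumes "\<And>n. \<exists>g\<in>approx_subdifferential \<phi> (1 / real (Suc n)) u. norm (g + p) \<le> m"
  shows "\<exists>g\<in>subdifferential \<phi> u. norm (g + p) \<le> m"
proof -
  define C where "C n = (+) p ` approx_subdifferential \<phi> (1 / real (Suc n)) u" for n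
  have "\<exists>x. (\<forall>n. x \<in> C n) \<and> norm x \<le> m"
  proof (rule nested_closed_convex_common_point)
    show "closed (C n)" "convex (C n)" for n
      by (simp_all add: C_def closed_translation closed_approx_subdifferential
          convex_translation convex_approx_subdifferential)
    show "C (Suc n) \<subseteq> C n" for n
      unfolding C_def by (intro image_mono approx_subdifferential_mono) (simp add: frac_le)
    show "\<exists>x\<in>C n. norm x \<le> m" for n
      using assms[of n] by (auto simp: C_def add.commute)
  qed
  then obtain x where x: "\<And>n. x \<in> C n" "norm x \<le> m" by blast
  have "x - p \<in> subdifferential \<phi> u"
    by (rule subgradient_of_approx_subgradients) (use x(1) in \<open>force simp: C_def simp del: of_nat_Suc\<close>)
  then show ?thesis using x(2) by (intro bexI[of _ "x - p"]) auto
qed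

text \<open>The minimizer \<open>v\<close> of \<open>\<phi> w + c / 2 * \<parallel>w - u\<parallel>\<^sup>2\<close> is the proximal point of \<open>u\<close>. Comparing it with the
  points of the segment towards \<open>w\<close> and letting them tend to \<open>v\<close> gives the subgradient inequality.\<close>

lemma proximal_point_exists:
  fixes \<phi> :: "'a::{real_inner, complete_space} \<Rightarrow> real"
  assumes cv: "convex_on UNIV \<phi>" and ct: "continuous_on UNIV \<phi>" and pos: "\<And>u. 0 \<le> \<phi> u"
    and c: "0 < c"
  shows "\<exists>v. c *\<^sub>R (u - v) \<in> subdifferential \<phi> v \<and> \<phi> v + c / 2 * (norm (v - u))\<^sup>2 \<le> \<phi> u"
proof -
  define F where "F w = \<phi> w + c / 2 * (norm (w - u))\<^sup>2" for w
  have "\<exists>v. \<forall>w. F v \<le> F w"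
  proof (rule convex_coercive_attains_minimum)
    show "convex_on UNIV F"
      unfolding F_def using c by (intro convex_on_add convex_on_scaled_norm_square cv) simp
    show "continuous_on UNIV F"
      unfolding F_def by (intro continuous_intros ct)
    show "0 \<le> F w" for w using pos[of w] c by (simp add: F_def)
    show "norm w \<le> norm u + sqrt (2 * F 0 / c)" if "F w \<le> F 0" for w
    proof -
      have "c / 2 * (norm (w - u))\<^sup>2 \<le> F 0" using that pos[of w] by (simp add: F_def)
      then have "(norm (w - u))\<^sup>2 \<le> 2 * F 0 / c" using c by (simp add: field_simps)
      then have "norm (w - u) \<le> sqrt (2 * F 0 / c)" by (rule real_le_rsqrt)
      then show ?thesis using norm_triangle_sub[of w u] by linarith
    qed
  qed
  then obtain v where v: "\<And>w. F v \<le> F w" by blast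
  have "c *\<^sub>R (u - v) \<in> subdifferential \<phi> v"
    unfolding subdifferential_def
  proof (intro CollectI allI)
    fix w
    define A where "A = \<phi> w - \<phi> v + c * inner (v - u) (w - v)"
    have ge: "0 \<le> A + t * (c / 2 * (norm (w - v))\<^sup>2)" if t: "0 < t" "t < 1" for t
    proof -
      define y where "y = (1 - t) *\<^sub>R v + t *\<^sub>R w"
      have 1: "\<phi> y \<le> (1 - t) * \<phi> v + t * \<phi> w"
        unfolding y_def using t by (intro convex_onD[OF cv]) auto
      have y: "y - u = (v - u) + t *\<^sub>R (w - v)" by (simp add: y_def algebra_simps)
      have 2: "(norm (y - u))\<^sup>2 = (norm (v - u))\<^sup>2 + 2 * (t * inner (v - u) (w - v)) + t\<^sup>2 * (norm (w - v))\<^sup>2"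
        unfolding y power2_norm_eq_inner inner_add_left inner_add_right inner_scaleR_left inner_scaleR_right
        by (simp add: inner_commute[of "w - v" "v - u"] power2_eq_square distrib_left)
      have 3: "F v \<le> F y" by (rule v)
      have "0 \<le> t * (A + t * (c / 2 * (norm (w - v))\<^sup>2))"
        using 1 3 unfolding F_def 2 A_def by (simp add: algebra_simps power2_eq_square)
      then show ?thesis using t by (simp add: zero_le_mult_iff)
    qed
    have "0 \<le> A + 0 * (c / 2 * (norm (w - v))\<^sup>2)"
    proof (rule tendsto_lowerbound)
      show "((\<lambda>t. A + t * (c / 2 * (norm (w - v))\<^sup>2)) \<longlongrightarrow> A + 0 * (c / 2 * (norm (w - v))\<^sup>2)) (at_right 0)"
        by (intro tendsto_intros)
      show "\<forall>\<^sub>F t in at_right 0. 0 \<le> A + t * (c / 2 * (norm (w - v))\<^sup>2)"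
        unfolding eventually_at_right[OF zero_less_one] by (intro exI[of _ 1] conjI allI impI ge) auto
    qed simp
    then show "\<phi> v + inner (c *\<^sub>R (u - v)) (w - v) \<le> \<phi> w"
      by (simp add: A_def inner_diff_left algebra_simps)
  qed
  moreover have "F v \<le> F u" by (rule v)
  ultimately show ?thesis by (auto simp: F_def)
qed

text \<open>Subgradients at proximal points tending to \<open>u\<close> are approximate subgradients at \<open>u\<close>. They are
  bounded because \<open>\<phi>\<close> is bounded on a ball around \<open>u\<close>: moving from the proximal point in the
  direction of its subgradient increases \<open>\<phi>\<close> at least at the rate of the norm of that subgradient.\<close>

lemma subdifferential_nonempty:
  fixes \<phi> :: "'a::{real_inner, complete_space} \<Rightarrow> real"
  assumes cv: "convex_on UNIV \<phi>" and ct: "continuous_on UNIV \<phi>" and pos: "\<And>u. 0 \<le> \<phi> u"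
  shows "subdifferential \<phi> u \<noteq> {}"
proof -
  have isc: "isCont \<phi> u" using ct by (simp add: continuous_on_eq_continuous_at)
  obtain d where d: "0 < d" "\<And>y. dist y u < d \<Longrightarrow> dist (\<phi> y) (\<phi> u) < 1"
    using isc unfolding continuous_at_eps_delta by (metis zero_less_one)
  define K where "K = \<phi> u + 1"
  have K: "\<phi> y \<le> K" if "norm (y - u) < d" for y
    using d(2)[of y] that by (auto simp: dist_norm K_def)
  define m where "m = 4 * K / d"
  have "\<exists>g\<in>approx_subdifferential \<phi> (1 / real (Suc n)) u. norm (g + 0) \<le> m" for n
  proof -
    define \<epsilon> where "\<epsilon> = 1 / real (Suc n)"
    have e: "0 < \<epsilon>" by (simp add: \<epsilon>_def)
    have m1: "0 < m + 1" using pos[of u] d(1) by (simp add: m_def K_def add_nonneg_pos)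
    obtain d' where d': "0 < d'" "\<And>y. dist y u < d' \<Longrightarrow> dist (\<phi> y) (\<phi> u) < \<epsilon> / 2"
      using isc e unfolding continuous_at_eps_delta by (metis half_gt_zero)
    \<comment> \<open>The proximal point is to lie within r of u: inside the ball where \<open>\<phi>\<close> is bounded, where \<open>\<phi>\<close> varies by less than \<open>\<epsilon> / 2\<close>, and so close that a subgradient of norm m changes the affine minorant by at most \<open>\<epsilon> / 2\<close>.\<close>
    define r where "r = min (d / 2) (min (d' / 2) (\<epsilon> / (2 * (m + 1))))"
    have r: "0 < r" "r \<le> d / 2" "r < d'" "(m + 1) * r \<le> \<epsilon> / 2"
    proof -
      show "0 < r" using d d' e m1 by (simp add: r_def)
      show "r \<le> d / 2" unfolding r_def by (rule min.cobounded1)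
      have "r \<le> d' / 2" unfolding r_def by (rule min.coboundedI2[OF min.cobounded1])
      then show "r < d'" using d'(1) by linarith
      have "r \<le> \<epsilon> / (2 * (m + 1))" by (simp add: r_def)
      then show "(m + 1) * r \<le> \<epsilon> / 2" using m1 by (simp add: field_simps)
    qed
    \<comment> \<open>With this penalty, \<open>c / 2 * \<parallel>v - u\<parallel>\<^sup>2 \<le> K\<close> forces the proximal point into the ball of radius r.\<close>
    define c where "c = 2 * K / r\<^sup>2"
    have Kpos: "0 < K" using pos[of u] by (simp add: K_def)
    have c: "0 < c" using Kpos r by (simp add: c_def)
    obtain v where v: "c *\<^sub>R (u - v) \<in> subdifferential \<phi> v" "\<phi> v + c / 2 * (norm (v - u))\<^sup>2 \<le> \<phi> u"
      using proximal_point_exists[OF cv ct pos c] by blast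
    define g where "g = c *\<^sub>R (u - v)"
    have "c / 2 * (norm (v - u))\<^sup>2 \<le> K" using v(2) pos[of v] by (simp add: K_def)
    moreover have "c / 2 * r\<^sup>2 = K" using r(1) by (simp add: c_def)
    ultimately have "c / 2 * (norm (v - u))\<^sup>2 \<le> c / 2 * r\<^sup>2" by linarith
    then have "(norm (v - u))\<^sup>2 \<le> r\<^sup>2" using c by (subst (asm) mult_le_cancel_left_pos) auto
    then have vr: "norm (v - u) \<le> r" using r(1) by (rule power2_le_imp_le[OF _ less_imp_le])
    have sub: "\<phi> v + inner g (w - v) \<le> \<phi> w" for w
      using v(1) by (auto simp: subdifferential_def g_def)
    have gm: "norm g \<le> m"
    proof (cases "g = 0")
      case False
      define w where "w = v + (d / (4 * norm g)) *\<^sub>R g"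
      have "norm (w - v) = d / 4" using False d(1) by (simp add: w_def)
      then have "norm (w - u) < d"
        using norm_triangle_ineq[of "w - v" "v - u"] vr r(2) d(1) by simp
      then have "\<phi> v + inner g (w - v) \<le> K" using sub[of w] K[of w] by linarith
      moreover have "inner g (w - v) = d / 4 * norm g"
        using False by (simp add: w_def dot_square_norm power2_eq_square)
      ultimately have "d / 4 * norm g \<le> K" using pos[of v] by simp
      then show ?thesis using d(1) by (simp add: m_def field_simps)
    qed (use pos[of u] d(1) in \<open>simp add: m_def K_def\<close>)
    have "g \<in> approx_subdifferential \<phi> \<epsilon> u"
      unfolding approx_subdifferential_def
    proof (intro CollectI allI)
      fix w
      have "dist v u < d'" using vr r(3) by (simp add: dist_norm)
      from d'(2)[OF this] have "\<phi> u < \<phi> v + \<epsilon> / 2" unfolding dist_real_def by linarith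
      moreover have "inner g (w - u) \<le> inner g (w - v) + \<epsilon> / 2"
      proof -
        have "inner g (v - u) \<le> norm g * norm (v - u)" by (rule norm_cauchy_schwarz)
        also have "\<dots> \<le> (m + 1) * r" using gm vr m1 by (intro mult_mono) auto
        also have "\<dots> \<le> \<epsilon> / 2" by (rule r)
        finally show ?thesis by (simp add: inner_diff_right)
      qed
      moreover have "\<epsilon> \<le> \<epsilon> * (1 + norm (w - u))" using e by simp
      ultimately show "\<phi> u + inner g (w - u) - \<epsilon> * (1 + norm (w - u)) \<le> \<phi> w"
        using sub[of w] by linarith
    qed
    then show ?thesis using gm by (intro bexI[of _ g]) (auto simp: \<epsilon>_def)
  qed
  then show ?thesis using bounded_approx_subgradients_imp_subgradient by blast
qed

lemma minimal_subgradient_exists: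
  fixes \<phi> :: "'a::{real_inner, complete_space} \<Rightarrow> real"
  assumes ne: "subdifferential \<phi> u \<noteq> {}"
  shows "\<exists>g\<in>subdifferential \<phi> u. \<forall>g'\<in>subdifferential \<phi> u. norm (g + p) \<le> norm (g' + p)"
proof -
  define S where "S = (+) p ` subdifferential \<phi> u"
  define m where "m = Inf (norm ` S)"
  have lower: "m \<le> norm x" if "x \<in> S" for x
    unfolding m_def using that by (intro cInf_lower bdd_belowI2[of _ 0]) auto
  define C where "C n = S \<inter> cball 0 (m + 1 / real (Suc n))" for n
  have clS: "closed S" "convex S"
    unfolding S_def approx_subdifferential_0[symmetric]
    by (simp_all add: closed_translation closed_approx_subdifferential
          convex_translation convex_approx_subdifferential)
  have "\<exists>x. (\<forall>n. x \<in> C n) \<and> norm x \<le> m + 1"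
  proof (rule nested_closed_convex_common_point)
    show "closed (C n)" "convex (C n)" for n
      unfolding C_def using clS by (auto intro: closed_Int convex_Int)
    show "C (Suc n) \<subseteq> C n" for n
    proof -
      have "1 / real (Suc (Suc n)) \<le> 1 / real (Suc n)" by (simp add: frac_le)
      then show ?thesis by (auto simp: C_def)
    qed
    show "\<exists>x\<in>C n. norm x \<le> m + 1" for n
    proof -
      have "Inf (norm ` S) < m + 1 / real (Suc n)" by (simp add: m_def)
      then obtain y where "y \<in> norm ` S" "y < m + 1 / real (Suc n)"
        using cInf_lessD[of "norm ` S"] ne unfolding S_def by blast
      then obtain x where "x \<in> S" "norm x < m + 1 / real (Suc n)" by auto
      moreover have "1 / real (Suc n) \<le> 1" by simp
      ultimately have "norm x \<le> m + 1" by linarith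
      then show ?thesis using \<open>x \<in> S\<close> \<open>norm x < m + 1 / real (Suc n)\<close>
        by (intro bexI[of _ x]) (auto simp: C_def)
    qed
  qed
  then obtain x where x: "\<And>n. x \<in> C n" by blast
  have "norm x \<le> m + 0"
  proof (rule LIMSEQ_le_const)
    show "(\<lambda>n. m + 1 / real (Suc n)) \<longlonglongrightarrow> m + 0"
      using LIMSEQ_Suc[OF lim_1_over_n, where 'a1=real] by (intro tendsto_intros) auto
    show "\<exists>N. \<forall>n\<ge>N. norm x \<le> m + 1 / real (Suc n)"
      using x by (auto simp: C_def)
  qed
  moreover obtain g where "g \<in> subdifferential \<phi> u" "x = p + g"
    using x[of 0] by (auto simp: C_def S_def)
  ultimately show ?thesis using lower
    by (intro bexI[of _ g]) (force simp: S_def add.commute)+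
qed

lemma min_norm_subgradient_in_subdifferential:
  fixes \<phi> :: "'a::{real_inner, complete_space} \<Rightarrow> real"
  assumes "subdifferential \<phi> u \<noteq> {}"
  shows "min_norm_subgradient \<phi> u \<in> subdifferential \<phi> u"
proof -
  have "\<exists>g. is_arg_min norm (\<lambda>g. g \<in> subdifferential \<phi> u) g"
    using minimal_subgradient_exists[OF assms, of 0] by (force simp: is_arg_min_linorder)
  then have "is_arg_min norm (\<lambda>g. g \<in> subdifferential \<phi> u) (min_norm_subgradient \<phi> u)"
    unfolding min_norm_subgradient_def arg_min_def by (rule someI_ex)
  then show ?thesis by (simp add: is_arg_min_def)
qed

text \<open>If approximate subgradients with almost minimal norm stayed away from \<open>g0\<close>, their midpoints with
  \<open>g0\<close> would be approximate subgradients with norms bounded away below the minimum, and these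
  produce a genuine subgradient below the minimum. This is what turns a bound on the norms
  of difference quotients into their convergence.\<close>

lemma approx_subgradient_near_minimal_subgradient:
  fixes \<phi> :: "'a::{real_inner, complete_space} \<Rightarrow> real"
  assumes g0: "g0 \<in> subdifferential \<phi> u"
    and min: "\<And>g. g \<in> subdifferential \<phi> u \<Longrightarrow> norm (g0 + p) \<le> norm (g + p)"
    and e: "0 < e"
  shows "\<exists>\<epsilon>>0. \<forall>g\<in>approx_subdifferential \<phi> \<epsilon> u. norm (g + p) \<le> norm (g0 + p) + \<epsilon> \<longrightarrow> norm (g - g0) < e"
proof (rule ccontr)
  assume contra: "\<not> ?thesis"
  define m where "m = norm (g0 + p)"
  have "\<exists>g\<in>approx_subdifferential \<phi> (1 / real (Suc n)) u. norm (g + p) \<le> m + 1 / real (Suc n) \<and> e \<le> norm (g - g0)" for n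
    using contra by (force simp: m_def not_less)
  then obtain g where g: "\<And>n. g n \<in> approx_subdifferential \<phi> (1 / real (Suc n)) u"
    "\<And>n. norm (g n + p) \<le> m + 1 / real (Suc n)" "\<And>n. e \<le> norm (g n - g0)" by metis
  have "(\<lambda>n. (m + 1 / real (Suc n))\<^sup>2) \<longlonglongrightarrow> (m + 0)\<^sup>2"
    using LIMSEQ_Suc[OF lim_1_over_n, where 'a1=real] by (intro tendsto_intros) auto
  moreover have "(m + 0)\<^sup>2 < m\<^sup>2 + e\<^sup>2 / 4" using e by simp
  ultimately have "\<forall>\<^sub>F n in sequentially. (m + 1 / real (Suc n))\<^sup>2 < m\<^sup>2 + e\<^sup>2 / 4"
    by (rule order_tendstoD(2))
  then obtain N where N: "\<And>n. N \<le> n \<Longrightarrow> (m + 1 / real (Suc n))\<^sup>2 < m\<^sup>2 + e\<^sup>2 / 4"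
    by (auto simp: eventually_sequentially)
  \<comment> \<open>The parallelogram law puts the midpoints below this value; the maximum only keeps the root meaningful.\<close>
  define m' where "m' = sqrt (max 0 (m\<^sup>2 - e\<^sup>2 / 8))"
  have "\<exists>g\<in>subdifferential \<phi> u. norm (g + p) \<le> m'"
  proof (rule bounded_approx_subgradients_imp_subgradient)
    fix n
    define k where "k = max n N"
    define h where "h = (1/2) *\<^sub>R (g k + g0)"
    have "g k \<in> approx_subdifferential \<phi> (1 / real (Suc n)) u"
      using g(1)[of k] approx_subdifferential_mono[of "1 / real (Suc k)" "1 / real (Suc n)" \<phi> u]
      by (auto simp: k_def frac_le)
    moreover have "g0 \<in> approx_subdifferential \<phi> (1 / real (Suc n)) u"
      using g0 approx_subdifferential_mono[of 0 "1 / real (Suc n)" \<phi> u]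
      by (auto simp: approx_subdifferential_0)
    ultimately have "h \<in> approx_subdifferential \<phi> (1 / real (Suc n)) u"
      unfolding h_def by (rule convex_midpoint[OF convex_approx_subdifferential])
    moreover have "norm (h + p) \<le> m'"
    proof -
      have eq: "h + p = (1/2) *\<^sub>R ((g k + p) + (g0 + p))"
        by (simp add: h_def algebra_simps flip: scaleR_add_left)
      have "(norm (g k + p))\<^sup>2 \<le> (m + 1 / real (Suc k))\<^sup>2"
        using g(2)[of k] by (intro power_mono) auto
      then have 1: "(norm (g k + p))\<^sup>2 \<le> m\<^sup>2 + e\<^sup>2 / 4" using N[of k] by (simp add: k_def)
      have 2: "e\<^sup>2 \<le> (norm ((g k + p) - (g0 + p)))\<^sup>2"
        using g(3)[of k] e by (intro power_mono) auto
      have "(norm (h + p))\<^sup>2 \<le> m\<^sup>2 - e\<^sup>2 / 8"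
        using parallelogram_midpoint[of "g k + p" "g0 + p"] 1 2 unfolding eq m_def by argo
      then show ?thesis unfolding m'_def by (intro real_le_rsqrt) auto
    qed
    ultimately show "\<exists>g\<in>approx_subdifferential \<phi> (1 / real (Suc n)) u. norm (g + p) \<le> m'" by blast
  qed
  then have le: "m \<le> m'" using min unfolding m_def by fastforce
  have "0 \<le> m" by (simp add: m_def)
  then have "m\<^sup>2 \<le> max 0 (m\<^sup>2 - e\<^sup>2 / 8)"
    using power_mono[OF le, of 2] by (simp add: m'_def)
  then have "m = 0" using e by (auto simp: max_def split: if_splits)
  \<comment> \<open>Here m' is not below m, which leaves only the case where the minimal norm is 0; then the norms themselves tend to 0.\<close>
  have "e \<le> 2 / real (Suc n)" for n
  proof -
    have "norm (g n - g0) \<le> norm (g n + p) + norm (g0 + p)"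
      using norm_triangle_ineq4[of "g n + p" "g0 + p"] by simp
    moreover have "0 \<le> 1 / real (Suc n)" "2 / real (Suc n) = 1 / real (Suc n) + 1 / real (Suc n)"
      by (simp_all add: add_divide_distrib[symmetric])
    ultimately show ?thesis using g(2)[of n] g(3)[of n] \<open>m = 0\<close> unfolding m_def by linarith
  qed
  moreover obtain n where "2 / real (Suc n) < e"
    using reals_Archimedean[of "e / 2"] e by (auto simp: field_simps inverse_eq_divide)
  ultimately show False by (meson not_le)
qed

section \<open>One-sided differential inequalities\<close>

text \<open>For \<open>\<epsilon> > 0\<close>, the last time at which \<open>q t \<le> q c + \<epsilon> * (t - c)\<close> must be the right end, because the
  slope condition would carry the inequality further. Starting at an interior \<open>c\<close> and letting it tend
  to \<open>a\<close> covers the left end, where only continuity is assumed.\<close>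

lemma right_slope_nonpos_imp_le:
  fixes q :: "real \<Rightarrow> real"
  assumes ab: "a \<le> b" and ct: "continuous_on {a..b} q"
    and slope: "\<And>t \<epsilon>. a < t \<Longrightarrow> t < b \<Longrightarrow> 0 < \<epsilon> \<Longrightarrow> \<forall>\<^sub>F s in at_right t. q s \<le> q t + \<epsilon> * (s - t)"
  shows "q b \<le> q a"
proof -
  have from_interior: "q b \<le> q c" if c: "a < c" "c \<le> b" for c
  proof (rule field_le_epsilon)
    fix e :: real assume e: "0 < e"
    define \<epsilon> where "\<epsilon> = e / (b - c + 1)"
    have eps: "0 < \<epsilon>" using e c by (simp add: \<epsilon>_def)
    define r where "r t = q t - q c - \<epsilon> * (t - c)" for t
    have ctr: "continuous_on {c..b} r"
      unfolding r_def using c by (intro continuous_intros continuous_on_subset[OF ct]) auto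
    have "r b \<le> 0"
    proof (rule ccontr)
      assume rb: "\<not> r b \<le> 0"
      define S where "S = {t \<in> {c..b}. r t \<in> {..0}}"
      have "S = {c..b} \<inter> r -` {..0}" by (auto simp: S_def)
      then have "closed S"
        using continuous_closed_preimage[OF ctr closed_atLeastAtMost closed_atMost[of 0]] by simp
      moreover have "bounded S" by (rule bounded_subset[of "{c..b}"]) (auto simp: S_def)
      ultimately have "compact S" by (simp add: compact_eq_bounded_closed)
      moreover have "c \<in> S" using c by (simp add: S_def r_def)
      ultimately obtain t where t: "t \<in> S" "\<And>s. s \<in> S \<Longrightarrow> s \<le> t"
        using compact_attains_sup[of S] by blast
      have tb: "c \<le> t" "t < b" "r t \<le> 0" using t(1) rb by (auto simp: S_def less_le)
      have "\<forall>\<^sub>F s in at_right t. q s \<le> q t + \<epsilon> * (s - t)"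
        using slope[of t \<epsilon>] tb c eps by auto
      moreover have "\<forall>\<^sub>F s in at_right t. t < s \<and> s < b"
        unfolding eventually_at_right[OF tb(2)] using tb(2) by (intro exI[of _ b]) auto
      ultimately have "\<forall>\<^sub>F s in at_right t. s \<in> S \<and> t < s"
      proof eventually_elim
        case (elim s)
        then have "r s \<le> r t" by (simp add: r_def algebra_simps)
        then show ?case using elim tb by (auto simp: S_def)
      qed
      then obtain s where "s \<in> S" "t < s" using eventually_happens[of _ "at_right t"] by auto
      then show False using t(2)[of s] by simp
    qed
    then have "q b \<le> q c + \<epsilon> * (b - c)" by (simp add: r_def)
    also have "\<epsilon> * (b - c) \<le> e"
      using e c by (simp add: \<epsilon>_def field_simps)
    finally show "q b \<le> q c + e" by simp
  qed
  show ?thesis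
  proof (cases "a < b")
    case True
    have "(q \<longlongrightarrow> q a) (at a within {a..b})"
      using ct True by (simp add: continuous_on_def)
    then have "(q \<longlongrightarrow> q a) (at_right a)"
      using True by (simp add: at_within_Icc_at_right)
    moreover have "\<forall>\<^sub>F c in at_right a. q b \<le> q c"
      unfolding eventually_at_right[OF True]
      using from_interior True by (intro exI[of _ b]) (auto intro: less_imp_le)
    ultimately show ?thesis by (intro tendsto_lowerbound) auto
  qed (use ab in simp)
qed

lemma has_right_derivative_slope_le:
  fixes q :: "real \<Rightarrow> real"
  assumes D: "(q has_real_derivative D) (at_right t)" and le: "D < c"
  shows "\<forall>\<^sub>F s in at_right t. q s \<le> q t + c * (s - t)"
proof -
  have "((\<lambda>s. (q s - q t) / (s - t)) \<longlongrightarrow> D) (at_right t)"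
    using D by (simp add: has_field_derivative_iff)
  then have "\<forall>\<^sub>F s in at_right t. (q s - q t) / (s - t) < c"
    by (rule order_tendstoD(2)) (rule le)
  moreover have "\<forall>\<^sub>F s in at_right t. t < s" by (simp add: eventually_at_filter)
  ultimately show ?thesis by eventually_elim (simp add: field_simps)
qed

lemma right_derivative_nonpos_imp_le:
  fixes q :: "real \<Rightarrow> real"
  assumes "a \<le> b" "continuous_on {a..b} q"
    and "\<And>t. a < t \<Longrightarrow> t < b \<Longrightarrow> \<exists>D. (q has_real_derivative D) (at_right t) \<and> D \<le> 0"
  shows "q b \<le> q a"
proof (rule right_slope_nonpos_imp_le[OF assms(1,2)])
  fix t \<epsilon> :: real assume "a < t" "t < b" "0 < \<epsilon>"
  then show "\<forall>\<^sub>F s in at_right t. q s \<le> q t + \<epsilon> * (s - t)"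
    using assms(3)[of t] has_right_derivative_slope_le[of q _ t \<epsilon>] by force
qed

lemma right_derivative_Gronwall:
  fixes q :: "real \<Rightarrow> real"
  assumes ab: "a \<le> b" and ct: "continuous_on {a..b} q"
    and D: "\<And>t. a < t \<Longrightarrow> t < b \<Longrightarrow> \<exists>D. (q has_real_derivative D) (at_right t) \<and> D \<le> K * q t + c"
    and K: "0 \<le> K" and c: "0 \<le> c"
  shows "q b \<le> exp (K * (b - a)) * (q a + c * (b - a))"
proof -
  define p where "p t = exp (- K * (t - a)) * q t - c * (t - a)" for t
  have "p b \<le> p a"
  proof (rule right_derivative_nonpos_imp_le[OF ab])
    show "continuous_on {a..b} p" unfolding p_def by (intro continuous_intros ct)
    fix t assume t: "a < t" "t < b"
    then obtain D where D: "(q has_real_derivative D) (at_right t)" "D \<le> K * q t + c"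
      using D by blast
    let ?e = "exp (- K * (t - a))"
    have "(p has_real_derivative (?e * (D - K * q t) - c)) (at_right t)"
      unfolding p_def by (auto intro!: derivative_eq_intros D(1) simp: algebra_simps)
    moreover have "?e * (D - K * q t) \<le> 1 * c"
    proof -
      have "?e * (D - K * q t) \<le> ?e * c" using D(2) by (intro mult_left_mono) auto
      also have "\<dots> \<le> 1 * c" using K t c by (intro mult_right_mono) auto
      finally show ?thesis .
    qed
    ultimately show "\<exists>D. (p has_real_derivative D) (at_right t) \<and> D \<le> 0" by force
  qed
  then have "exp (- K * (b - a)) * q b \<le> q a + c * (b - a)" by (simp add: p_def)
  then have "exp (K * (b - a)) * (exp (- K * (b - a)) * q b) \<le> exp (K * (b - a)) * (q a + c * (b - a))"
    by (intro mult_left_mono) auto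
  then show ?thesis by (simp flip: mult.assoc exp_add)
qed

lemma right_derivative_le_imp_increment_le:
  fixes q :: "real \<Rightarrow> real"
  assumes ab: "a \<le> b" and ct: "continuous_on {a..b} q"
    and D: "\<And>t. a < t \<Longrightarrow> t < b \<Longrightarrow> \<exists>D. (q has_real_derivative D) (at_right t) \<and> D \<le> c"
  shows "q b \<le> q a + c * (b - a)"
proof -
  have "q b - c * (b - a) \<le> q a - c * (a - a)"
  proof (rule right_derivative_nonpos_imp_le[OF ab])
    show "continuous_on {a..b} (\<lambda>t. q t - c * (t - a))" by (intro continuous_intros ct)
    fix t assume t: "a < t" "t < b"
    then obtain D where D: "(q has_real_derivative D) (at_right t)" "D \<le> c"
      using D by blast
    have "((\<lambda>t. q t - c * (t - a)) has_real_derivative (D - c)) (at_right t)"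
      by (auto intro!: derivative_eq_intros D(1))
    then show "\<exists>D. ((\<lambda>t. q t - c * (t - a)) has_real_derivative D) (at_right t) \<and> D \<le> 0"
      using D(2) by force
  qed
  then show ?thesis by simp
qed

lemma has_vector_derivative_iff_quotient:
  fixes z :: "real \<Rightarrow> 'a::real_normed_vector"
  shows "(z has_vector_derivative D) (at t within S) \<longleftrightarrow>
    ((\<lambda>s. (1 / (s - t)) *\<^sub>R (z s - z t)) \<longlongrightarrow> D) (at t within S)"
proof -
  have "(z has_vector_derivative D) (at t within S) \<longleftrightarrow>
      ((\<lambda>s. norm (z s - z t - (s - t) *\<^sub>R D) / norm (s - t)) \<longlongrightarrow> 0) (at t within S)"
    unfolding has_vector_derivative_def has_derivative_iff_norm
    by (simp add: bounded_linear_scaleR_left)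
  also have "\<dots> \<longleftrightarrow> ((\<lambda>s. norm ((1 / (s - t)) *\<^sub>R (z s - z t) - D)) \<longlongrightarrow> 0) (at t within S)"
  proof (rule filterlim_cong[OF refl refl])
    have "\<forall>\<^sub>F s in at t within S. s \<noteq> t" by (simp add: eventually_at_filter)
    then show "\<forall>\<^sub>F s in at t within S. norm (z s - z t - (s - t) *\<^sub>R D) / norm (s - t) =
        norm ((1 / (s - t)) *\<^sub>R (z s - z t) - D)"
    proof eventually_elim
      case (elim s)
      then have "(1 / (s - t)) *\<^sub>R (z s - z t) - D = (1 / (s - t)) *\<^sub>R (z s - z t - (s - t) *\<^sub>R D)"
        by (simp add: scaleR_diff_right[of _ "z s - z t"])
      then show ?case by simp
    qed
  qed
  also have "\<dots> \<longleftrightarrow> ((\<lambda>s. (1 / (s - t)) *\<^sub>R (z s - z t)) \<longlongrightarrow> D) (at t within S)"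
    by (simp add: tendsto_norm_zero_iff LIM_zero_iff)
  finally show ?thesis .
qed

lemma right_vector_derivative_bound:
  fixes z :: "real \<Rightarrow> 'a::real_normed_vector"
  assumes ab: "a \<le> b" and ct: "continuous_on {a..b} z"
    and D: "\<And>t. a < t \<Longrightarrow> t < b \<Longrightarrow> \<exists>D. (z has_vector_derivative D) (at_right t) \<and> norm D \<le> c"
  shows "norm (z b - z a) \<le> c * (b - a)"
proof -
  have "norm (z b - z a) - c * (b - a) \<le> norm (z a - z a) - c * (a - a)"
  proof (rule right_slope_nonpos_imp_le[OF ab])
    show "continuous_on {a..b} (\<lambda>t. norm (z t - z a) - c * (t - a))" by (intro continuous_intros ct)
    fix t \<epsilon> :: real assume t: "a < t" "t < b" and e: "0 < \<epsilon>"
    then obtain D where D: "(z has_vector_derivative D) (at_right t)" "norm D \<le> c"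
      using D by blast
    have "((\<lambda>s. norm ((1 / (s - t)) *\<^sub>R (z s - z t))) \<longlongrightarrow> norm D) (at_right t)"
      using D(1) unfolding has_vector_derivative_iff_quotient by (rule tendsto_norm)
    then have "\<forall>\<^sub>F s in at_right t. norm ((1 / (s - t)) *\<^sub>R (z s - z t)) < c + \<epsilon>"
      by (rule order_tendstoD(2)) (use D(2) e in simp)
    moreover have "\<forall>\<^sub>F s in at_right t. t < s" by (simp add: eventually_at_filter)
    ultimately show "\<forall>\<^sub>F s in at_right t. norm (z s - z a) - c * (s - a)
        \<le> norm (z t - z a) - c * (t - a) + \<epsilon> * (s - t)"
    proof eventually_elim
      case (elim s)
      then have "norm (z s - z t) / (s - t) < c + \<epsilon>" by simp
      then have "norm (z s - z t) \<le> (c + \<epsilon>) * (s - t)"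
        using elim(2) by (simp add: divide_less_eq)
      moreover have "norm (z s - z a) \<le> norm (z s - z t) + norm (z t - z a)"
        using norm_triangle_ineq[of "z s - z t" "z t - z a"] by simp
      ultimately show ?case by (simp add: algebra_simps)
    qed
  qed
  then show ?thesis by simp
qed

text \<open>The inequality \<open>(q\<^sup>2)' \<le> 2 * c * q\<close> should give \<open>q' \<le> c\<close>, but division by \<open>q\<close> fails where \<open>q = 0\<close>.
  Replacing \<open>q = sqrt p\<close> by \<open>sqrt (p + e\<^sup>2) \<ge> e\<close> makes the division harmless.\<close>

lemma right_slope_of_square_imp_growth_le:
  fixes p :: "real \<Rightarrow> real"
  assumes ab: "a \<le> b" and ct: "continuous_on {a..b} p" and pos: "\<And>t. a \<le> t \<Longrightarrow> t \<le> b \<Longrightarrow> 0 \<le> p t"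
    and c: "0 \<le> c"
    and slope: "\<And>t \<epsilon>. a < t \<Longrightarrow> t < b \<Longrightarrow> 0 < \<epsilon> \<Longrightarrow>
        \<forall>\<^sub>F s in at_right t. p s \<le> p t + (2 * c * sqrt (p t) + \<epsilon>) * (s - t)"
  shows "sqrt (p b) \<le> sqrt (p a) + c * (b - a)"
proof (rule field_le_epsilon)
  fix e :: real assume e: "0 < e"
  define r where "r t = sqrt (p t + e\<^sup>2)" for t
  have "r b - c * (b - a) \<le> r a - c * (a - a)"
  proof (rule right_slope_nonpos_imp_le[OF ab])
    show "continuous_on {a..b} (\<lambda>t. r t - c * (t - a))" unfolding r_def by (intro continuous_intros ct)
    fix t \<epsilon> :: real assume t: "a < t" "t < b" and eps: "0 < \<epsilon>"
    have rt: "e \<le> r t" "sqrt (p t) \<le> r t" "0 < r t"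
    proof -
      show "e \<le> r t" unfolding r_def using pos[of t] t by (intro real_le_rsqrt) simp
      then show "0 < r t" using e by linarith
      show "sqrt (p t) \<le> r t" unfolding r_def by simp
    qed
    have "\<forall>\<^sub>F s in at_right t. p s \<le> p t + (2 * c * sqrt (p t) + 2 * e * \<epsilon>) * (s - t)"
      using slope[OF t] e eps by simp
    moreover have "\<forall>\<^sub>F s in at_right t. t < s \<and> s < b"
      unfolding eventually_at_right[OF t(2)] using t by (intro exI[of _ b]) auto
    ultimately show "\<forall>\<^sub>F s in at_right t. r s - c * (s - a) \<le> r t - c * (t - a) + \<epsilon> * (s - t)"
    proof eventually_elim
      case (elim s)
      have "2 * r t * (r s - r t) \<le> (r s)\<^sup>2 - (r t)\<^sup>2"
        using zero_le_power2[of "r s - r t"] by (simp add: power2_eq_square algebra_simps)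
      also have "\<dots> = p s - p t"
        unfolding r_def using pos[of s] pos[of t] elim t by simp
      also have "\<dots> \<le> (2 * c * sqrt (p t) + 2 * e * \<epsilon>) * (s - t)" using elim by simp
      also have "\<dots> \<le> (2 * c * r t + 2 * r t * \<epsilon>) * (s - t)"
        using elim rt c eps by (intro mult_right_mono add_mono mult_left_mono) auto
      also have "\<dots> = 2 * r t * ((c + \<epsilon>) * (s - t))" by (simp add: algebra_simps)
      finally have "r s - r t \<le> (c + \<epsilon>) * (s - t)" using rt(3) by simp
      then show ?case by (simp add: algebra_simps)
    qed
  qed
  moreover have "sqrt (p b) \<le> r b" unfolding r_def by simp
  moreover have "r a \<le> sqrt (p a) + e"
    unfolding r_def using sqrt_add_le_add_sqrt[of "p a" "e\<^sup>2"] pos[of a] ab e by simp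
  ultimately show "sqrt (p b) \<le> sqrt (p a) + c * (b - a) + e" by simp
qed

lemma open_superset_of_negligible:
  fixes N :: "real set" and e :: real
  assumes "negligible N" "0 < e"
  obtains U where "open U" "N \<subseteq> U" "U \<in> lmeasurable" "measure lebesgue U < e"
proof -
  have N: "N \<in> sets lebesgue" "emeasure lebesgue N = 0"
    using assms(1) by (auto simp: negligible_iff_null_sets null_sets_def)
  obtain U where U: "open U" "N \<subseteq> U" "U - N \<in> lmeasurable" "emeasure lebesgue (U - N) < ennreal e"
    using sets_lebesgue_outer_open[OF N(1) assms(2)] .
  have NL: "N \<in> lmeasurable" using assms(1) by (simp add: negligible_imp_measurable)
  have Ueq: "U = (U - N) \<union> N" using U(2) by blast
  have "U \<in> lmeasurable" by (subst Ueq) (intro fmeasurable.Un U NL)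
  moreover have "measure lebesgue U < e"
  proof -
    have "measure lebesgue U \<le> measure lebesgue (U - N) + measure lebesgue N"
      by (subst Ueq) (rule measure_Un_le; use U NL in auto)
    also have "measure lebesgue N = 0" using assms(1) by (simp add: negligible_imp_measure0)
    also have "measure lebesgue (U - N) < e"
      using U(4) assms(2) U(3) by (simp add: emeasure_eq_measure2 ennreal_less_iff)
    finally show ?thesis by simp
  qed
  ultimately show ?thesis using that U by blast
qed

text \<open>Cover the exceptional null set by an open set \<open>U\<close> of small measure and subtract from \<open>q\<close> the
  function \<open>L * measure (U \<inter> {a..t})\<close>. On \<open>U\<close> it grows with slope \<open>L\<close>, which absorbs any growth of \<open>q\<close>;
  off \<open>U\<close> the derivative of \<open>q\<close> is nonpositive. So the one-sided criterion applies at every time, and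
  the total correction is small.\<close>

lemma lipschitz_derivative_nonpos_ae_imp_le:
  fixes q :: "real \<Rightarrow> real"
  assumes ab: "a \<le> b" and lip: "L-lipschitz_on {a..b} q" and N: "negligible N"
    and D: "\<And>t. a < t \<Longrightarrow> t < b \<Longrightarrow> t \<notin> N \<Longrightarrow> \<exists>D. (q has_real_derivative D) (at t) \<and> D \<le> 0"
  shows "q b \<le> q a"
proof (rule field_le_epsilon)
  fix e :: real assume e: "0 < e"
  have L: "0 \<le> L" using lip by (rule lipschitz_on_nonneg)
  obtain U where U: "open U" "N \<subseteq> U" "U \<in> lmeasurable" "measure lebesgue U < e / (L + 1)"
    using open_superset_of_negligible[OF N, of "e / (L + 1)"] e L by auto
  define u where "u t = measure lebesgue (U \<inter> {a..t})" for t
  have meas: "U \<inter> {s..t} \<in> lmeasurable" "U \<inter> {s<..t} \<in> lmeasurable" for s t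
    using U(3) by (auto intro: fmeasurable_Int_fmeasurable)
  have u_diff: "u s - u t = measure lebesgue (U \<inter> {t<..s})" if "a \<le> t" "t \<le> s" for s t
  proof -
    have "U \<inter> {a..s} = (U \<inter> {a..t}) \<union> (U \<inter> {t<..s})" using that by auto
    moreover have disj: "U \<inter> {a..t} \<inter> (U \<inter> {t<..s}) = {}" by auto
    ultimately have "u s = u t + measure lebesgue (U \<inter> {t<..s})"
      unfolding u_def using measure_Un3[OF meas(1)[of a t] meas(2)[of t s]]
      by (simp add: disj)
    then show ?thesis by simp
  qed
  have u_mono: "u t \<le> u s" if "a \<le> t" "t \<le> s" for s t
    using u_diff[OF that] measure_nonneg by (metis diff_ge_0_iff_ge)
  have u_lip: "1-lipschitz_on {a..b} u"
  proof (rule lipschitz_on_leI)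
    fix s t assume st: "s \<in> {a..b}" "t \<in> {a..b}" "s \<le> t"
    have "measure lebesgue (U \<inter> {s<..t}) \<le> measure lebesgue {s<..t}"
      by (rule measure_mono_fmeasurable) (use meas(2)[of s t] in
          \<open>auto intro: bounded_set_imp_lmeasurable\<close>)
    then show "dist (u s) (u t) \<le> 1 * dist s t"
      using u_diff[of s t] u_mono[of s t] st by (simp add: dist_real_def)
  qed simp
  have "q b - L * u b \<le> q a - L * u a"
  proof (rule right_slope_nonpos_imp_le[OF ab])
    show "continuous_on {a..b} (\<lambda>t. q t - L * u t)"
      using lipschitz_on_continuous_on[OF lip] lipschitz_on_continuous_on[OF u_lip]
      by (intro continuous_intros)
    fix t \<epsilon> :: real assume t: "a < t" "t < b" and eps: "0 < \<epsilon>"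
    have tb: "\<forall>\<^sub>F s in at_right t. t < s \<and> s < b"
      unfolding eventually_at_right[OF t(2)] using t by (intro exI[of _ b]) auto
    show "\<forall>\<^sub>F s in at_right t. q s - L * u s \<le> q t - L * u t + \<epsilon> * (s - t)"
    proof (cases "t \<in> U")
      case True
      then obtain d where d: "0 < d" "ball t d \<subseteq> U" using U(1) open_contains_ball by blast
      have "\<forall>\<^sub>F s in at_right t. t < s \<and> s < t + d"
        unfolding eventually_at_right[OF less_add_same_cancel1[THEN iffD2, OF d(1)]]
        using d(1) by (intro exI[of _ "t + d"]) auto
      with tb show ?thesis
      proof eventually_elim
        case (elim s)
        have "{t<..s} \<subseteq> U" using elim d(2) by (auto simp: dist_real_def subset_iff)
        then have "U \<inter> {t<..s} = {t<..s}" by blast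
        then have "u s - u t = s - t" using u_diff[of t s] elim t by simp
        then have "u s = u t + (s - t)" by simp
        then have eq: "L * u s = L * u t + L * (s - t)" by (simp only: distrib_left)
        have "dist (q s) (q t) \<le> L * dist s t" using elim t by (intro lipschitz_onD[OF lip]) auto
        then have "q s \<le> q t + L * (s - t)" using elim by (simp add: dist_real_def)
        moreover have "0 \<le> \<epsilon> * (s - t)" using eps elim by simp
        ultimately show ?case using eq by linarith
      qed
    next
      case False
      then obtain D where "(q has_real_derivative D) (at t)" "D \<le> 0" using D[OF t] U(2) by blast
      then have "\<forall>\<^sub>F s in at_right t. q s \<le> q t + \<epsilon> * (s - t)"
        using eps by (intro has_right_derivative_slope_le[of q D])
          (auto intro: has_field_derivative_at_within)
      with tb show ?thesis
      proof eventually_elim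
        case (elim s)
        have "L * u t \<le> L * u s" using u_mono[of t s] elim t L by (intro mult_left_mono) auto
        then show ?case using elim by linarith
      qed
    qed
  qed
  moreover have "u a = 0" unfolding u_def by (rule negligible_imp_measure0) auto
  moreover have "L * u b \<le> e"
  proof -
    have "u b \<le> measure lebesgue U" unfolding u_def by (rule measure_mono_fmeasurable) (use U(3) in auto)
    then have "L * u b \<le> L * (e / (L + 1))" using U(4) L by (intro mult_left_mono) auto
    also have "\<dots> \<le> e" using L e by (simp add: field_simps)
    finally show ?thesis .
  qed
  ultimately show "q b \<le> q a + e" by simp
qed

section \<open>The vector field of the damped system\<close>

lemma has_real_derivative_norm_square:
  fixes z :: "real \<Rightarrow> 'a::real_inner"
  assumes "(z has_vector_derivative D) (at t within S)"
  shows "((\<lambda>s. (norm (z s - w))\<^sup>2) has_real_derivative 2 * inner D (z t - w)) (at t within S)"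
proof -
  have z: "(z has_derivative (\<lambda>h. h *\<^sub>R D)) (at t within S)"
    using assms by (simp add: has_vector_derivative_def)
  have "((\<lambda>s. inner (z s - w) (z s - w)) has_derivative
      (\<lambda>h. inner (z t - w) (h *\<^sub>R D - 0) + inner (h *\<^sub>R D - 0) (z t - w))) (at t within S)"
    by (intro has_derivative_inner has_derivative_diff z has_derivative_const)
  then show ?thesis
    unfolding power2_norm_eq_inner
    by (rule has_derivative_imp_has_field_derivative) (simp add: inner_commute)
qed

locale damped_inertial_system =
  fixes f \<phi> :: "'h::{real_inner, complete_space} \<Rightarrow> real"
    and x0 x1 :: 'h
  assumes differentiable: "\<forall>u. f differentiable (at u)"
    and gradient_lipschitz: "\<forall>B. bounded B \<longrightarrow> (\<exists>L. L-lipschitz_on B (gradient f))"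
    and below: "bdd_below (range f)"
    and damping: "damping_potential \<phi>"
begin

abbreviation friction :: "'h \<Rightarrow> 'h" where
  "friction \<equiv> min_norm_subgradient \<phi>"

lemma phi_nonneg: "0 \<le> \<phi> u"
  and phi_convex: "convex_on UNIV \<phi>"
  and phi_continuous: "continuous_on UNIV \<phi>"
  and phi_zero: "\<phi> 0 = 0"
  using damping by (auto simp: damping_potential_def)

lemma subdifferential_phi_nonempty: "subdifferential \<phi> v \<noteq> {}"
  by (rule subdifferential_nonempty[OF phi_convex phi_continuous phi_nonneg])

lemma friction_subgradient: "friction v \<in> subdifferential \<phi> v"
  by (rule min_norm_subgradient_in_subdifferential[OF subdifferential_phi_nonempty])

lemma subgradient_monotone:
  assumes "g \<in> subdifferential \<phi> v" "g' \<in> subdifferential \<phi> v'"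
  shows "0 \<le> inner (g - g') (v - v')"
proof -
  have "\<phi> v + inner g (v' - v) \<le> \<phi> v'" "\<phi> v' + inner g' (v - v') \<le> \<phi> v"
    using assms by (auto simp: subdifferential_def)
  then show ?thesis by (simp add: inner_diff_left inner_diff_right)
qed

text \<open>A single \<open>K\<close> serves for all the bounds on a ball, so that the estimates carry one constant.
  Taking \<open>R\<close> and \<open>K\<close> at least \<open>1\<close> keeps them positive and lets \<open>K\<close> absorb the coupling term of the field.\<close>

definition controlled_on_ball :: "real \<Rightarrow> real \<Rightarrow> bool" where
  "controlled_on_ball R K \<longleftrightarrow> 1 \<le> R \<and> 1 \<le> K \<and>
     (\<forall>v. norm v \<le> R \<longrightarrow> norm (friction v) \<le> K) \<and>
     (\<forall>x. norm x \<le> R \<longrightarrow> norm (gradient f x) \<le> K) \<and>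
     (\<forall>u v. norm u \<le> R \<longrightarrow> norm v \<le> R \<longrightarrow> \<phi> u - \<phi> v \<le> K * norm (u - v)) \<and>
     (\<forall>x y. norm x \<le> R \<longrightarrow> norm y \<le> R \<longrightarrow> norm (gradient f x - gradient f y) \<le> K * norm (x - y))"

text \<open>The Lipschitz bound for \<open>\<phi>\<close> comes from the subgradient inequality at \<open>u\<close> and the bound on the
  subgradients of minimal norm.\<close>

lemma controlled_on_ball_exists:
  assumes R: "1 \<le> R"
  shows "\<exists>K. controlled_on_ball R K"
proof -
  have "bdd_above ((\<lambda>u. norm (friction u)) ` cball 0 R)"
    using damping R by (simp add: damping_potential_def)
  then obtain M1 where M1: "\<And>v. norm v \<le> R \<Longrightarrow> norm (friction v) \<le> M1"
    unfolding bdd_above_def by fastforce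
  obtain L where L: "L-lipschitz_on (cball 0 R) (gradient f)"
    using gradient_lipschitz bounded_cball by blast
  have L0: "0 \<le> L" using L by (rule lipschitz_on_nonneg)
  have lip: "norm (gradient f x - gradient f y) \<le> L * norm (x - y)" if "norm x \<le> R" "norm y \<le> R" for x y
    using lipschitz_onD[OF L, of x y] that by (simp add: dist_norm)
  define K where "K = 1 + \<bar>M1\<bar> + L + norm (gradient f 0) + L * R"
  have K: "1 \<le> K" "M1 \<le> K" "L \<le> K" "norm (gradient f 0) + L * R \<le> K"
  proof -
    have "0 \<le> L * R" "0 \<le> norm (gradient f 0)" "0 \<le> \<bar>M1\<bar>" "M1 \<le> \<bar>M1\<bar>" using L0 R by simp_all
    then show "1 \<le> K" "M1 \<le> K" "L \<le> K" "norm (gradient f 0) + L * R \<le> K"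
      unfolding K_def using L0 by linarith+
  qed
  have fr: "norm (friction v) \<le> K" if "norm v \<le> R" for v using M1[OF that] K by linarith
  have "norm (gradient f x) \<le> K" if "norm x \<le> R" for x
  proof -
    have "norm (gradient f x - gradient f 0) \<le> L * norm (x - 0)" using lip[of x 0] that R by simp
    also have "\<dots> \<le> L * R" using L0 that by (intro mult_left_mono) auto
    finally show ?thesis
      using norm_triangle_sub[of "gradient f x" "gradient f 0"] K(4) by linarith
  qed
  moreover have "\<phi> u - \<phi> v \<le> K * norm (u - v)" if "norm u \<le> R" for u v
  proof -
    have "\<phi> u + inner (friction u) (v - u) \<le> \<phi> v"
      using friction_subgradient[of u] by (simp add: subdifferential_def)
    then have "\<phi> u - \<phi> v \<le> inner (friction u) (u - v)" by (simp add: inner_diff_right)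
    also have "\<dots> \<le> norm (friction u) * norm (u - v)" by (rule norm_cauchy_schwarz)
    also have "\<dots> \<le> K * norm (u - v)" using fr[OF that] by (intro mult_right_mono) auto
    finally show ?thesis .
  qed
  moreover have "norm (gradient f x - gradient f y) \<le> K * norm (x - y)" if "norm x \<le> R" "norm y \<le> R" for x y
    using lip[OF that] mult_right_mono[OF K(3), of "norm (x - y)"] by simp
  ultimately show ?thesis using fr K(1) R unfolding controlled_on_ball_def by blast
qed

lemma controlled_on_ballD:
  assumes "controlled_on_ball R K"
  shows "1 \<le> R" "1 \<le> K"
    "\<And>v. norm v \<le> R \<Longrightarrow> norm (friction v) \<le> K"
    "\<And>x. norm x \<le> R \<Longrightarrow> norm (gradient f x) \<le> K"
    "\<And>u v. norm u \<le> R \<Longrightarrow> norm v \<le> R \<Longrightarrow> \<phi> u - \<phi> v \<le> K * norm (u - v)"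
    "\<And>x y. norm x \<le> R \<Longrightarrow> norm y \<le> R \<Longrightarrow> norm (gradient f x - gradient f y) \<le> K * norm (x - y)"
  using assms by (auto simp: controlled_on_ball_def)

lemma potential_descent:
  assumes RK: "controlled_on_ball R K" and x: "norm x \<le> R" and y: "norm y \<le> R"
  shows "f y \<le> f x + inner (gradient f x) (y - x) + K * (norm (y - x))\<^sup>2"
proof -
  define p where "p t = f (x + t *\<^sub>R (y - x))" for t
  have D: "(p has_real_derivative inner (gradient f (x + t *\<^sub>R (y - x))) (y - x)) (at t)" for t
  proof -
    have "(f has_derivative (\<lambda>h. inner (gradient f (x + t *\<^sub>R (y - x))) h)) (at (x + t *\<^sub>R (y - x)))"
      using gradient_has_derivative differentiable by blast
    moreover have "((\<lambda>t. x + t *\<^sub>R (y - x)) has_derivative (\<lambda>h. h *\<^sub>R (y - x))) (at t)"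
      by (auto intro!: derivative_eq_intros)
    ultimately have "(p has_derivative (\<lambda>h. inner (gradient f (x + t *\<^sub>R (y - x))) (h *\<^sub>R (y - x)))) (at t)"
      unfolding p_def by (rule has_derivative_compose[rotated])
    then show ?thesis
      by (rule has_derivative_imp_has_field_derivative) simp
  qed
  obtain t where t: "0 < t" "t < 1" "p 1 - p 0 = (1 - 0) * inner (gradient f (x + t *\<^sub>R (y - x))) (y - x)"
    using MVT2[OF zero_less_one, of p "\<lambda>t. inner (gradient f (x + t *\<^sub>R (y - x))) (y - x)"] D by blast
  define w where "w = x + t *\<^sub>R (y - x)"
  have w: "norm w \<le> R"
  proof -
    have "w = (1 - t) *\<^sub>R x + t *\<^sub>R y" by (simp add: w_def algebra_simps)
    then show ?thesis using convexD[OF convex_cball[of 0 R], of x y "1 - t" t] x y t by simp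
  qed
  have "inner (gradient f w - gradient f x) (y - x) \<le> norm (gradient f w - gradient f x) * norm (y - x)"
    by (rule norm_cauchy_schwarz)
  also have "\<dots> \<le> (K * norm (w - x)) * norm (y - x)"
    using controlled_on_ballD(6)[OF RK w x] by (intro mult_right_mono) auto
  also have "\<dots> \<le> (K * norm (y - x)) * norm (y - x)"
    using t controlled_on_ballD(2)[OF RK]
    by (intro mult_right_mono mult_left_mono) (auto simp: w_def mult_left_le_one_le)
  finally have "inner (gradient f w) (y - x) - inner (gradient f x) (y - x) \<le> K * (norm (y - x))\<^sup>2"
    by (simp add: inner_diff_left power2_eq_square)
  moreover have "f y - f x = inner (gradient f w) (y - x)"
    using t(3) by (simp add: p_def w_def)
  ultimately show ?thesis by linarith
qed

text \<open>The element of \<open>F (x, v)\<close> that belongs to the subgradient \<open>g\<close>. Keeping \<open>g\<close> as a parameter lets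
  the same one-sided Lipschitz estimate serve Euler steps, the limit and arbitrary solutions.\<close>

definition velocity_field :: "'h \<Rightarrow> 'h \<times> 'h \<Rightarrow> 'h \<times> 'h" where
  "velocity_field g z = (snd z, - (g + gradient f (fst z)))"

lemma norm_pair_components:
  fixes z :: "'h \<times> 'h"
  shows "norm (fst z) \<le> norm z" "norm (snd z) \<le> norm z"
  using norm_fst_le[of "fst z" "snd z"] norm_snd_le[of "snd z" "fst z"] by auto

text \<open>The friction terms contribute with a favourable sign by monotonicity; only the linear coupling and
  the Lipschitz gradient remain.\<close>

lemma velocity_field_one_sided_lipschitz:
  assumes RK: "controlled_on_ball R K" and z: "norm z \<le> R" "norm z' \<le> R"
    and g: "g \<in> subdifferential \<phi> (snd z)" "g' \<in> subdifferential \<phi> (snd z')"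
  shows "inner (velocity_field g z - velocity_field g' z') (z - z') \<le> 2 * K * (norm (z - z'))\<^sup>2"
proof -
  define a b where "a = fst z - fst z'" and "b = snd z - snd z'"
  define G where "G = gradient f (fst z) - gradient f (fst z')"
  have K: "1 \<le> K" by (rule controlled_on_ballD(2)[OF RK])
  have "norm G \<le> K * norm a"
    unfolding G_def a_def using z norm_pair_components[of z] norm_pair_components[of z']
    by (intro controlled_on_ballD(6)[OF RK]) auto
  have ab: "norm a \<le> norm (z - z')" "norm b \<le> norm (z - z')"
    using norm_pair_components[of "z - z'"] by (auto simp: a_def b_def)
  have "inner (velocity_field g z - velocity_field g' z') (z - z')
      = inner b a - inner (g - g') b - inner G b"
    by (simp add: velocity_field_def inner_prod_def a_def b_def G_def algebra_simps)
  moreover have "0 \<le> inner (g - g') b" unfolding b_def by (rule subgradient_monotone[OF g])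
  moreover have "inner b a \<le> norm (z - z') * norm (z - z')"
    using norm_cauchy_schwarz[of b a] mult_mono[OF ab(2,1)] by force
  moreover have "- inner G b \<le> (K * norm (z - z')) * norm (z - z')"
  proof -
    have "- inner G b \<le> norm G * norm b" using norm_cauchy_schwarz[of "- G" b] by simp
    also have "\<dots> \<le> (K * norm a) * norm (z - z')"
      using \<open>norm G \<le> K * norm a\<close> ab K by (intro mult_mono) auto
    also have "\<dots> \<le> (K * norm (z - z')) * norm (z - z')"
      using ab K by (intro mult_right_mono mult_left_mono) auto
    finally show ?thesis .
  qed
  moreover have "norm (z - z') * norm (z - z') \<le> K * (norm (z - z') * norm (z - z'))"
    using K by (simp add: mult_le_cancel_right1)
  ultimately show ?thesis by (simp add: power2_eq_square)
qed

section \<open>Explicit Euler polygons\<close>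

abbreviation field :: "'h \<times> 'h \<Rightarrow> 'h \<times> 'h" where
  "field z \<equiv> velocity_field (friction (snd z)) z"

lemma norm_field_le:
  assumes RK: "controlled_on_ball R K" and z: "norm z \<le> R"
  shows "norm (field z) \<le> R + 2 * K"
proof -
  have c: "norm (fst z) \<le> R" "norm (snd z) \<le> R" using norm_pair_components[of z] z by auto
  have "norm (field z) \<le> norm (snd z) + norm (- (friction (snd z) + gradient f (fst z)))"
    unfolding velocity_field_def by (rule norm_Pair_le)
  also have "norm (- (friction (snd z) + gradient f (fst z))) \<le> norm (friction (snd z)) + norm (gradient f (fst z))"
    by (simp only: norm_minus_cancel norm_triangle_ineq)
  finally show ?thesis
    using c controlled_on_ballD(3)[OF RK c(2)] controlled_on_ballD(4)[OF RK c(1)] by linarith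
qed

fun euler :: "real \<Rightarrow> nat \<Rightarrow> 'h \<times> 'h" where
  "euler h 0 = (x0, x1)"
| "euler h (Suc n) = euler h n + h *\<^sub>R field (euler h n)"

text \<open>The energy \<open>\<parallel>v\<parallel>\<^sup>2 / 2 + f x\<close> decreases along the flow since \<open>\<langle>g, v\<rangle> \<ge> 0\<close>, and one explicit step violates
  this by at most \<open>C * h\<^sup>2\<close> as long as the iterates stay in the ball of radius \<open>R\<close>. Up to time \<open>T\<close> the
  violations add up to at most \<open>T * C * h \<le> 1\<close>, which bounds \<open>v\<close> by \<open>W\<close>, because \<open>f\<close> is bounded below, and
  then \<open>x\<close> by \<open>\<parallel>x0\<parallel> + T * W\<close>. The radius \<open>R\<close> is chosen from these bounds in advance, so the
  induction closes.\<close>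

lemma euler_bounded:
  assumes T: "0 < T"
  shows "\<exists>R\<ge>1. \<exists>h0>0. \<forall>h n. 0 < h \<longrightarrow> h \<le> h0 \<longrightarrow> real n * h \<le> T \<longrightarrow> norm (euler h n) \<le> R"
proof -
  obtain b where b: "\<And>u. b \<le> f u" using below by (auto simp: bdd_below_def)
  define e0 where "e0 = 1/2 * (norm x1)\<^sup>2 + f x0"
  have e0: "b \<le> e0" using b[of x0] by (simp add: e0_def add_increasing)
  \<comment> \<open>At this speed the total energy is at least e0 + 1, one more than its initial value e0, because f is at least b.\<close>
  define W where "W = sqrt (2 * (e0 + 1 - b))"
  have W: "0 \<le> W" "W\<^sup>2 = 2 * (e0 + 1 - b)" using e0 by (auto simp: W_def)
  define X where "X = norm x0 + T * W"
  define R where "R = X + W + 1"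
  have X: "0 \<le> X" using W T by (simp add: X_def)
  have R1: "1 \<le> R" using X W by (simp add: R_def)
  obtain K where RK: "controlled_on_ball R K" using controlled_on_ball_exists[OF R1] by blast
  have K: "1 \<le> K" by (rule controlled_on_ballD(2)[OF RK])
  define C where "C = K * W\<^sup>2 + 2 * K\<^sup>2"
  have C: "0 < C" using K W(1) by (auto simp: C_def intro!: add_nonneg_pos mult_nonneg_nonneg)
  define h0 where "h0 = 1 / (T * C)"
  have h0: "0 < h0" using T C by (simp add: h0_def)
  have main: "norm (snd (euler h n)) \<le> W \<and> norm (fst (euler h n)) \<le> norm x0 + real n * h * W \<and>
      1/2 * (norm (snd (euler h n)))\<^sup>2 + f (fst (euler h n)) \<le> e0 + real n * (h\<^sup>2 * C)"
    if h: "0 < h" "h \<le> h0" and n: "real n * h \<le> T" for h n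
    using n
  proof (induction n)
    case 0
    have "(norm x1)\<^sup>2 \<le> W\<^sup>2" unfolding W(2) e0_def using b[of x0] by simp
    then show ?case using W(1) by (auto simp: e0_def intro: power2_le_imp_le)
  next
    case (Suc n)
    define x v where "x = fst (euler h n)" and "v = snd (euler h n)"
    define x' v' where "x' = x + h *\<^sub>R v" and "v' = v - h *\<^sub>R (friction v + gradient f x)"
    have e: "fst (euler h (Suc n)) = x'" "snd (euler h (Suc n)) = v'"
      by (simp_all add: x_def v_def x'_def v'_def velocity_field_def scaleR_minus_right[symmetric]
          del: scaleR_minus_right minus_add_distrib)
    have nT: "real n * h \<le> T" using Suc.prems h by (simp add: algebra_simps)
    note IH = Suc.IH[OF nT, folded x_def v_def]
    have nX: "norm x0 + t * W \<le> X" if "t \<le> T" for t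
      unfolding X_def using that W(1) by (simp add: mult_right_mono)
    have x: "norm x \<le> R" using IH nX[OF nT] W(1) by (simp add: R_def)
    have v: "norm v \<le> R" using IH X by (simp add: R_def)
    have x'b: "norm x' \<le> norm x0 + real (Suc n) * h * W"
    proof -
      have "norm x' \<le> norm x + h * norm v" unfolding x'_def using norm_triangle_ineq[of x "h *\<^sub>R v"] h by simp
      also have "h * norm v \<le> h * W" using IH h by (intro mult_left_mono) auto
      finally show ?thesis using IH by (simp add: algebra_simps)
    qed
    have x': "norm x' \<le> R" using x'b nX[OF Suc.prems] W(1) by (simp add: R_def)
    have fv: "norm (friction v + gradient f x) \<le> 2 * K"
      using norm_triangle_ineq[of "friction v" "gradient f x"] controlled_on_ballD(3)[OF RK v]
        controlled_on_ballD(4)[OF RK x] by linarith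
    have "0 \<le> inner (friction v - 0) (v - 0)"
    proof (rule subgradient_monotone[OF friction_subgradient])
      show "0 \<in> subdifferential \<phi> 0"
        using phi_nonneg phi_zero by (simp add: subdifferential_def)
    qed
    then have fric: "0 \<le> h * inner (friction v) v" using h by simp
    have "f x' \<le> f x + inner (gradient f x) (x' - x) + K * (norm (x' - x))\<^sup>2"
      by (rule potential_descent[OF RK x x'])
    moreover have "K * (norm (x' - x))\<^sup>2 \<le> K * (h\<^sup>2 * W\<^sup>2)"
      using IH h K by (intro mult_left_mono) (auto simp: x'_def power_mult_distrib intro!: mult_left_mono power_mono)
    ultimately have pot: "f x' \<le> f x + h * inner (gradient f x) v + K * (h\<^sup>2 * W\<^sup>2)"
      by (simp add: x'_def)
    have "(norm v')\<^sup>2 = (norm v)\<^sup>2 - 2 * h * inner (friction v + gradient f x) v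
        + h\<^sup>2 * (norm (friction v + gradient f x))\<^sup>2"
      unfolding v'_def power2_norm_eq_inner
      by (simp add: inner_diff_left inner_diff_right inner_commute power2_eq_square algebra_simps)
    also have "(norm (friction v + gradient f x))\<^sup>2 \<le> (2 * K)\<^sup>2"
      using fv by (intro power_mono) auto
    finally have "(norm v')\<^sup>2 \<le> (norm v)\<^sup>2 - 2 * h * inner (friction v + gradient f x) v + h\<^sup>2 * (2 * K)\<^sup>2"
      by (simp add: mult_left_mono)
    then have kin: "1/2 * (norm v')\<^sup>2 \<le> 1/2 * (norm v)\<^sup>2 - h * inner (gradient f x) v + h\<^sup>2 * (2 * K\<^sup>2)"
      using fric by (simp add: inner_add_left power2_eq_square algebra_simps)
    have energy: "1/2 * (norm v')\<^sup>2 + f x' \<le> e0 + real (Suc n) * (h\<^sup>2 * C)"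
    proof -
      have "h\<^sup>2 * C = K * (h\<^sup>2 * W\<^sup>2) + h\<^sup>2 * (2 * K\<^sup>2)" by (simp add: C_def algebra_simps)
      then have "1/2 * (norm v')\<^sup>2 + f x' \<le> e0 + real n * (h\<^sup>2 * C) + h\<^sup>2 * C"
        using pot kin IH by linarith
      then show ?thesis by (simp add: algebra_simps)
    qed
    have "real (Suc n) * (h\<^sup>2 * C) = (real (Suc n) * h) * (h * C)" by (simp add: power2_eq_square)
    also have "\<dots> \<le> T * (h0 * C)" using Suc.prems h C T by (intro mult_mono) auto
    also have "\<dots> = 1" using T C by (simp add: h0_def)
    finally have "1/2 * (norm v')\<^sup>2 \<le> e0 + 1 - b" using energy b[of x'] by linarith
    then have "(norm v')\<^sup>2 \<le> W\<^sup>2" unfolding W(2) by argo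
    then have "norm v' \<le> W" using W(1) by (rule power2_le_imp_le)
    then show ?case unfolding e using x'b energy by blast
  qed
  have "norm (euler h n) \<le> R" if h: "0 < h" "h \<le> h0" and n: "real n * h \<le> T" for h n
  proof -
    have "norm (euler h n) \<le> norm (fst (euler h n)) + norm (snd (euler h n))"
      using norm_Pair_le[of "fst (euler h n)" "snd (euler h n)"] by simp
    moreover have "real n * h * W \<le> T * W" using n W(1) by (rule mult_right_mono)
    ultimately show ?thesis using main[OF h n] by (simp add: R_def X_def)
  qed
  then show ?thesis using R1 h0 by blast
qed

definition node :: "real \<Rightarrow> real \<Rightarrow> 'h \<times> 'h" where
  "node h t = euler h (nat \<lfloor>t / h\<rfloor>)"

definition polygon :: "real \<Rightarrow> real \<Rightarrow> 'h \<times> 'h" where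
  "polygon h t = node h t + (t - real (nat \<lfloor>t / h\<rfloor>) * h) *\<^sub>R field (node h t)"

lemma polygon_eq:
  assumes h: "0 < h" and t: "real n * h \<le> t" "t \<le> real (Suc n) * h"
  shows "polygon h t = euler h n + (t - real n * h) *\<^sub>R field (euler h n)"
proof (cases "t = real (Suc n) * h")
  case True
  then have "t / h = real (Suc n)" using h by (simp del: of_nat_Suc)
  then have "nat \<lfloor>t / h\<rfloor> = Suc n" by (metis floor_of_nat nat_int)
  then show ?thesis using True by (simp add: polygon_def node_def algebra_simps)
next
  case False
  have "real n \<le> t / h" "t / h < real n + 1" using h t False by (simp_all add: field_simps)
  then have "\<lfloor>t / h\<rfloor> = int n" by (intro floor_unique) auto
  then show ?thesis by (simp add: polygon_def node_def)
qed

lemma polygon_0: "0 < h \<Longrightarrow> polygon h 0 = (x0, x1)"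
  by (simp add: polygon_def node_def)

lemma floor_step:
  assumes h: "0 < h" and t: "0 \<le> t"
  shows "real (nat \<lfloor>t / h\<rfloor>) * h \<le> t" "t < real (Suc (nat \<lfloor>t / h\<rfloor>)) * h"
proof -
  have "0 \<le> t / h" using h t by simp
  then have "real (nat \<lfloor>t / h\<rfloor>) \<le> t / h" "t / h < real (nat \<lfloor>t / h\<rfloor>) + 1"
    by linarith+
  then show "real (nat \<lfloor>t / h\<rfloor>) * h \<le> t" "t < real (Suc (nat \<lfloor>t / h\<rfloor>)) * h"
    using h by (simp_all add: field_simps)
qed

lemma polygon_has_right_derivative:
  assumes h: "0 < h" and t: "0 \<le> t"
  shows "(polygon h has_vector_derivative field (node h t)) (at_right t)"
proof -
  define n where "n = nat \<lfloor>t / h\<rfloor>"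
  note n = floor_step[OF h t, folded n_def]
  have "((\<lambda>s. euler h n + (s - real n * h) *\<^sub>R field (euler h n)) has_vector_derivative
      field (euler h n)) (at t within {t..})"
    by (auto intro!: derivative_eq_intros)
  then have "(polygon h has_vector_derivative field (euler h n)) (at t within {t..})"
  proof (rule has_vector_derivative_transform_within)
    show "0 < real (Suc n) * h - t" using n by simp
    fix s assume "s \<in> {t..}" "dist s t < real (Suc n) * h - t"
    then show "euler h n + (s - real n * h) *\<^sub>R field (euler h n) = polygon h s"
      using n by (intro polygon_eq[symmetric] h) (auto simp: dist_real_def)
  qed simp
  then show ?thesis
    unfolding node_def n_def by (rule has_vector_derivative_within_subset) auto
qed

lemma polygon_continuous:
  assumes h: "0 < h" and a: "0 \<le> a"
  shows "continuous_on {a..b} (polygon h)"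
proof -
  have piece: "continuous_on {real n * h..real (Suc n) * h} (polygon h)" for n
  proof -
    have "continuous_on {real n * h..real (Suc n) * h}
        (\<lambda>t. euler h n + (t - real n * h) *\<^sub>R field (euler h n))" by (intro continuous_intros)
    then show ?thesis
      by (rule continuous_on_eq) (use polygon_eq[OF h] in auto)
  qed
  have "continuous_on {0..real n * h} (polygon h)" for n
  proof (induction n)
    case (Suc n)
    have "{0..real (Suc n) * h} = {0..real n * h} \<union> {real n * h..real (Suc n) * h}"
    proof -
      have "0 \<le> real n * h" "real n * h \<le> real (Suc n) * h" using h by (simp_all add: algebra_simps)
      then show ?thesis by (simp only: ivl_disj_un_two_touch)
    qed
    then show ?case using continuous_on_closed_Un[OF _ _ Suc piece[of n]] by simp
  qed simp
  moreover obtain n where "b < real n * h" using ex_less_of_nat_mult[OF h] by blast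
  ultimately show ?thesis using a by (auto intro: continuous_on_subset[of "{0..real n * h}"])
qed

lemma polygon_near_node:
  assumes "0 < h" "0 \<le> t"
  shows "norm (polygon h t - node h t) \<le> h * norm (field (node h t))"
proof -
  have "norm (polygon h t - node h t) = \<bar>t - real (nat \<lfloor>t / h\<rfloor>) * h\<bar> * norm (field (node h t))"
    by (simp add: polygon_def)
  also have "\<dots> \<le> h * norm (field (node h t))"
    using floor_step[OF assms] by (intro mult_right_mono) (auto simp: algebra_simps)
  finally show ?thesis .
qed

section \<open>The limit of the Euler polygons\<close>

lemma nodes_bounded:
  assumes "0 < T"
  shows "\<exists>R K h0. controlled_on_ball R K \<and> 0 < h0 \<and>
    (\<forall>h t. 0 < h \<longrightarrow> h \<le> h0 \<longrightarrow> 0 \<le> t \<longrightarrow> t \<le> T \<longrightarrow> norm (node h t) \<le> R)"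
proof -
  obtain R h0 where R: "1 \<le> R" "0 < h0"
    "\<And>h n. 0 < h \<Longrightarrow> h \<le> h0 \<Longrightarrow> real n * h \<le> T \<Longrightarrow> norm (euler h n) \<le> R"
    using euler_bounded[OF assms] by blast
  obtain K where "controlled_on_ball R K" using controlled_on_ball_exists[OF R(1)] by blast
  moreover have "norm (node h t) \<le> R" if "0 < h" "h \<le> h0" "0 \<le> t" "t \<le> T" for h t
    unfolding node_def by (rule R(3)) (use that floor_step(1)[of h t] in linarith)+
  ultimately show ?thesis using R(2) by blast
qed

text \<open>The derivative of the squared distance is the inner product of the field difference at the nodes
  with the polygon difference. Up to errors of the order of the steps the latter is the node difference,
  to which the one-sided Lipschitz bound applies; Gronwall's inequality does the rest.\<close>

lemma polygons_close:
  assumes RK: "controlled_on_ball R K" and T: "0 < T"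
    and h: "0 < h" "h \<le> 1" and k: "0 < k" "k \<le> 1"
    and bh: "\<And>t. 0 \<le> t \<Longrightarrow> t \<le> T \<Longrightarrow> norm (node h t) \<le> R"
    and bk: "\<And>t. 0 \<le> t \<Longrightarrow> t \<le> T \<Longrightarrow> norm (node k t) \<le> R"
    and t: "0 \<le> t" "t \<le> T"
  shows "(norm (polygon h t - polygon k t))\<^sup>2
     \<le> exp (8 * K * T) * ((16 * K + 4) * (R + 2 * K)\<^sup>2 * T) * (h + k)"
proof -
  define M where "M = R + 2 * K"
  have K: "1 \<le> K" "1 \<le> R" using controlled_on_ballD(1,2)[OF RK] by auto
  have M: "0 \<le> M" using K by (simp add: M_def)
  define c where "c = (16 * K + 4) * M\<^sup>2 * (h + k)"
  define p where "p s = (norm (polygon h s - polygon k s))\<^sup>2" for s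
  have c0: "0 \<le> c" using K h k by (simp add: c_def)
  have "p t \<le> exp (8 * K * (t - 0)) * (p 0 + c * (t - 0))"
  proof (rule right_derivative_Gronwall[OF t(1)])
    show "continuous_on {0..t} p"
      unfolding p_def by (intro continuous_intros polygon_continuous h k) simp_all
    show "0 \<le> 8 * K" "0 \<le> c" using K c0 by auto
    fix s assume s: "0 < s" "s < t"
    define a b where "a = node h s" and "b = node k s"
    define A B where "A = polygon h s" and "B = polygon k s"
    have ab: "norm a \<le> R" "norm b \<le> R" using bh[of s] bk[of s] s t by (auto simp: a_def b_def)
    have fM: "norm (field a) \<le> M" "norm (field b) \<le> M"
      using norm_field_le[OF RK] ab by (auto simp: M_def)
    have near: "norm (A - a) \<le> h * M" "norm (B - b) \<le> k * M"
    proof -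
      have "norm (A - a) \<le> h * norm (field a)" unfolding A_def a_def using s h by (intro polygon_near_node) auto
      also have "\<dots> \<le> h * M" using fM h by (intro mult_left_mono) auto
      finally show "norm (A - a) \<le> h * M" .
      have "norm (B - b) \<le> k * norm (field b)" unfolding B_def b_def using s k by (intro polygon_near_node) auto
      also have "\<dots> \<le> k * M" using fM k by (intro mult_left_mono) auto
      finally show "norm (B - b) \<le> k * M" .
    qed
    have dev: "norm ((A - B) - (a - b)) \<le> (h + k) * M"
      using near norm_triangle_ineq4[of "A - a" "B - b"] by (simp add: algebra_simps)
    have "((\<lambda>s. polygon h s - polygon k s) has_vector_derivative field a - field b) (at_right s)"
      unfolding a_def b_def using s
      by (intro has_vector_derivative_diff polygon_has_right_derivative h k) auto
    from has_real_derivative_norm_square[OF this, of 0]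
    have D: "(p has_real_derivative 2 * inner (field a - field b) (A - B)) (at_right s)"
      by (simp add: p_def[abs_def] A_def B_def)
    have "inner (field a - field b) (a - b) \<le> 2 * K * (norm (a - b))\<^sup>2"
      by (rule velocity_field_one_sided_lipschitz[OF RK ab friction_subgradient friction_subgradient])
    moreover have "2 * K * (norm (a - b))\<^sup>2 \<le> 2 * K * (2 * p s + 4 * M\<^sup>2 * (h + k))"
    proof -
      have "norm (a - b) \<le> norm (A - B) + (h + k) * M"
        using dev norm_triangle_ineq4[of "A - B" "(A - B) - (a - b)"] by simp
      then have "(norm (a - b))\<^sup>2 \<le> (norm (A - B) + (h + k) * M)\<^sup>2" by (intro power_mono) auto
      also have "\<dots> \<le> 2 * (norm (A - B))\<^sup>2 + 2 * ((h + k) * M)\<^sup>2"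
        using zero_le_power2[of "norm (A - B) - (h + k) * M"]
        by (simp add: power2_sum power2_diff)
      also have "((h + k) * M)\<^sup>2 \<le> 2 * M\<^sup>2 * (h + k)"
      proof -
        have "(h + k) * ((h + k) * M\<^sup>2) \<le> 2 * ((h + k) * M\<^sup>2)" using h k by (intro mult_right_mono) auto
        then show ?thesis by (simp add: power2_eq_square mult_ac)
      qed
      finally have "(norm (a - b))\<^sup>2 \<le> 2 * p s + 4 * M\<^sup>2 * (h + k)"
        by (simp add: p_def A_def B_def)
      then show ?thesis using K by (intro mult_left_mono) auto
    qed
    moreover have "inner (field a - field b) ((A - B) - (a - b)) \<le> 2 * M\<^sup>2 * (h + k)"
    proof -
      have "inner (field a - field b) ((A - B) - (a - b)) \<le> norm (field a - field b) * norm ((A - B) - (a - b))"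
        by (rule norm_cauchy_schwarz)
      also have "\<dots> \<le> (2 * M) * ((h + k) * M)"
        using norm_triangle_ineq4[of "field a" "field b"] fM dev M by (intro mult_mono) auto
      finally show ?thesis by (simp add: power2_eq_square mult_ac)
    qed
    ultimately have "2 * inner (field a - field b) (A - B) \<le> 8 * K * p s + c"
      by (simp add: c_def inner_diff_right algebra_simps)
    then show "\<exists>D. (p has_real_derivative D) (at_right s) \<and> D \<le> 8 * K * p s + c" using D by blast
  qed
  also have "p 0 = 0" using h k by (simp add: p_def polygon_0)
  also have "exp (8 * K * (t - 0)) * (0 + c * (t - 0)) \<le> exp (8 * K * T) * (c * T)"
  proof (intro mult_mono)
    show "0 + c * (t - 0) \<le> c * T" using mult_left_mono[OF t(2) c0] by simp
  qed (use t K c0 in auto)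
  finally show ?thesis by (simp add: p_def c_def M_def mult_ac)
qed

abbreviation step :: "nat \<Rightarrow> real" where
  "step n \<equiv> 1 / real (Suc n)"

lemma step_tendsto_0: "step \<longlonglongrightarrow> 0"
  using LIMSEQ_Suc[OF lim_1_over_n, where 'a1=real] by simp

definition trajectory :: "real \<Rightarrow> 'h \<times> 'h" where
  "trajectory t = lim (\<lambda>n. polygon (step n) t)"

text \<open>Bundling the uniform convergence of nodes and polygons with a controlled ball that contains the nodes
  fixes \<open>R\<close> and \<open>K\<close> across the lemmas below, which all argue on \<open>[0, T]\<close>.\<close>

definition polygons_track :: "real \<Rightarrow> real \<Rightarrow> real \<Rightarrow> bool" where
  "polygons_track T R K \<longleftrightarrow> controlled_on_ball R K \<and>
     (\<forall>e>0. \<exists>N. \<forall>n\<ge>N. \<forall>t\<in>{0..T}. norm (node (step n) t) \<le> R \<and>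
        norm (node (step n) t - trajectory t) \<le> e \<and> norm (polygon (step n) t - trajectory t) \<le> e)"

lemma polygons_track_exists:
  assumes T: "0 < T"
  shows "\<exists>R K. polygons_track T R K"
proof -
  obtain R K h0 where RK: "controlled_on_ball R K" and h0: "0 < h0"
    and nb: "\<And>h t. 0 < h \<Longrightarrow> h \<le> h0 \<Longrightarrow> 0 \<le> t \<Longrightarrow> t \<le> T \<Longrightarrow> norm (node h t) \<le> R"
    using nodes_bounded[OF T] by blast
  have K: "1 \<le> K" "1 \<le> R" using controlled_on_ballD(1,2)[OF RK] by auto
  have "\<forall>\<^sub>F n in sequentially. step n < h0" by (rule order_tendstoD(2)[OF step_tendsto_0 h0])
  then obtain N0 where N0: "\<And>n. N0 \<le> n \<Longrightarrow> step n < h0" by (auto simp: eventually_sequentially)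
  have nbn: "norm (node (step n) t) \<le> R" if "N0 \<le> n" "t \<in> {0..T}" for n t
    using nb[of "step n" t] N0[OF that(1)] that(2) by simp
  define C where "C = exp (8 * K * T) * ((16 * K + 4) * (R + 2 * K)\<^sup>2 * T)"
  have C: "0 < C" using K T by (simp add: C_def)
  have close: "(norm (polygon (step m) t - polygon (step n) t))\<^sup>2 \<le> C * (step m + step n)"
    if "N0 \<le> m" "N0 \<le> n" "t \<in> {0..T}" for m n t
    unfolding C_def using that by (intro polygons_close[OF RK T] nbn) auto
  have "uniformly_Cauchy_on {0..T} (\<lambda>n. polygon (step n))"
    unfolding uniformly_Cauchy_on_def
  proof (intro allI impI)
    fix e :: real assume e: "0 < e"
    have "\<forall>\<^sub>F n in sequentially. step n < e\<^sup>2 / (2 * C)"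
      by (rule order_tendstoD(2)[OF step_tendsto_0]) (use e C in simp)
    then obtain N1 where N1: "\<And>n. N1 \<le> n \<Longrightarrow> step n < e\<^sup>2 / (2 * C)"
      by (auto simp: eventually_sequentially)
    show "\<exists>M. \<forall>t\<in>{0..T}. \<forall>m\<ge>M. \<forall>n\<ge>M. dist (polygon (step m) t) (polygon (step n) t) < e"
    proof (intro exI[of _ "max N0 N1"] ballI allI impI)
      fix t m n assume a: "t \<in> {0..T}" "max N0 N1 \<le> m" "max N0 N1 \<le> n"
      have "step m + step n < e\<^sup>2 / (2 * C) + e\<^sup>2 / (2 * C)"
        using N1[of m] N1[of n] a by (intro add_strict_mono) auto
      also have "\<dots> = e\<^sup>2 / C" by simp
      finally have "C * (step m + step n) < C * (e\<^sup>2 / C)" using C by (intro mult_strict_left_mono) auto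
      then have "(norm (polygon (step m) t - polygon (step n) t))\<^sup>2 < e\<^sup>2"
        using close[of m n t] a C by simp
      then show "dist (polygon (step m) t) (polygon (step n) t) < e"
        using e by (auto simp: dist_norm intro: power2_less_imp_less)
    qed
  qed
  then have "uniformly_convergent_on {0..T} (\<lambda>n. polygon (step n))"
    by (rule Cauchy_uniformly_convergent)
  then have ul: "uniform_limit {0..T} (\<lambda>n. polygon (step n)) trajectory sequentially"
    unfolding uniformly_convergent_uniform_limit_iff trajectory_def .
  have "polygons_track T R K"
    unfolding polygons_track_def
  proof (intro conjI RK allI impI)
    fix e :: real assume e: "0 < e"
    obtain N1 where N1: "\<And>n t. N1 \<le> n \<Longrightarrow> t \<in> {0..T} \<Longrightarrow> dist (polygon (step n) t) (trajectory t) < e / 2"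
      using uniform_limitD[OF ul half_gt_zero[OF e]] unfolding eventually_sequentially by blast
    have "\<forall>\<^sub>F n in sequentially. step n < e / (2 * (R + 2 * K))"
      by (rule order_tendstoD(2)[OF step_tendsto_0]) (use e K in simp)
    then obtain N2 where N2: "\<And>n. N2 \<le> n \<Longrightarrow> step n < e / (2 * (R + 2 * K))"
      by (auto simp: eventually_sequentially)
    show "\<exists>N. \<forall>n\<ge>N. \<forall>t\<in>{0..T}. norm (node (step n) t) \<le> R \<and>
        norm (node (step n) t - trajectory t) \<le> e \<and> norm (polygon (step n) t - trajectory t) \<le> e"
    proof (intro exI[of _ "max N0 (max N1 N2)"] ballI allI impI)
      fix n t assume a: "max N0 (max N1 N2) \<le> n" "t \<in> {0..T}"
      have 1: "norm (node (step n) t) \<le> R" using nbn[of n t] a by simp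
      have 2: "norm (polygon (step n) t - trajectory t) < e / 2"
        using N1[of n t] a by (simp add: dist_norm)
      have "norm (polygon (step n) t - node (step n) t) \<le> step n * norm (field (node (step n) t))"
        using a by (intro polygon_near_node) auto
      also have "\<dots> \<le> step n * (R + 2 * K)"
        by (intro mult_left_mono norm_field_le[OF RK 1]) simp
      also have "\<dots> \<le> (e / (2 * (R + 2 * K))) * (R + 2 * K)"
        using N2[of n] a K by (intro mult_right_mono) auto
      also have "\<dots> = e / 2" using K by (simp add: nonzero_divide_mult_cancel_right field_simps)
      finally have 3: "norm (polygon (step n) t - node (step n) t) \<le> e / 2" .
      have "norm (node (step n) t - trajectory t) \<le> e"
        using 2 3 norm_triangle_ineq4[of "polygon (step n) t - trajectory t" "polygon (step n) t - node (step n) t"]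
        by simp
      then show "norm (node (step n) t) \<le> R \<and>
        norm (node (step n) t - trajectory t) \<le> e \<and> norm (polygon (step n) t - trajectory t) \<le> e"
        using 1 2 e by linarith
    qed
  qed
  then show ?thesis by blast
qed

lemma trackE:
  assumes "polygons_track T R K" "0 < e"
  obtains N where "\<And>n t. N \<le> n \<Longrightarrow> 0 \<le> t \<Longrightarrow> t \<le> T \<Longrightarrow> norm (node (step n) t) \<le> R"
    "\<And>n t. N \<le> n \<Longrightarrow> 0 \<le> t \<Longrightarrow> t \<le> T \<Longrightarrow> norm (node (step n) t - trajectory t) \<le> e"
    "\<And>n t. N \<le> n \<Longrightarrow> 0 \<le> t \<Longrightarrow> t \<le> T \<Longrightarrow> norm (polygon (step n) t - trajectory t) \<le> e"
proof -
  obtain N where "\<forall>n\<ge>N. \<forall>t\<in>{0..T}. norm (node (step n) t) \<le> R \<and>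
        norm (node (step n) t - trajectory t) \<le> e \<and> norm (polygon (step n) t - trajectory t) \<le> e"
    using assms unfolding polygons_track_def by blast
  then show ?thesis using that[of N] by auto
qed

lemma track_controlled: "polygons_track T R K \<Longrightarrow> controlled_on_ball R K"
  by (simp add: polygons_track_def)

lemma polygons_tendsto_trajectory:
  assumes tr: "polygons_track T R K" and t: "0 \<le> t" "t \<le> T"
  shows "(\<lambda>n. polygon (step n) t) \<longlonglongrightarrow> trajectory t"
proof (rule LIMSEQ_I)
  fix r :: real assume r: "0 < r"
  then obtain N where "\<And>n. N \<le> n \<Longrightarrow> norm (polygon (step n) t - trajectory t) \<le> r / 2"
    using trackE[OF tr, of "r / 2"] t by (metis half_gt_zero)
  then show "\<exists>no. \<forall>n\<ge>no. norm (polygon (step n) t - trajectory t) < r"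
    using r by (intro exI[of _ N]) force
qed

lemma trajectory_bounded:
  assumes tr: "polygons_track T R K" and t: "0 \<le> t" "t \<le> T"
  shows "norm (trajectory t) \<le> R"
proof (rule field_le_epsilon)
  fix e :: real assume "0 < e"
  from trackE[OF tr this] obtain N where
    "norm (node (step N) t) \<le> R" "norm (node (step N) t - trajectory t) \<le> e"
    using t by (metis order_refl)
  then show "norm (trajectory t) \<le> R + e"
    using norm_triangle_ineq4[of "node (step N) t" "node (step N) t - trajectory t"] by simp
qed

lemma trajectory_0: "trajectory 0 = (x0, x1)"
proof -
  have "(\<lambda>n. polygon (step n) 0) = (\<lambda>_. (x0, x1))" by (simp add: polygon_0)
  then show ?thesis unfolding trajectory_def by simp
qed

lemma trajectory_lipschitz:
  assumes tr: "polygons_track T R K" and ab: "0 \<le> a" "a \<le> b" "b \<le> T"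
  shows "norm (trajectory b - trajectory a) \<le> (R + 2 * K) * (b - a)"
proof -
  have "\<exists>N. \<forall>n\<ge>N. norm (polygon (step n) b - polygon (step n) a) \<le> (R + 2 * K) * (b - a)"
  proof -
    obtain N where N: "\<And>n t. N \<le> n \<Longrightarrow> 0 \<le> t \<Longrightarrow> t \<le> T \<Longrightarrow> norm (node (step n) t) \<le> R"
      using trackE[OF tr zero_less_one] by metis
    have "norm (polygon (step n) b - polygon (step n) a) \<le> (R + 2 * K) * (b - a)" if n: "N \<le> n" for n
    proof (rule right_vector_derivative_bound[OF ab(2)])
      show "continuous_on {a..b} (polygon (step n))" by (rule polygon_continuous) (use ab in auto)
      fix t assume t: "a < t" "t < b"
      show "\<exists>D. (polygon (step n) has_vector_derivative D) (at_right t) \<and> norm D \<le> R + 2 * K"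
        using t ab n
        by (intro exI[of _ "field (node (step n) t)"] conjI polygon_has_right_derivative
            norm_field_le[OF track_controlled[OF tr]] N) auto
    qed
    then show ?thesis by blast
  qed
  moreover have "(\<lambda>n. norm (polygon (step n) b - polygon (step n) a)) \<longlonglongrightarrow> norm (trajectory b - trajectory a)"
    using ab by (intro tendsto_intros polygons_tendsto_trajectory[OF tr]) auto
  ultimately show ?thesis by (intro LIMSEQ_le_const2)
qed

abbreviation X :: "real \<Rightarrow> 'h" where "X t \<equiv> fst (trajectory t)"
abbreviation V :: "real \<Rightarrow> 'h" where "V t \<equiv> snd (trajectory t)"

lemma trajectory_near:
  assumes tr: "polygons_track T R K" and "0 \<le> a" "b \<le> T" and "c \<in> {a..b}" "t \<in> {a..b}"
  shows "norm (trajectory t - trajectory c) \<le> (R + 2 * K) * (b - a)"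
proof -
  have M: "0 \<le> R + 2 * K" using controlled_on_ballD(1,2)[OF track_controlled[OF tr]] by simp
  have "norm (trajectory t - trajectory c) \<le> (R + 2 * K) * \<bar>t - c\<bar>"
  proof (cases "c \<le> t")
    case True
    then show ?thesis using trajectory_lipschitz[OF tr, of c t] assms by simp
  next
    case False
    then show ?thesis using trajectory_lipschitz[OF tr, of t c] assms by (simp add: norm_minus_commute)
  qed
  also have "\<dots> \<le> (R + 2 * K) * (b - a)" using M assms by (intro mult_left_mono) auto
  finally show ?thesis .
qed

text \<open>The position of a polygon moves with the velocity of its nodes, which is uniformly close to \<open>V c\<close>
  on a short interval.\<close>

lemma position_increment:
  assumes tr: "polygons_track T R K" and ab: "0 \<le> a" "a \<le> b" "b \<le> T" and c: "c \<in> {a..b}"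
  shows "norm (X b - X a - (b - a) *\<^sub>R V c) \<le> (R + 2 * K) * (b - a)\<^sup>2"
proof -
  define M where "M = R + 2 * K"
  have bound: "norm (X b - X a - (b - a) *\<^sub>R V c) \<le> (M * (b - a) + e) * (b - a)" if e: "0 < e" for e
  proof -
    obtain N where N: "\<And>n t. N \<le> n \<Longrightarrow> 0 \<le> t \<Longrightarrow> t \<le> T \<Longrightarrow> norm (node (step n) t - trajectory t) \<le> e"
      using trackE[OF tr e] by metis
    have "norm (fst (polygon (step n) b) - fst (polygon (step n) a) - (b - a) *\<^sub>R V c) \<le> (M * (b - a) + e) * (b - a)"
      if n: "N \<le> n" for n
    proof -
      define y where "y t = fst (polygon (step n) t) - t *\<^sub>R V c" for t
      have "norm (y b - y a) \<le> (M * (b - a) + e) * (b - a)"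
      proof (rule right_vector_derivative_bound[OF ab(2)])
        show "continuous_on {a..b} y"
          unfolding y_def by (intro continuous_intros polygon_continuous) (use ab in auto)
        fix t assume t: "a < t" "t < b"
        have "(polygon (step n) has_vector_derivative field (node (step n) t)) (at_right t)"
          using t ab by (intro polygon_has_right_derivative) auto
        then have "((\<lambda>t. fst (polygon (step n) t)) has_vector_derivative fst (field (node (step n) t))) (at_right t)"
          by (rule bounded_linear.has_vector_derivative[OF bounded_linear_fst])
        then have D: "(y has_vector_derivative snd (node (step n) t) - V c) (at_right t)"
          unfolding y_def by (auto intro!: derivative_eq_intros simp: velocity_field_def)
        have "norm (snd (node (step n) t) - V c) \<le> norm (node (step n) t - trajectory c)"
          using norm_pair_components(2)[of "node (step n) t - trajectory c"] by simp
        also have "\<dots> \<le> norm (node (step n) t - trajectory t) + norm (trajectory t - trajectory c)"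
          using norm_triangle_ineq[of "node (step n) t - trajectory t" "trajectory t - trajectory c"] by simp
        also have "\<dots> \<le> M * (b - a) + e"
          using N[OF n, of t] trajectory_near[OF tr ab(1,3) c, of t] t ab by (simp add: M_def)
        finally show "\<exists>D. (y has_vector_derivative D) (at_right t) \<and> norm D \<le> M * (b - a) + e"
          using D by blast
      qed
      then show ?thesis by (simp add: y_def algebra_simps)
    qed
    then have "\<exists>N. \<forall>n\<ge>N. norm (fst (polygon (step n) b) - fst (polygon (step n) a) - (b - a) *\<^sub>R V c)
       \<le> (M * (b - a) + e) * (b - a)" by blast
    moreover have "(\<lambda>n. norm (fst (polygon (step n) b) - fst (polygon (step n) a) - (b - a) *\<^sub>R V c))
       \<longlonglongrightarrow> norm (X b - X a - (b - a) *\<^sub>R V c)"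
      using ab by (intro tendsto_intros polygons_tendsto_trajectory[OF tr]) auto
    ultimately show ?thesis by (intro LIMSEQ_le_const2)
  qed
  have "norm (X b - X a - (b - a) *\<^sub>R V c) \<le> (M * (b - a) + 0) * (b - a)"
  proof (rule tendsto_lowerbound)
    show "((\<lambda>e. (M * (b - a) + e) * (b - a)) \<longlongrightarrow> (M * (b - a) + 0) * (b - a)) (at_right 0)"
      by (intro tendsto_intros)
    show "\<forall>\<^sub>F e in at_right 0. norm (X b - X a - (b - a) *\<^sub>R V c) \<le> (M * (b - a) + e) * (b - a)"
      using bound by (auto simp: eventually_at_filter)
  qed simp
  then show ?thesis by (simp add: M_def power2_eq_square)
qed

text \<open>For a polygon, the derivative of \<open>\<parallel>v - w\<parallel>\<^sup>2 / 2\<close> is estimated by the subgradient inequality at the node,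
  and the values at the node are replaced by those at \<open>c\<close> at a cost proportional to \<open>b - a\<close>. The
  inequality survives the limit since it no longer contains a derivative. Allowing \<open>c\<close> to be either
  end point is what makes it usable for both forward and backward quotients.\<close>

lemma velocity_variational_inequality:
  assumes tr: "polygons_track T R K" and T: "0 < T"
  shows "\<exists>C\<ge>0. \<forall>a b c w. 0 \<le> a \<longrightarrow> a \<le> b \<longrightarrow> b \<le> T \<longrightarrow> c \<in> {a..b} \<longrightarrow>
    (norm (V b - w))\<^sup>2 / 2 - (norm (V a - w))\<^sup>2 / 2 \<le>
    (b - a) * (\<phi> w - \<phi> (V c) - inner (gradient f (X c)) (V c - w) + C * (b - a) * (1 + norm (w - V c)))"
proof -
  note RK = track_controlled[OF tr]
  have K: "1 \<le> K" "1 \<le> R" using controlled_on_ballD(1,2)[OF RK] by auto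
  define M where "M = R + 2 * K"
  have M: "0 \<le> M" using K by (simp add: M_def)
  define C where "C = K * M * (2 + M * T)"
  have C: "0 \<le> C" using K M T by (simp add: C_def)
  have main: "(norm (V b - w))\<^sup>2 / 2 - (norm (V a - w))\<^sup>2 / 2 \<le>
    (b - a) * (\<phi> w - \<phi> (V c) - inner (gradient f (X c)) (V c - w) + C * (b - a) * (1 + norm (w - V c)))"
    if ab: "0 \<le> a" "a \<le> b" "b \<le> T" and c: "c \<in> {a..b}" for a b c w
  proof -
    define B where "B = \<phi> w - \<phi> (V c) - inner (gradient f (X c)) (V c - w)"
    define \<delta> where "\<delta> e = M * (b - a) + e" for e
    define r where "r e = B + K * \<delta> e * (2 + \<delta> e + norm (w - V c)) + 2 * M * e" for e
    have Vc: "norm (V c) \<le> R" "norm (X c) \<le> R"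
      using trajectory_bounded[OF tr, of c] norm_pair_components[of "trajectory c"] ab c by auto
    have bound: "(norm (V b - w))\<^sup>2 / 2 - (norm (V a - w))\<^sup>2 / 2 \<le> r e * (b - a)" if e: "0 < e" for e
    proof -
      obtain N where N: "\<And>n t. N \<le> n \<Longrightarrow> 0 \<le> t \<Longrightarrow> t \<le> T \<Longrightarrow> norm (node (step n) t) \<le> R"
        "\<And>n t. N \<le> n \<Longrightarrow> 0 \<le> t \<Longrightarrow> t \<le> T \<Longrightarrow> norm (node (step n) t - trajectory t) \<le> e"
        "\<And>n t. N \<le> n \<Longrightarrow> 0 \<le> t \<Longrightarrow> t \<le> T \<Longrightarrow> norm (polygon (step n) t - trajectory t) \<le> e"
        using trackE[OF tr e] by blast
      have d0: "0 \<le> \<delta> e" using M ab e by (simp add: \<delta>_def)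
      have "(norm (snd (polygon (step n) b) - w))\<^sup>2 / 2 - (norm (snd (polygon (step n) a) - w))\<^sup>2 / 2 \<le> r e * (b - a)"
        if n: "N \<le> n" for n
      proof -
        define q where "q t = (norm (snd (polygon (step n) t) - w))\<^sup>2 / 2" for t
        have "q b \<le> q a + r e * (b - a)"
        proof (rule right_derivative_le_imp_increment_le[OF ab(2)])
          show "continuous_on {a..b} q"
            unfolding q_def by (intro continuous_intros polygon_continuous) (use ab in auto)
          fix t assume t: "a < t" "t < b"
          define x v where "x = fst (node (step n) t)" and "v = snd (node (step n) t)"
          define v' where "v' = snd (polygon (step n) t)"
          define g where "g = friction v + gradient f x"
          have tT: "0 \<le> t" "t \<le> T" using t ab by auto
          have "(polygon (step n) has_vector_derivative field (node (step n) t)) (at_right t)"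
            using t ab by (intro polygon_has_right_derivative) auto
          then have "((\<lambda>t. snd (polygon (step n) t)) has_vector_derivative snd (field (node (step n) t))) (at_right t)"
            by (rule bounded_linear.has_vector_derivative[OF bounded_linear_snd])
          from has_real_derivative_norm_square[OF this, of w]
          have "(q has_real_derivative (2 * inner (- g) (v' - w)) / 2) (at_right t)"
            unfolding q_def by (intro DERIV_cdivide) (simp add: velocity_field_def v'_def g_def x_def v_def)
          then have D: "(q has_real_derivative inner (- g) (v' - w)) (at_right t)" by simp
          have xv: "norm x \<le> R" "norm v \<le> R"
            using N(1)[OF n tT] norm_pair_components[of "node (step n) t"] by (auto simp: x_def v_def)
          have "norm (node (step n) t - trajectory c) \<le> \<delta> e"
            using N(2)[OF n tT] trajectory_near[OF tr ab(1,3) c, of t] t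
              norm_triangle_ineq[of "node (step n) t - trajectory t" "trajectory t - trajectory c"]
            by (simp add: \<delta>_def M_def)
          then have xc: "norm (x - X c) \<le> \<delta> e" and vc: "norm (v - V c) \<le> \<delta> e"
            using norm_pair_components[of "node (step n) t - trajectory c"] by (auto simp: x_def v_def)
          have "norm (polygon (step n) t - node (step n) t) \<le> 2 * e"
            using N(2,3)[OF n tT]
              norm_triangle_ineq4[of "polygon (step n) t - trajectory t" "node (step n) t - trajectory t"]
            by simp
          then have v'v: "norm (v' - v) \<le> 2 * e"
            using norm_pair_components(2)[of "polygon (step n) t - node (step n) t"] by (simp add: v'_def v_def)
          have gM: "norm g \<le> M"
            using norm_triangle_ineq[of "friction v" "gradient f x"] controlled_on_ballD(3)[OF RK xv(2)]
              controlled_on_ballD(4)[OF RK xv(1)] K by (simp add: g_def M_def)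
          have t1: "- inner g (v' - v) \<le> 2 * M * e"
          proof -
            have "- inner g (v' - v) \<le> norm g * norm (v' - v)" using norm_cauchy_schwarz[of "- g" "v' - v"] by simp
            also have "\<dots> \<le> M * (2 * e)" using gM v'v M by (intro mult_mono) auto
            finally show ?thesis by simp
          qed
          have t2: "- inner (friction v) (v - w) \<le> \<phi> w - \<phi> v"
          proof -
            have "\<phi> v + inner (friction v) (w - v) \<le> \<phi> w"
              using friction_subgradient[of v] by (simp add: subdifferential_def)
            then show ?thesis by (simp add: inner_diff_right)
          qed
          have t3: "- \<phi> v \<le> - \<phi> (V c) + K * \<delta> e"
          proof -
            have "\<phi> (V c) - \<phi> v \<le> K * norm (V c - v)" by (rule controlled_on_ballD(5)[OF RK Vc(1) xv(2)])
            also have "\<dots> \<le> K * \<delta> e" using vc K by (intro mult_left_mono) (auto simp: norm_minus_commute)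
            finally show ?thesis by simp
          qed
          have t4: "- inner (gradient f x - gradient f (X c)) (v - w) \<le> K * \<delta> e * (\<delta> e + norm (w - V c))"
          proof -
            have "- inner (gradient f x - gradient f (X c)) (v - w) \<le> norm (gradient f x - gradient f (X c)) * norm (v - w)"
              using norm_cauchy_schwarz[of "- (gradient f x - gradient f (X c))" "v - w"]
              by (simp only: norm_minus_cancel inner_minus_left)
            also have "\<dots> \<le> (K * \<delta> e) * (\<delta> e + norm (w - V c))"
            proof (intro mult_mono)
              have "norm (gradient f x - gradient f (X c)) \<le> K * norm (x - X c)"
                by (rule controlled_on_ballD(6)[OF RK xv(1) Vc(2)])
              also have "\<dots> \<le> K * \<delta> e" using xc K by (intro mult_left_mono) auto
              finally show "norm (gradient f x - gradient f (X c)) \<le> K * \<delta> e" .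
              show "norm (v - w) \<le> \<delta> e + norm (w - V c)"
                using vc norm_triangle_ineq4[of "v - V c" "w - V c"] by simp
            qed (use K d0 in auto)
            finally show ?thesis .
          qed
          have t5: "- inner (gradient f (X c)) (v - V c) \<le> K * \<delta> e"
          proof -
            have "- inner (gradient f (X c)) (v - V c) \<le> norm (gradient f (X c)) * norm (v - V c)"
              using norm_cauchy_schwarz[of "- gradient f (X c)" "v - V c"] by simp
            also have "\<dots> \<le> K * \<delta> e" using controlled_on_ballD(4)[OF RK Vc(2)] vc K by (intro mult_mono) auto
            finally show ?thesis .
          qed
          have "inner (- g) (v' - w) = - inner g (v' - v) - inner (friction v) (v - w)
              - inner (gradient f x - gradient f (X c)) (v - w) - inner (gradient f (X c)) (v - V c)
              - inner (gradient f (X c)) (V c - w)"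
            by (simp add: g_def inner_diff_right inner_diff_left inner_add_left)
          also have "\<dots> \<le> r e"
            using t1 t2 t3 t4 t5 unfolding r_def B_def by (simp add: algebra_simps)
          finally show "\<exists>D. (q has_real_derivative D) (at_right t) \<and> D \<le> r e" using D by blast
        qed
        then show ?thesis by (simp add: q_def)
      qed
      then have "\<exists>N. \<forall>n\<ge>N. (norm (snd (polygon (step n) b) - w))\<^sup>2 / 2
          - (norm (snd (polygon (step n) a) - w))\<^sup>2 / 2 \<le> r e * (b - a)" by blast
      moreover have "(\<lambda>n. (norm (snd (polygon (step n) b) - w))\<^sup>2 / 2 - (norm (snd (polygon (step n) a) - w))\<^sup>2 / 2)
          \<longlonglongrightarrow> (norm (V b - w))\<^sup>2 / 2 - (norm (V a - w))\<^sup>2 / 2"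
        using ab by (intro tendsto_intros polygons_tendsto_trajectory[OF tr]) auto
      ultimately show ?thesis by (intro LIMSEQ_le_const2)
    qed
    have "(norm (V b - w))\<^sup>2 / 2 - (norm (V a - w))\<^sup>2 / 2 \<le> r 0 * (b - a)"
    proof (rule tendsto_lowerbound)
      show "((\<lambda>e. r e * (b - a)) \<longlongrightarrow> r 0 * (b - a)) (at_right 0)"
        unfolding r_def \<delta>_def by (intro tendsto_intros)
      show "\<forall>\<^sub>F e in at_right 0. (norm (V b - w))\<^sup>2 / 2 - (norm (V a - w))\<^sup>2 / 2 \<le> r e * (b - a)"
        using bound by (auto simp: eventually_at_filter)
    qed simp
    also have "r 0 * (b - a) \<le> (B + C * (b - a) * (1 + norm (w - V c))) * (b - a)"
    proof (intro mult_right_mono)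
      have "2 + M * (b - a) + norm (w - V c) \<le> (2 + M * T) * (1 + norm (w - V c))"
      proof -
        have "M * (b - a) \<le> M * T" using M ab by (intro mult_left_mono) auto
        moreover have "norm (w - V c) \<le> (2 + M * T) * norm (w - V c)"
          using M T by (simp add: mult_le_cancel_right1)
        ultimately show ?thesis by (simp add: distrib_left)
      qed
      then have "K * (M * (b - a)) * (2 + M * (b - a) + norm (w - V c))
          \<le> K * (M * (b - a)) * ((2 + M * T) * (1 + norm (w - V c)))"
        using K M ab by (intro mult_left_mono) auto
      then show "r 0 \<le> B + C * (b - a) * (1 + norm (w - V c))"
        by (simp add: r_def \<delta>_def C_def mult_ac)
    qed (use ab in simp)
    finally show ?thesis by (simp add: B_def mult_ac)
  qed
  show ?thesis using C main by blast
qed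

end

section \<open>Differentiability of the limit velocity\<close>

lemma has_vector_derivative_Pair:
  assumes "(u has_vector_derivative u') (at t within S)" "(v has_vector_derivative v') (at t within S)"
  shows "((\<lambda>s. (u s, v s)) has_vector_derivative (u', v')) (at t within S)"
  using has_derivative_Pair[OF assms[unfolded has_vector_derivative_def]]
  by (simp add: has_vector_derivative_def)

lemma has_vector_derivative_shift_right:
  fixes z :: "real \<Rightarrow> 'a::real_normed_vector"
  assumes "(z has_vector_derivative D) (at_right (t + h))"
  shows "((\<lambda>s. z (s + h)) has_vector_derivative D) (at_right t)"
proof -
  have "filterlim (\<lambda>s. s + h) (at_right (t + h)) (at_right t)"
    by (auto simp: filterlim_at_right_to_0[of _ _ t] filterlim_at eventually_at_filter
        intro!: tendsto_eq_intros)
  from filterlim_compose[OF assms[unfolded has_vector_derivative_iff_quotient] this]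
  show ?thesis by (simp add: has_vector_derivative_iff_quotient)
qed

lemma has_right_vector_derivative_increment:
  fixes z :: "real \<Rightarrow> 'a::real_normed_vector"
  assumes "(z has_vector_derivative D) (at_right t)"
  shows "((\<lambda>h. (1 / h) *\<^sub>R (z (t + h) - z t)) \<longlongrightarrow> D) (at_right 0)"
  using assms by (simp add: has_vector_derivative_iff_quotient filterlim_at_right_to_0[of _ _ t] add.commute)

lemma has_vector_derivative_two_sided:
  fixes z :: "real \<Rightarrow> 'a::real_normed_vector"
  assumes "(z has_vector_derivative D) (at_left t)" "(z has_vector_derivative D) (at_right t)"
  shows "(z has_vector_derivative D) (at t)"
  using assms filterlim_split_at unfolding has_vector_derivative_iff_quotient by blast

context damped_inertial_system
begin

text \<open>The subgradient \<open>g\<close> at \<open>V t\<close> for which the resulting acceleration \<open>- (g + \<nabla>f (X t))\<close> has minimal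
  norm. It differs in general from \<open>friction (V t)\<close>, which minimizes the norm of \<open>g\<close> itself.\<close>

definition reaction :: "real \<Rightarrow> 'h" where
  "reaction t = (SOME g. g \<in> subdifferential \<phi> (V t) \<and>
     (\<forall>g'\<in>subdifferential \<phi> (V t). norm (g + gradient f (X t)) \<le> norm (g' + gradient f (X t))))"

abbreviation accel :: "real \<Rightarrow> 'h" where
  "accel t \<equiv> - (reaction t + gradient f (X t))"

lemma reaction_subgradient: "reaction t \<in> subdifferential \<phi> (V t)"
  and reaction_minimal: "g \<in> subdifferential \<phi> (V t) \<Longrightarrow>
    norm (reaction t + gradient f (X t)) \<le> norm (g + gradient f (X t))"
proof -
  have "\<exists>g. g \<in> subdifferential \<phi> (V t) \<and>
     (\<forall>g'\<in>subdifferential \<phi> (V t). norm (g + gradient f (X t)) \<le> norm (g' + gradient f (X t)))"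
    using minimal_subgradient_exists[OF subdifferential_phi_nonempty] by blast
  from someI_ex[OF this, folded reaction_def]
  show "reaction t \<in> subdifferential \<phi> (V t)"
    and "g \<in> subdifferential \<phi> (V t) \<Longrightarrow>
      norm (reaction t + gradient f (X t)) \<le> norm (g + gradient f (X t))" by auto
qed

lemma velocity_field_reaction: "velocity_field (reaction t) (trajectory t) = (V t, accel t)"
  by (simp add: velocity_field_def)

text \<open>Expanding the squares in the variational inequality around either end point leaves
  \<open>\<langle>V b - V a, V c - w\<rangle>\<close> and the term \<open>\<parallel>V b - V a\<parallel>\<^sup>2\<close>, which is of second order because \<open>V\<close> is Lipschitz.\<close>

lemma velocity_quotient_approx_subgradient:
  assumes tr: "polygons_track T R K" and T: "0 < T"
  shows "\<exists>C\<ge>0. \<forall>a b c. 0 \<le> a \<longrightarrow> a < b \<longrightarrow> b \<le> T \<longrightarrow> c \<in> {a, b} \<longrightarrow>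
    - ((1 / (b - a)) *\<^sub>R (V b - V a)) - gradient f (X c) \<in> approx_subdifferential \<phi> (C * (b - a)) (V c)"
proof -
  obtain C where C: "0 \<le> C" and var: "\<And>a b c w. 0 \<le> a \<Longrightarrow> a \<le> b \<Longrightarrow> b \<le> T \<Longrightarrow> c \<in> {a..b} \<Longrightarrow>
    (norm (V b - w))\<^sup>2 / 2 - (norm (V a - w))\<^sup>2 / 2 \<le>
    (b - a) * (\<phi> w - \<phi> (V c) - inner (gradient f (X c)) (V c - w) + C * (b - a) * (1 + norm (w - V c)))"
    using velocity_variational_inequality[OF tr T] by blast
  define M where "M = R + 2 * K"
  have "- ((1 / (b - a)) *\<^sub>R (V b - V a)) - gradient f (X c)
      \<in> approx_subdifferential \<phi> ((C + M\<^sup>2) * (b - a)) (V c)"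
    if ab: "0 \<le> a" "a < b" "b \<le> T" and c: "c \<in> {a, b}" for a b c
    unfolding approx_subdifferential_def
  proof (intro CollectI allI)
    fix w
    define d where "d = (1 / (b - a)) *\<^sub>R (V b - V a)"
    have d: "V b - V a = (b - a) *\<^sub>R d" using ab by (simp add: d_def)
    have "norm (V b - V a) \<le> norm (trajectory b - trajectory a)"
      using norm_pair_components(2)[of "trajectory b - trajectory a"] by simp
    also have "\<dots> \<le> M * (b - a)" unfolding M_def using ab by (intro trajectory_lipschitz[OF tr]) auto
    finally have "(norm (V b - V a))\<^sup>2 \<le> (M * (b - a))\<^sup>2" by (intro power_mono) auto
    then have sq: "(norm (V b - V a))\<^sup>2 \<le> (b - a) * (M\<^sup>2 * (b - a))"
      by (simp add: power2_eq_square mult_ac)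
    have expand: "(norm (V b - w))\<^sup>2 / 2 - (norm (V a - w))\<^sup>2 / 2 =
        inner (V b - V a) (V c - w) + (if c = a then 1 else - 1) * (norm (V b - V a))\<^sup>2 / 2"
      using c ab unfolding power2_norm_eq_inner
      by (auto simp: inner_diff_left inner_diff_right inner_commute field_simps)
    have "(b - a) * inner d (V c - w) = inner (V b - V a) (V c - w)" unfolding d by simp
    also have "\<dots> \<le> (norm (V b - w))\<^sup>2 / 2 - (norm (V a - w))\<^sup>2 / 2 + (b - a) * (M\<^sup>2 * (b - a))"
    proof -
      have "- ((norm (V b - V a))\<^sup>2 / 2) \<le> (if c = a then 1 else - 1) * (norm (V b - V a))\<^sup>2 / 2" by simp
      then show ?thesis unfolding expand using sq zero_le_power2[of "norm (V b - V a)"] by linarith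
    qed
    also have "\<dots> \<le> (b - a) * (\<phi> w - \<phi> (V c) - inner (gradient f (X c)) (V c - w)
        + C * (b - a) * (1 + norm (w - V c)) + M\<^sup>2 * (b - a))"
      using var[of a b c w] ab c by (auto simp: distrib_left)
    finally have "inner d (V c - w) \<le> \<phi> w - \<phi> (V c) - inner (gradient f (X c)) (V c - w)
        + C * (b - a) * (1 + norm (w - V c)) + M\<^sup>2 * (b - a)"
      using ab by simp
    moreover have "M\<^sup>2 * (b - a) \<le> M\<^sup>2 * (b - a) * (1 + norm (w - V c))"
      using mult_left_mono[of 1 "1 + norm (w - V c)" "M\<^sup>2 * (b - a)"] ab by simp
    ultimately show "\<phi> (V c) + inner (- d - gradient f (X c)) (w - V c)
        - (C + M\<^sup>2) * (b - a) * (1 + norm (w - V c)) \<le> \<phi> w"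
      by (simp add: inner_diff_left inner_diff_right algebra_simps)
  qed
  then show ?thesis using C by (intro exI[of _ "C + M\<^sup>2"]) auto
qed

lemma velocity_quotient_near_accel:
  assumes tr: "polygons_track T R K" and T: "0 < T" and e: "0 < e"
  shows "\<exists>\<epsilon>>0. \<forall>a b. 0 \<le> a \<longrightarrow> a < b \<longrightarrow> b \<le> T \<longrightarrow> t \<in> {a, b} \<longrightarrow> b - a < \<epsilon> \<longrightarrow>
    norm ((1 / (b - a)) *\<^sub>R (V b - V a)) \<le> norm (accel t) + \<epsilon> \<longrightarrow>
    norm ((1 / (b - a)) *\<^sub>R (V b - V a) - accel t) < e"
proof -
  obtain C where C: "0 \<le> C" and app: "\<And>a b c. 0 \<le> a \<Longrightarrow> a < b \<Longrightarrow> b \<le> T \<Longrightarrow> c \<in> {a, b} \<Longrightarrow>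
    - ((1 / (b - a)) *\<^sub>R (V b - V a)) - gradient f (X c) \<in> approx_subdifferential \<phi> (C * (b - a)) (V c)"
    using velocity_quotient_approx_subgradient[OF tr T] by blast
  obtain \<epsilon> where eps: "0 < \<epsilon>" and near: "\<And>g. g \<in> approx_subdifferential \<phi> \<epsilon> (V t) \<Longrightarrow>
      norm (g + gradient f (X t)) \<le> norm (reaction t + gradient f (X t)) + \<epsilon> \<Longrightarrow> norm (g - reaction t) < e"
    using approx_subgradient_near_minimal_subgradient[OF reaction_subgradient reaction_minimal e] by blast
  define \<epsilon>' where "\<epsilon>' = min \<epsilon> (\<epsilon> / (C + 1))"
  have eps': "0 < \<epsilon>'" "\<epsilon>' \<le> \<epsilon>" "C * \<epsilon>' \<le> \<epsilon>"
  proof -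
    show "0 < \<epsilon>'" "\<epsilon>' \<le> \<epsilon>" using eps C by (auto simp: \<epsilon>'_def)
    have "C * \<epsilon>' \<le> C * (\<epsilon> / (C + 1))" using C by (intro mult_left_mono) (auto simp: \<epsilon>'_def)
    also have "\<dots> \<le> \<epsilon>" using C eps by (simp add: field_simps)
    finally show "C * \<epsilon>' \<le> \<epsilon>" .
  qed
  show ?thesis
  proof (intro exI[of _ \<epsilon>'] conjI allI impI eps'(1))
    fix a b assume ab: "0 \<le> a" "a < b" "b \<le> T" "t \<in> {a, b}" "b - a < \<epsilon>'"
      and le: "norm ((1 / (b - a)) *\<^sub>R (V b - V a)) \<le> norm (accel t) + \<epsilon>'"
    define d where "d = (1 / (b - a)) *\<^sub>R (V b - V a)"
    have "C * (b - a) \<le> C * \<epsilon>'" using ab C by (intro mult_left_mono) auto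
    then have "C * (b - a) \<le> \<epsilon>" using eps' by linarith
    then have "- d - gradient f (X t) \<in> approx_subdifferential \<phi> \<epsilon> (V t)"
      using app[OF ab(1-4)] approx_subdifferential_mono unfolding d_def by blast
    moreover have "norm (- d - gradient f (X t) + gradient f (X t)) \<le> norm (reaction t + gradient f (X t)) + \<epsilon>"
      using le eps'(2) unfolding d_def[symmetric] norm_minus_cancel by simp
    ultimately have "norm (- d - gradient f (X t) - reaction t) < e" by (rule near)
    moreover have "- d - gradient f (X t) - reaction t = - (d - accel t)" by simp
    ultimately have "norm (- (d - accel t)) < e" by simp
    then show "norm (d - accel t) < e" by (simp only: norm_minus_cancel)
  qed
qed

text \<open>Use \<open>w = V a\<close> in the variational inequality. Monotonicity allows the unknown
  subgradients along the trajectory to be replaced by the minimal one at time \<open>a\<close>, so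
  that \<open>p s = \<parallel>V s - V a\<parallel>\<^sup>2\<close> satisfies \<open>p' \<le> 2 * c * sqrt p\<close> with \<open>c\<close> close to \<open>norm (accel a)\<close>.\<close>

lemma velocity_increment_le:
  assumes tr: "polygons_track T R K" and T: "0 < T" and ab: "0 \<le> a" "a \<le> b" "b \<le> T"
  shows "norm (V b - V a) \<le> (norm (accel a) + K * (R + 2 * K) * (b - a)) * (b - a)"
proof -
  note RK = track_controlled[OF tr]
  obtain C where C: "0 \<le> C" and var: "\<And>a b c w. 0 \<le> a \<Longrightarrow> a \<le> b \<Longrightarrow> b \<le> T \<Longrightarrow> c \<in> {a..b} \<Longrightarrow>
    (norm (V b - w))\<^sup>2 / 2 - (norm (V a - w))\<^sup>2 / 2 \<le>
    (b - a) * (\<phi> w - \<phi> (V c) - inner (gradient f (X c)) (V c - w) + C * (b - a) * (1 + norm (w - V c)))"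
    using velocity_variational_inequality[OF tr T] by blast
  define M where "M = R + 2 * K"
  have K: "1 \<le> K" "1 \<le> R" using controlled_on_ballD(1,2)[OF RK] by auto
  have M: "0 \<le> M" using K by (simp add: M_def)
  define c where "c = norm (accel a) + K * M * (b - a)"
  define p where "p s = (norm (V s - V a))\<^sup>2" for s
  have ctZ: "continuous_on {a..b} trajectory"
  proof (rule lipschitz_on_continuous_on)
    show "M-lipschitz_on {a..b} trajectory"
      using ab M trajectory_lipschitz[OF tr]
      by (intro lipschitz_on_leI) (auto simp: dist_norm M_def norm_minus_commute[of "trajectory x" "trajectory y" for x y])
  qed
  have "sqrt (p b) \<le> sqrt (p a) + c * (b - a)"
  proof (rule right_slope_of_square_imp_growth_le[OF ab(2)])
    show "continuous_on {a..b} p" unfolding p_def by (intro continuous_intros ctZ)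
    show "0 \<le> c" using K M ab by (simp add: c_def)
    show "0 \<le> p s" for s by (simp add: p_def)
    fix t \<epsilon> :: real assume t: "a < t" "t < b" and eps: "0 < \<epsilon>"
    define n where "n = norm (V t - V a)"
    define \<delta> where "\<delta> = \<epsilon> / (2 * (C + 1) * (1 + n))"
    have n0: "0 \<le> n" by (simp add: n_def)
    have del: "0 < \<delta>" using eps C n0 by (simp add: \<delta>_def)
    have "\<forall>\<^sub>F s in at_right t. s < b" using t by (intro eventually_at_right_field[THEN iffD2]) auto
    moreover have "\<forall>\<^sub>F s in at_right t. s < t + \<delta>"
      using del by (intro eventually_at_right_field[THEN iffD2]) (auto intro!: exI[of _ "t + \<delta>"])
    moreover have "\<forall>\<^sub>F s in at_right t. t < s" by (simp add: eventually_at_filter)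
    ultimately show "\<forall>\<^sub>F s in at_right t. p s \<le> p t + (2 * c * sqrt (p t) + \<epsilon>) * (s - t)"
    proof eventually_elim
      case (elim s)
      have r: "\<phi> (V a) - \<phi> (V t) \<le> - inner (reaction a) (V t - V a)"
      proof -
        have "\<phi> (V a) + inner (reaction a) (V t - V a) \<le> \<phi> (V t)"
          using reaction_subgradient[of a] by (simp add: subdifferential_def)
        then show ?thesis by simp
      qed
      have G: "norm (gradient f (X t) - gradient f (X a)) \<le> K * M * (b - a)"
      proof -
        have "norm (X t - X a) \<le> norm (trajectory t - trajectory a)"
          using norm_pair_components(1)[of "trajectory t - trajectory a"] by simp
        also have "\<dots> \<le> M * (b - a)"
          unfolding M_def using t ab by (intro trajectory_near[OF tr]) auto
        finally have "K * norm (X t - X a) \<le> K * (M * (b - a))" using K by (intro mult_left_mono) auto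
        moreover have "norm (gradient f (X t) - gradient f (X a)) \<le> K * norm (X t - X a)"
          using t ab trajectory_bounded[OF tr, of t] trajectory_bounded[OF tr, of a]
            norm_pair_components(1)[of "trajectory t"] norm_pair_components(1)[of "trajectory a"]
          by (intro controlled_on_ballD(6)[OF RK]) auto
        ultimately show ?thesis by (simp add: mult.assoc)
      qed
      have "\<phi> (V a) - \<phi> (V t) - inner (gradient f (X t)) (V t - V a) \<le> c * n"
      proof -
        have "\<phi> (V a) - \<phi> (V t) - inner (gradient f (X t)) (V t - V a)
            \<le> inner (accel a - (gradient f (X t) - gradient f (X a))) (V t - V a)"
          using r by (simp add: inner_diff_left inner_add_left)
        also have "\<dots> \<le> norm (accel a - (gradient f (X t) - gradient f (X a))) * n"
          unfolding n_def by (rule norm_cauchy_schwarz)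
        also have "\<dots> \<le> c * n"
        proof (rule mult_right_mono[OF _ n0])
          show "norm (accel a - (gradient f (X t) - gradient f (X a))) \<le> c"
            unfolding c_def using norm_triangle_ineq4[of "accel a" "gradient f (X t) - gradient f (X a)"] G
            by linarith
        qed
        finally show ?thesis .
      qed
      moreover have "C * (s - t) * (1 + norm (V a - V t)) \<le> \<epsilon> / 2"
      proof -
        have "C * (s - t) * (1 + n) \<le> (C + 1) * \<delta> * (1 + n)"
          using elim C n0 by (intro mult_right_mono mult_mono) auto
        also have "\<dots> = \<epsilon> / 2" using C n0 by (simp add: \<delta>_def divide_simps)
        finally show ?thesis by (simp add: n_def norm_minus_commute)
      qed
      ultimately have "\<phi> (V a) - \<phi> (V t) - inner (gradient f (X t)) (V t - V a)
          + C * (s - t) * (1 + norm (V a - V t)) \<le> c * n + \<epsilon> / 2" by linarith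
      then have "(s - t) * (\<phi> (V a) - \<phi> (V t) - inner (gradient f (X t)) (V t - V a)
          + C * (s - t) * (1 + norm (V a - V t))) \<le> (s - t) * (c * n + \<epsilon> / 2)"
        using elim by (intro mult_left_mono) auto
      moreover have "p s / 2 - p t / 2 \<le> (s - t) * (\<phi> (V a) - \<phi> (V t) - inner (gradient f (X t)) (V t - V a)
          + C * (s - t) * (1 + norm (V a - V t)))"
        unfolding p_def using var[of t s t "V a"] t ab elim by auto
      moreover have "(2 * c * sqrt (p t) + \<epsilon>) * (s - t) = 2 * ((s - t) * (c * n + \<epsilon> / 2))"
        by (simp add: p_def n_def field_simps)
      ultimately show ?case by linarith
    qed
  qed
  then show ?thesis by (simp add: p_def c_def M_def)
qed

lemma position_has_derivative:
  assumes t: "0 \<le> t"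
  shows "(X has_vector_derivative V t) (at t within {0..})"
proof -
  obtain R K where tr: "polygons_track (t + 1) R K" using polygons_track_exists[of "t + 1"] t by auto
  define M where "M = R + 2 * K"
  have "((\<lambda>s. M * \<bar>s - t\<bar>) \<longlongrightarrow> M * \<bar>t - t\<bar>) (at t within {0..})" by (intro tendsto_intros)
  then have lim0: "((\<lambda>s. M * \<bar>s - t\<bar>) \<longlongrightarrow> 0) (at t within {0..})" by simp
  have "\<forall>\<^sub>F s in at t within {0..}. s < t + 1"
    by (rule order_tendstoD(2)[OF tendsto_ident_at]) simp
  moreover have "\<forall>\<^sub>F s in at t within {0..}. s \<noteq> t \<and> 0 \<le> s" by (simp add: eventually_at_filter)
  ultimately have "\<forall>\<^sub>F s in at t within {0..}.
      norm ((1 / (s - t)) *\<^sub>R (X s - X t) - V t) \<le> M * \<bar>s - t\<bar>"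
  proof eventually_elim
    case (elim s)
    have "norm (X s - X t - (s - t) *\<^sub>R V t) \<le> M * (s - t)\<^sup>2"
    proof (cases "t \<le> s")
      case True
      then show ?thesis using position_increment[OF tr t True, of t] elim by (simp add: M_def)
    next
      case False
      have "norm (X t - X s - (t - s) *\<^sub>R V t) \<le> M * (t - s)\<^sup>2"
        using position_increment[OF tr, of s t t] elim False by (simp add: M_def)
      moreover have "X t - X s - (t - s) *\<^sub>R V t = - (X s - X t - (s - t) *\<^sub>R V t)"
        by (simp add: algebra_simps)
      ultimately show ?thesis by (metis norm_minus_cancel power2_commute)
    qed
    then have "norm ((1 / (s - t)) *\<^sub>R (X s - X t - (s - t) *\<^sub>R V t)) \<le> \<bar>1 / (s - t)\<bar> * (M * (s - t)\<^sup>2)"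
      by (simp add: divide_right_mono)
    moreover have "(1 / (s - t)) *\<^sub>R (X s - X t - (s - t) *\<^sub>R V t) = (1 / (s - t)) *\<^sub>R (X s - X t) - V t"
      using elim by (simp add: scaleR_diff_right[of _ "X s - X t"])
    moreover have "\<bar>1 / (s - t)\<bar> * (M * (s - t)\<^sup>2) = M * \<bar>s - t\<bar>"
    proof -
      define u where "u = \<bar>s - t\<bar>"
      have "(s - t)\<^sup>2 = u\<^sup>2" "\<bar>1 / (s - t)\<bar> = 1 / u" "u \<noteq> 0"
        using elim by (auto simp: u_def abs_divide)
      then show ?thesis unfolding u_def[symmetric] by (simp add: power2_eq_square)
    qed
    ultimately show ?case by simp
  qed
  then have "((\<lambda>s. (1 / (s - t)) *\<^sub>R (X s - X t) - V t) \<longlongrightarrow> 0) (at t within {0..})"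
    by (rule Lim_null_comparison) (rule lim0)
  then show ?thesis by (simp add: has_vector_derivative_iff_quotient LIM_zero_iff)
qed

lemma velocity_has_right_derivative:
  assumes t: "0 \<le> t"
  shows "(V has_vector_derivative accel t) (at_right t)"
  unfolding has_vector_derivative_iff_quotient
proof (rule tendstoI)
  fix e :: real assume e: "0 < e"
  obtain R K where tr: "polygons_track (t + 1) R K" using polygons_track_exists[of "t + 1"] t by auto
  define B where "B = K * (R + 2 * K)"
  have B: "0 < B" using controlled_on_ballD(1,2)[OF track_controlled[OF tr]] by (simp add: B_def)
  obtain \<epsilon> where eps: "0 < \<epsilon>" and near: "\<And>a b. 0 \<le> a \<Longrightarrow> a < b \<Longrightarrow> b \<le> t + 1 \<Longrightarrow> t \<in> {a, b} \<Longrightarrow> b - a < \<epsilon> \<Longrightarrow>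
    norm ((1 / (b - a)) *\<^sub>R (V b - V a)) \<le> norm (accel t) + \<epsilon> \<Longrightarrow>
    norm ((1 / (b - a)) *\<^sub>R (V b - V a) - accel t) < e"
    using velocity_quotient_near_accel[OF tr _ e, of t] t by auto
  have "\<forall>\<^sub>F s in at_right t. s < t + min 1 (min \<epsilon> (\<epsilon> / B))"
    by (rule order_tendstoD(2)[OF tendsto_ident_at]) (use eps B in simp)
  moreover have "\<forall>\<^sub>F s in at_right t. t < s" by (simp add: eventually_at_filter)
  ultimately show "\<forall>\<^sub>F s in at_right t. dist ((1 / (s - t)) *\<^sub>R (V s - V t)) (accel t) < e"
  proof eventually_elim
    case (elim s)
    have s: "s \<le> t + 1" "s - t < \<epsilon>" "s - t < \<epsilon> / B" using elim(1) by linarith+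
    have "norm ((1 / (s - t)) *\<^sub>R (V s - V t)) \<le> norm (accel t) + \<epsilon>"
    proof -
      have "norm (V s - V t) \<le> (norm (accel t) + B * (s - t)) * (s - t)"
        unfolding B_def using t elim s by (intro velocity_increment_le[OF tr]) auto
      then have "norm (V s - V t) / (s - t) \<le> norm (accel t) + B * (s - t)"
        using elim(2) by (simp add: divide_le_eq del: norm_minus_cancel minus_add_distrib)
      moreover have "B * (s - t) \<le> \<epsilon>" using s(3) B by (simp add: field_simps)
      ultimately show ?thesis using elim(2) by (simp del: minus_add_distrib)
    qed
    then show ?case unfolding dist_norm using t elim s by (intro near) auto
  qed
qed

lemma trajectory_has_right_derivative:
  assumes "0 \<le> t"
  shows "(trajectory has_vector_derivative (V t, accel t)) (at_right t)"
proof -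
  have "(X has_vector_derivative V t) (at_right t)"
    by (rule has_vector_derivative_within_subset[OF position_has_derivative[OF assms]]) (use assms in auto)
  from has_vector_derivative_Pair[OF this velocity_has_right_derivative[OF assms]]
  show ?thesis by simp
qed

lemma trajectory_continuous: "continuous_on {0..} trajectory"
  unfolding continuous_on_def
proof
  fix t :: real assume "t \<in> {0..}"
  then have t: "0 \<le> t" by simp
  obtain R K where tr: "polygons_track (t + 1) R K" using polygons_track_exists[of "t + 1"] t by auto
  define M where "M = R + 2 * K"
  have "((\<lambda>s. M * \<bar>s - t\<bar>) \<longlongrightarrow> M * \<bar>t - t\<bar>) (at t within {0..})" by (intro tendsto_intros)
  then have lim0: "((\<lambda>s. M * \<bar>s - t\<bar>) \<longlongrightarrow> 0) (at t within {0..})" by simp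
  have "\<forall>\<^sub>F s in at t within {0..}. s < t + 1"
    by (rule order_tendstoD(2)[OF tendsto_ident_at]) simp
  moreover have "\<forall>\<^sub>F s in at t within {0..}. s \<noteq> t \<and> 0 \<le> s" by (simp add: eventually_at_filter)
  ultimately have "\<forall>\<^sub>F s in at t within {0..}. norm (trajectory s - trajectory t) \<le> M * \<bar>s - t\<bar>"
  proof eventually_elim
    case (elim s)
    then show ?case
      using trajectory_lipschitz[OF tr, of s t] trajectory_lipschitz[OF tr, of t s] t
      by (cases "t \<le> s") (auto simp: M_def norm_minus_commute)
  qed
  then have "((\<lambda>s. trajectory s - trajectory t) \<longlongrightarrow> 0) (at t within {0..})"
    by (rule Lim_null_comparison) (rule lim0)
  then show "(trajectory \<longlongrightarrow> trajectory t) (at t within {0..})" by (simp add: LIM_zero_iff)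
qed

text \<open>The trajectory and its time shift are both solutions, in the sense of right derivatives, of the same
  autonomous system, so the one-sided Lipschitz bound controls their distance.\<close>

lemma trajectory_increment_growth:
  assumes tr: "polygons_track T R K" and ab: "0 \<le> a" "a \<le> b" and h: "0 \<le> h" "b + h \<le> T"
  shows "norm (trajectory (b + h) - trajectory b) \<le> exp (2 * K * (b - a)) * norm (trajectory (a + h) - trajectory a)"
proof -
  note RK = track_controlled[OF tr]
  have K: "1 \<le> K" by (rule controlled_on_ballD(2)[OF RK])
  define p where "p s = (norm (trajectory (s + h) - trajectory s))\<^sup>2" for s
  have "p b \<le> exp (4 * K * (b - a)) * (p a + 0 * (b - a))"
  proof (rule right_derivative_Gronwall[OF ab(2)])
    have "continuous_on {a..b} (\<lambda>s. trajectory (s + h))"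
      by (rule continuous_on_compose2[OF trajectory_continuous]) (use ab h in \<open>auto intro!: continuous_intros\<close>)
    moreover have "continuous_on {a..b} trajectory"
      by (rule continuous_on_subset[OF trajectory_continuous]) (use ab in auto)
    ultimately show "continuous_on {a..b} p" unfolding p_def by (intro continuous_intros)
    show "0 \<le> 4 * K" "0 \<le> (0::real)" using K by auto
    fix s assume s: "a < s" "s < b"
    let ?D = "velocity_field (reaction (s + h)) (trajectory (s + h)) - velocity_field (reaction s) (trajectory s)"
    have "((\<lambda>s. trajectory (s + h) - trajectory s) has_vector_derivative ?D) (at_right s)"
      unfolding velocity_field_reaction using s ab h
      by (intro has_vector_derivative_diff has_vector_derivative_shift_right trajectory_has_right_derivative) auto
    from has_real_derivative_norm_square[OF this, of 0]
    have "(p has_real_derivative 2 * inner ?D (trajectory (s + h) - trajectory s)) (at_right s)"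
      by (simp add: p_def[abs_def])
    moreover have "inner ?D (trajectory (s + h) - trajectory s) \<le> 2 * K * p s"
      unfolding p_def using s ab h
      by (intro velocity_field_one_sided_lipschitz[OF RK] reaction_subgradient trajectory_bounded[OF tr]) auto
    ultimately show "\<exists>D. (p has_real_derivative D) (at_right s) \<and> D \<le> 4 * K * p s + 0" by force
  qed
  also have "exp (4 * K * (b - a)) = (exp (2 * K * (b - a)))\<^sup>2"
    by (simp add: power2_eq_square flip: exp_add)
  finally have "(norm (trajectory (b + h) - trajectory b))\<^sup>2
      \<le> (exp (2 * K * (b - a)) * norm (trajectory (a + h) - trajectory a))\<^sup>2"
    by (simp add: p_def power_mult_distrib)
  then show ?thesis by (rule power2_le_imp_le) simp
qed

definition speed :: "real \<Rightarrow> real" where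
  "speed t = norm (V t, accel t)"

lemma speed_growth:
  assumes tr: "polygons_track T R K" and ab: "0 \<le> a" "a \<le> b" "b < T"
  shows "speed b \<le> exp (2 * K * (b - a)) * speed a"
proof -
  have lim: "((\<lambda>h. norm ((1 / h) *\<^sub>R (trajectory (t + h) - trajectory t))) \<longlongrightarrow> speed t) (at_right 0)"
    if "0 \<le> t" for t
    unfolding speed_def
    by (intro tendsto_norm has_right_vector_derivative_increment trajectory_has_right_derivative that)
  have "\<forall>\<^sub>F h in at_right 0. h < T - b"
    by (rule order_tendstoD(2)[OF tendsto_ident_at]) (use ab in simp)
  moreover have "\<forall>\<^sub>F h in at_right 0. (0::real) < h" by (simp add: eventually_at_filter)
  ultimately have "\<forall>\<^sub>F h in at_right 0. norm ((1 / h) *\<^sub>R (trajectory (b + h) - trajectory b))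
      \<le> exp (2 * K * (b - a)) * norm ((1 / h) *\<^sub>R (trajectory (a + h) - trajectory a))"
  proof eventually_elim
    case (elim h)
    then show ?case
      using trajectory_increment_growth[OF tr ab(1,2), of h] by (simp add: divide_right_mono)
  qed
  then show ?thesis
    using ab by (intro tendsto_le[OF _ tendsto_mult_left[OF lim] lim]) auto
qed

text \<open>A backward increment is at most the length of the interval times the largest speed on it, which by
  \<open>speed_growth\<close> is essentially the speed at the left end; continuity of the speed turns this into the
  bound \<open>speed t\<close> in the limit. Removing the position component, whose quotients converge to \<open>V t\<close>,
  leaves the bound \<open>norm (accel t)\<close> that forces the quotients of \<open>V\<close> to converge.\<close>

lemma velocity_has_derivative_where_speed_continuous:
  assumes t: "0 < t" and ct: "isCont speed t"
  shows "(V has_vector_derivative accel t) (at t)"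
proof (rule has_vector_derivative_two_sided)
  show "(V has_vector_derivative accel t) (at_right t)"
    using t by (intro velocity_has_right_derivative) simp
  obtain R K where tr: "polygons_track (t + 1) R K" using polygons_track_exists[of "t + 1"] t by auto
  have K: "1 \<le> K" by (rule controlled_on_ballD(2)[OF track_controlled[OF tr]])
  have posD: "(X has_vector_derivative V t) (at_left t)"
  proof (rule has_vector_derivative_within_subset)
    have "(X has_vector_derivative V t) (at t within {0..})" using t by (intro position_has_derivative) simp
    then show "(X has_vector_derivative V t) (at t within UNIV)"
      using t at_within_interior[of t "{0..}"] by (simp add: interior_real_atLeast)
  qed simp
  \<comment> \<open>An upper bound for the squared norm of the backward quotient of V, by the Pythagorean identity.\<close>
  define U where "U s = (exp (2 * K * (t - s)) * speed s)\<^sup>2 - (norm ((1 / (s - t)) *\<^sub>R (X s - X t)))\<^sup>2" for s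
  have "(speed \<longlongrightarrow> speed t) (at_left t)"
    using ct by (simp add: isCont_def filterlim_at_split)
  moreover have "((\<lambda>s. exp (2 * K * (t - s))) \<longlongrightarrow> exp (2 * K * (t - t))) (at_left t)"
    by (intro tendsto_intros)
  ultimately have "(U \<longlongrightarrow> (exp (2 * K * (t - t)) * speed t)\<^sup>2 - (norm (V t))\<^sup>2) (at_left t)"
    unfolding U_def by (intro tendsto_intros posD[unfolded has_vector_derivative_iff_quotient])
  then have Ulim: "(U \<longlongrightarrow> (norm (accel t))\<^sup>2) (at_left t)"
    by (simp add: speed_def norm_Pair)
  show "(V has_vector_derivative accel t) (at_left t)"
    unfolding has_vector_derivative_iff_quotient
  proof (rule tendstoI)
    fix e :: real assume e: "0 < e"
    obtain \<epsilon> where eps: "0 < \<epsilon>" and near: "\<And>a b. 0 \<le> a \<Longrightarrow> a < b \<Longrightarrow> b \<le> t + 1 \<Longrightarrow> t \<in> {a, b} \<Longrightarrow> b - a < \<epsilon> \<Longrightarrow>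
      norm ((1 / (b - a)) *\<^sub>R (V b - V a)) \<le> norm (accel t) + \<epsilon> \<Longrightarrow>
      norm ((1 / (b - a)) *\<^sub>R (V b - V a) - accel t) < e"
      using velocity_quotient_near_accel[OF tr _ e, of t] t by auto
    have "\<forall>\<^sub>F s in at_left t. U s < (norm (accel t) + \<epsilon>)\<^sup>2"
      by (rule order_tendstoD(2)[OF Ulim]) (use eps in \<open>intro power_strict_mono; simp\<close>)
    moreover have "\<forall>\<^sub>F s in at_left t. max 0 (t - \<epsilon>) < s"
      by (rule order_tendstoD(1)[OF tendsto_ident_at]) (use eps t in simp)
    moreover have "\<forall>\<^sub>F s in at_left t. s < t" by (simp add: eventually_at_filter)
    ultimately show "\<forall>\<^sub>F s in at_left t. dist ((1 / (s - t)) *\<^sub>R (V s - V t)) (accel t) < e"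
    proof eventually_elim
      case (elim s)
      have s: "0 \<le> s" "t - s < \<epsilon>" using elim(2) by auto
      have "norm (trajectory t - trajectory s) \<le> (exp (2 * K * (t - s)) * speed s) * (t - s)"
      proof (rule right_vector_derivative_bound)
        show "s \<le> t" using elim by simp
        show "continuous_on {s..t} trajectory"
          by (rule continuous_on_subset[OF trajectory_continuous]) (use s in auto)
        fix r assume r: "s < r" "r < t"
        have "speed r \<le> exp (2 * K * (r - s)) * speed s" using r s by (intro speed_growth[OF tr]) auto
        also have "\<dots> \<le> exp (2 * K * (t - s)) * speed s"
          using r K by (intro mult_right_mono) (auto simp: speed_def)
        finally show "\<exists>D. (trajectory has_vector_derivative D) (at_right r) \<and> norm D \<le> exp (2 * K * (t - s)) * speed s"
          using trajectory_has_right_derivative[of r] r s unfolding speed_def by force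
      qed
      then have "norm ((1 / (s - t)) *\<^sub>R (trajectory s - trajectory t)) \<le> exp (2 * K * (t - s)) * speed s"
      proof -
        have "\<bar>1 / (s - t)\<bar> = 1 / (t - s)" using elim by (simp add: abs_divide)
        then show ?thesis
          using \<open>norm (trajectory t - trajectory s) \<le> _\<close> elim
          by (simp add: norm_minus_commute[of "trajectory s"] divide_le_eq del: abs_divide)
      qed
      then have "(norm ((1 / (s - t)) *\<^sub>R (trajectory s - trajectory t)))\<^sup>2 \<le> (exp (2 * K * (t - s)) * speed s)\<^sup>2"
        by (intro power_mono) auto
      moreover have "(norm ((1 / (s - t)) *\<^sub>R (trajectory s - trajectory t)))\<^sup>2 =
          (norm ((1 / (s - t)) *\<^sub>R (X s - X t)))\<^sup>2 + (norm ((1 / (s - t)) *\<^sub>R (V s - V t)))\<^sup>2"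
        by (simp add: norm_prod_def del: norm_scaleR)
      ultimately have "(norm ((1 / (s - t)) *\<^sub>R (V s - V t)))\<^sup>2 \<le> (norm (accel t) + \<epsilon>)\<^sup>2"
        using elim(1) unfolding U_def by linarith
      then have le: "norm ((1 / (s - t)) *\<^sub>R (V s - V t)) \<le> norm (accel t) + \<epsilon>"
        by (rule power2_le_imp_le) (use eps in simp)
      have flip: "(1 / (s - t)) *\<^sub>R (V s - V t) = (1 / (t - s)) *\<^sub>R (V t - V s)"
      proof -
        have "1 / (s - t) = - (1 / (t - s))" using elim by (simp add: field_simps)
        then show ?thesis by (simp add: algebra_simps)
      qed
      show ?case unfolding dist_norm flip using le[unfolded flip] elim s by (intro near) auto
    qed
  qed
qed

lemma velocity_differentiable_off_countable:
  "\<exists>S. countable S \<and> (\<forall>t>0. t \<notin> S \<longrightarrow> (V has_vector_derivative accel t) (at t))"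
proof -
  have "\<exists>S. countable S \<and> (\<forall>t\<in>{0<..<real (Suc n)}. t \<notin> S \<longrightarrow> isCont speed t)" for n
  proof -
    obtain R K where tr: "polygons_track (real (Suc n)) R K" using polygons_track_exists by force
    define q where "q t = - (exp (- 2 * K * t) * speed t)" for t
    have "mono_on {0<..<real (Suc n)} q"
    proof (rule mono_onI)
      fix a b assume ab: "a \<in> {0<..<real (Suc n)}" "b \<in> {0<..<real (Suc n)}" "a \<le> b"
      have "exp (- 2 * K * b) * speed b \<le> exp (- 2 * K * b) * (exp (2 * K * (b - a)) * speed a)"
        using ab by (intro mult_left_mono speed_growth[OF tr]) auto
      also have "\<dots> = exp (- 2 * K * a) * speed a"
        by (simp add: algebra_simps flip: mult.assoc exp_add)
      finally show "q a \<le> q b" by (simp add: q_def)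
    qed
    then have "countable {t \<in> {0<..<real (Suc n)}. \<not> isCont q t}"
      by (rule mono_on_ctble_discont_open[OF open_greaterThanLessThan])
    moreover have "isCont speed t" if "isCont q t" for t
    proof -
      have "speed = (\<lambda>t. - exp (2 * K * t) * q t)"
        by (auto simp: q_def simp flip: mult.assoc exp_add)
      moreover have "isCont (\<lambda>t. - exp (2 * K * t) * q t) t" using that by (intro continuous_intros)
      ultimately show ?thesis by simp
    qed
    ultimately show ?thesis by (intro exI[of _ "{t \<in> {0<..<real (Suc n)}. \<not> isCont q t}"]) auto
  qed
  then obtain S where S: "\<And>n. countable (S n)"
    "\<And>n t. t \<in> {0<..<real (Suc n)} \<Longrightarrow> t \<notin> S n \<Longrightarrow> isCont speed t" by metis
  have "(V has_vector_derivative accel t) (at t)" if t: "0 < t" "t \<notin> (\<Union>n. S n)" for t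
  proof -
    obtain n where "t < real n" using reals_Archimedean2 by blast
    then have "isCont speed t" using S(2)[of t n] t by auto
    then show ?thesis by (rule velocity_has_derivative_where_speed_continuous[OF t(1)])
  qed
  moreover have "countable (\<Union>n. S n)" using S(1) by simp
  ultimately show ?thesis by blast
qed

end

section \<open>The acceleration as an essentially bounded function\<close>

lemma AE_lebesgue_on_not_in_countable:
  assumes "countable S" "A \<in> sets lebesgue"
  shows "AE t in lebesgue_on A. t \<in> A \<and> t \<notin> (S :: real set)"
proof -
  have "S \<in> null_sets lebesgue" using assms(1) by (simp add: countable_imp_null_set_lborel null_sets_completionI)
  then have "AE t in lebesgue. t \<notin> S" by (rule AE_not_in)
  then have "AE t in lebesgue. t \<in> A \<longrightarrow> t \<in> A \<and> t \<notin> S" by eventually_elim simp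
  then show ?thesis using assms(2) by (simp add: AE_restrict_space_iff)
qed

lemma straddling_quotients_tendsto:
  fixes v :: "real \<Rightarrow> 'a::real_normed_vector"
  assumes D: "(v has_vector_derivative D) (at t)"
    and ab: "\<And>n. a n \<le> t" "\<And>n. t < b n" and lim: "(\<lambda>n. b n - a n) \<longlonglongrightarrow> 0"
  shows "(\<lambda>n. (1 / (b n - a n)) *\<^sub>R (v (b n) - v (a n))) \<longlonglongrightarrow> D"
proof (rule LIMSEQ_I)
  fix r :: real assume r: "0 < r"
  obtain d where d: "0 < d" "\<And>s. norm (s - t) < d \<Longrightarrow> norm (v s - v t - (s - t) *\<^sub>R D) \<le> r / 2 * norm (s - t)"
    using D half_gt_zero[OF r] unfolding has_vector_derivative_def has_derivative_at_alt by blast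
  have "\<forall>\<^sub>F n in sequentially. b n - a n < d" using lim d(1) by (rule order_tendstoD(2))
  then obtain N where N: "\<And>n. N \<le> n \<Longrightarrow> b n - a n < d" by (auto simp: eventually_sequentially)
  show "\<exists>N. \<forall>n\<ge>N. norm ((1 / (b n - a n)) *\<^sub>R (v (b n) - v (a n)) - D) < r"
  proof (intro exI[of _ N] allI impI)
    fix n assume n: "N \<le> n"
    note le = ab(1)[of n] ab(2)[of n] N[OF n]
    have "norm (v (b n) - v t - (b n - t) *\<^sub>R D) \<le> r / 2 * norm (b n - t)"
      by (rule d(2)) (use le in simp)
    moreover have "norm (v (a n) - v t - (a n - t) *\<^sub>R D) \<le> r / 2 * norm (a n - t)"
      by (rule d(2)) (use le in simp)
    moreover have "norm (v (b n) - v (a n) - (b n - a n) *\<^sub>R D) \<le>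
        norm (v (b n) - v t - (b n - t) *\<^sub>R D) + norm (v (a n) - v t - (a n - t) *\<^sub>R D)"
      using norm_triangle_ineq4[of "v (b n) - v t - (b n - t) *\<^sub>R D" "v (a n) - v t - (a n - t) *\<^sub>R D"]
      by (simp add: algebra_simps)
    ultimately have "norm (v (b n) - v (a n) - (b n - a n) *\<^sub>R D) \<le> r / 2 * (b n - a n)"
      using le by (simp add: field_simps)
    moreover have "(1 / (b n - a n)) *\<^sub>R (v (b n) - v (a n)) - D =
        (1 / (b n - a n)) *\<^sub>R (v (b n) - v (a n) - (b n - a n) *\<^sub>R D)"
      using le by (simp add: scaleR_diff_right[of _ "v (b n) - v (a n)"])
    ultimately have "norm ((1 / (b n - a n)) *\<^sub>R (v (b n) - v (a n)) - D) \<le> r / 2"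
      using le by (simp add: divide_le_eq)
    then show "norm ((1 / (b n - a n)) *\<^sub>R (v (b n) - v (a n)) - D) < r" using r by linarith
  qed
qed

lemma simple_function_of_grid_index:
  fixes F :: "int \<Rightarrow> 'a" and m T :: real
  assumes m: "0 < m"
  shows "simple_function (lebesgue_on {0<..<T}) (\<lambda>t. F \<lfloor>t * m\<rfloor>)"
proof (rule simple_function_compose1[where g = F])
  show "simple_function (lebesgue_on {0<..<T}) (\<lambda>t. \<lfloor>t * m\<rfloor>)"
    unfolding simple_function_def
  proof (intro conjI ballI)
    have "(\<lambda>t. \<lfloor>t * m\<rfloor>) ` {0<..<T} \<subseteq> {0..\<lfloor>T * m\<rfloor>}"
      using m by (auto intro!: floor_mono mult_right_mono)
    then show "finite ((\<lambda>t. \<lfloor>t * m\<rfloor>) ` space (lebesgue_on {0<..<T}))"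
      by (auto intro: finite_subset)
    fix k
    have "(\<lambda>t. \<lfloor>t * m\<rfloor>) -` {k} \<inter> {0<..<T} = {of_int k / m..<(of_int k + 1) / m} \<inter> {0<..<T}"
    proof -
      have "\<lfloor>t * m\<rfloor> = k \<longleftrightarrow> of_int k / m \<le> t \<and> t < (of_int k + 1) / m" for t
        using m by (simp add: floor_eq_iff pos_divide_le_eq pos_less_divide_eq)
      then show ?thesis by (simp add: set_eq_iff)
    qed
    moreover have "space (lebesgue_on {0<..<T}) = {0<..<T}" by simp
    moreover have "{of_int k / m..<(of_int k + 1) / m} \<inter> {0<..<T} \<in> sets (lebesgue_on {0<..<T})"
      by (subst sets_restrict_space_iff) auto
    ultimately show "(\<lambda>t. \<lfloor>t * m\<rfloor>) -` {k} \<inter> space (lebesgue_on {0<..<T}) \<in> sets (lebesgue_on {0<..<T})"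
      by (simp only:)
  qed
qed

text \<open>The derivative is the limit of difference quotients of \<open>v\<close> over the cells of finer and finer
  uniform grids; each of these takes only finitely many values on a bounded interval.\<close>

lemma lipschitz_ae_derivative_in_L_infinity:
  fixes v :: "real \<Rightarrow> 'a::real_normed_vector"
  assumes D: "AE t in lebesgue_on {0<..<T}. (v has_vector_derivative D t) (at t)"
    and L: "L-lipschitz_on {0<..<T} v"
  shows "in_L_infinity (lebesgue_on {0<..<T}) D"
  unfolding in_L_infinity_def
proof
  define m where "m n = real (Suc n)" for n
  define a b where "a n t = of_int \<lfloor>t * m n\<rfloor> / m n" and "b n t = (of_int \<lfloor>t * m n\<rfloor> + 1) / m n" for n t
  define s where "s n t = (1 / (b n t - a n t)) *\<^sub>R (v (b n t) - v (a n t))" for n t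
  have m: "0 < m n" for n by (simp add: m_def)
  have "simple_function (lebesgue_on {0<..<T}) (s n)" for n
    unfolding s_def a_def b_def by (rule simple_function_of_grid_index[OF m])
  moreover have "(\<lambda>n. s n t) \<longlonglongrightarrow> D t" if "(v has_vector_derivative D t) (at t)" for t
    unfolding s_def
  proof (rule straddling_quotients_tendsto[OF that])
    show "a n t \<le> t" "t < b n t" for n
      using m[of n] by (simp_all add: a_def b_def divide_le_eq less_divide_eq)
    have "(\<lambda>n. b n t - a n t) = (\<lambda>n. 1 / real (Suc n))"
      by (simp add: a_def b_def m_def fun_eq_iff flip: diff_divide_distrib)
    then show "(\<lambda>n. b n t - a n t) \<longlonglongrightarrow> 0"
      using LIMSEQ_Suc[OF lim_1_over_n, where 'a1=real] by simp
  qed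
  ultimately show "\<exists>s. (\<forall>i::nat. simple_function (lebesgue_on {0<..<T}) (s i)) \<and>
      (AE t in lebesgue_on {0<..<T}. (\<lambda>i. s i t) \<longlonglongrightarrow> D t)"
    using D by (intro exI[of _ s]) (auto elim: eventually_mono)
  have "AE t in lebesgue_on {0<..<T}. t \<in> {0<..<T}" by (rule AE_I2) simp
  with D have "AE t in lebesgue_on {0<..<T}. norm (D t) \<le> L"
  proof eventually_elim
    case (elim t)
    have "((\<lambda>r. norm ((1 / (r - t)) *\<^sub>R (v r - v t))) \<longlongrightarrow> norm (D t)) (at t)"
      using elim(1) unfolding has_vector_derivative_iff_quotient by (rule tendsto_norm)
    moreover have "\<forall>\<^sub>F r in at t. norm ((1 / (r - t)) *\<^sub>R (v r - v t)) \<le> L"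
    proof -
      have "\<forall>\<^sub>F r in at t. r \<in> {0<..<T}" using elim(2) by (intro eventually_at_in_open') auto
      moreover have "\<forall>\<^sub>F r in at t. r \<noteq> t" by (simp add: eventually_at_filter)
      ultimately show ?thesis
      proof eventually_elim
        case (elim r)
        then have "norm (v r - v t) \<le> L * \<bar>r - t\<bar>"
          using lipschitz_onD[OF L, of r t] \<open>t \<in> {0<..<T}\<close> by (simp add: dist_norm)
        then show ?case using elim by (simp add: divide_le_eq)
      qed
    qed
    ultimately show ?case by (intro tendsto_upperbound) auto
  qed
  then show "\<exists>C. AE t in lebesgue_on {0<..<T}. norm (D t) \<le> C" by blast
qed

section \<open>Existence\<close>

context damped_inertial_system
begin

lemma velocity_X:
  assumes "0 \<le> t"
  shows "velocity X t = V t"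
  unfolding velocity_def
proof (rule vector_derivative_within[OF _ position_has_derivative[OF assms]])
  have "at_right t \<le> at t within {0..}" using assms by (intro at_le) auto
  then show "at t within {0..} \<noteq> bot" using trivial_limit_at_right_real[of t] by (metis le_bot)
qed

lemma velocity_X_has_derivative:
  assumes "0 < t" "(V has_vector_derivative D) (at t)"
  shows "(velocity X has_vector_derivative D) (at t)"
proof (rule has_vector_derivative_transform_within_open[OF assms(2)])
  show "open {0::real<..}" "t \<in> {0<..}" using assms by auto
  show "V s = velocity X s" if "s \<in> {0<..}" for s using that by (simp add: velocity_X)
qed

lemma limit_is_strong_solution: "strong_global_solution \<phi> f X"
proof -
  obtain S where S: "countable S" "\<And>t. 0 < t \<Longrightarrow> t \<notin> S \<Longrightarrow> (V has_vector_derivative accel t) (at t)"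
    using velocity_differentiable_off_countable by blast
  have D: "(velocity X has_vector_derivative accel t) (at t)" if "0 < t" "t \<notin> S" for t
    using velocity_X_has_derivative S(2) that by blast
  have acc: "acceleration X t = accel t" if "0 < t" "t \<notin> S" for t
    unfolding acceleration_def using D[OF that] by (rule vector_derivative_at)
  have AE_D: "AE t in lebesgue_on {0<..<T}. (velocity X has_vector_derivative acceleration X t) (at t)" for T
  proof -
    have "AE t in lebesgue_on {0<..<T}. t \<in> {0<..<T} \<and> t \<notin> S"
      by (rule AE_lebesgue_on_not_in_countable[OF S(1)]) simp
    then show ?thesis by eventually_elim (simp add: acc D del: minus_add_distrib)
  qed
  have lip: "\<exists>L. L-lipschitz_on {0<..<T} (velocity X)" if T: "0 < T" for T
  proof -
    obtain R K where tr: "polygons_track T R K" using polygons_track_exists[OF T] by blast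
    have "(R + 2 * K)-lipschitz_on {0<..<T} (velocity X)"
    proof (rule lipschitz_on_leI)
      fix s t assume st: "s \<in> {0<..<T}" "t \<in> {0<..<T}" "s \<le> t"
      have "norm (V t - V s) \<le> norm (trajectory t - trajectory s)"
        using norm_pair_components(2)[of "trajectory t - trajectory s"] by simp
      also have "\<dots> \<le> (R + 2 * K) * (t - s)" using st by (intro trajectory_lipschitz[OF tr]) auto
      finally show "dist (velocity X s) (velocity X t) \<le> (R + 2 * K) * dist s t"
        using st by (simp add: velocity_X dist_norm norm_minus_commute)
    qed (use controlled_on_ballD(1,2)[OF track_controlled[OF tr]] in simp)
    then show ?thesis by blast
  qed
  have ct: "continuous_on {0..} (velocity X)"
  proof (rule continuous_on_eq)
    show "continuous_on {0..} V" by (intro continuous_intros trajectory_continuous)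
  qed (simp add: velocity_X)
  have incl: "AE t in lebesgue_on {0<..}.
      0 \<in> (\<lambda>g. acceleration X t + g + gradient f (X t)) ` subdifferential \<phi> (velocity X t)"
  proof -
    have "AE t in lebesgue_on {0<..}. t \<in> {0<..} \<and> t \<notin> S"
      by (rule AE_lebesgue_on_not_in_countable[OF S(1)]) simp
    then show ?thesis
    proof eventually_elim
      case (elim t)
      then show ?case
        using reaction_subgradient[of t] by (intro image_eqI[of _ _ "reaction t"]) (auto simp: acc velocity_X)
    qed
  qed
  show ?thesis
    unfolding strong_global_solution_def
  proof (intro conjI allI impI incl ct)
    show "X differentiable (at t within {0..})" if "0 \<le> t" for t
      using position_has_derivative[OF that] by (rule differentiableI_vector)
    fix T :: real assume T: "0 < T"
    show "\<exists>L. L-lipschitz_on {0<..<T} (velocity X)" by (rule lip[OF T])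
    show "AE t in lebesgue_on {0<..<T}. velocity X differentiable (at t)"
      using AE_D[of T] by eventually_elim (rule differentiableI_vector)
    show "in_L_infinity (lebesgue_on {0<..<T}) (acceleration X)"
      using lip[OF T] lipschitz_ae_derivative_in_L_infinity[OF AE_D] by blast
  qed
qed

end

section \<open>Uniqueness\<close>

lemma lipschitz_on_mult_bounded:
  fixes p q :: "real \<Rightarrow> real"
  assumes p: "A-lipschitz_on S p" "\<And>t. t \<in> S \<Longrightarrow> \<bar>p t\<bar> \<le> a" and q: "B-lipschitz_on S q" "\<And>t. t \<in> S \<Longrightarrow> \<bar>q t\<bar> \<le> b"
    and ab: "0 \<le> a" "0 \<le> b"
  shows "(a * B + b * A)-lipschitz_on S (\<lambda>t. p t * q t)"
proof (rule lipschitz_onI)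
  have AB: "0 \<le> A" "0 \<le> B" using p(1) q(1) by (auto dest: lipschitz_on_nonneg)
  then show "0 \<le> a * B + b * A" using ab by simp
  fix s t assume st: "s \<in> S" "t \<in> S"
  have "\<bar>p s * q s - p t * q t\<bar> \<le> \<bar>p s\<bar> * \<bar>q s - q t\<bar> + \<bar>q t\<bar> * \<bar>p s - p t\<bar>"
  proof -
    have "p s * q s - p t * q t = p s * (q s - q t) + q t * (p s - p t)" by (simp add: algebra_simps)
    then show ?thesis by (metis abs_mult abs_triangle_ineq)
  qed
  also have "\<dots> \<le> a * (B * dist s t) + b * (A * dist s t)"
    using lipschitz_onD[OF p(1) st] lipschitz_onD[OF q(1) st] p(2)[OF st(1)] q(2)[OF st(2)] ab
    by (intro add_mono mult_mono) (auto simp: dist_real_def)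
  finally show "dist (p s * q s) (p t * q t) \<le> (a * B + b * A) * dist s t"
    by (simp add: dist_real_def algebra_simps)
qed

lemma lipschitz_exp_neg_norm_square:
  fixes z :: "real \<Rightarrow> 'a::real_normed_vector"
  assumes z: "L-lipschitz_on {0..T} z" and b: "\<And>t. t \<in> {0..T} \<Longrightarrow> norm (z t) \<le> B" and k: "0 \<le> k" and B: "0 \<le> B"
  shows "\<exists>L'. L'-lipschitz_on {0..T} (\<lambda>t. exp (- k * t) * (norm (z t))\<^sup>2)"
proof -
  have n: "L-lipschitz_on {0..T} (\<lambda>t. norm (z t))"
  proof (rule lipschitz_onI)
    fix s t assume "s \<in> {0..T}" "t \<in> {0..T}"
    then show "dist (norm (z s)) (norm (z t)) \<le> L * dist s t"
      using lipschitz_onD[OF z, of s t] norm_triangle_ineq3[of "z s" "z t"]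
      by (simp add: dist_norm)
  qed (rule lipschitz_on_nonneg[OF z])
  have sq: "(B * L + B * L)-lipschitz_on {0..T} (\<lambda>t. norm (z t) * norm (z t))"
    using b B by (intro lipschitz_on_mult_bounded n) auto
  have ex: "k-lipschitz_on {0..T} (\<lambda>t. exp (- k * t))"
  proof (rule lipschitz_on_leI)
    fix s t assume st: "s \<in> {0..T}" "t \<in> {0..T}" "s \<le> t"
    have "norm (exp (- k * t) - exp (- k * s)) \<le> k * (t - s)"
    proof (rule right_vector_derivative_bound[OF st(3)])
      show "continuous_on {s..t} (\<lambda>t. exp (- k * t))" by (intro continuous_intros)
      fix r assume r: "s < r" "r < t"
      have "((\<lambda>t. exp (- k * t)) has_vector_derivative exp (- k * r) * (- k)) (at_right r)"
        unfolding has_real_derivative_iff_has_vector_derivative[symmetric]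
        by (auto intro!: derivative_eq_intros)
      moreover have "norm (exp (- k * r) * (- k)) \<le> k"
        using r st k by (simp add: abs_mult mult_left_le_one_le)
      ultimately show "\<exists>D. ((\<lambda>t. exp (- k * t)) has_vector_derivative D) (at_right r) \<and> norm D \<le> k" by blast
    qed
    then show "dist (exp (- k * s)) (exp (- k * t)) \<le> k * dist s t"
      using st by (simp add: dist_real_def abs_minus_commute)
  qed (rule k)
  have "(1 * (B * L + B * L) + (B * B) * k)-lipschitz_on {0..T} (\<lambda>t. exp (- k * t) * (norm (z t) * norm (z t)))"
    using k B b by (intro lipschitz_on_mult_bounded ex sq) (auto intro!: mult_mono)
  then show ?thesis by (auto simp: power2_eq_square)
qed

context damped_inertial_system
begin

lemma strong_solution_has_velocity:
  assumes "strong_global_solution \<phi> f y" "0 \<le> t"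
  shows "(y has_vector_derivative velocity y t) (at t within {0..})"
  using assms vector_derivative_works unfolding strong_global_solution_def velocity_def by blast

lemma strong_solution_state_lipschitz:
  assumes y: "strong_global_solution \<phi> f y" and T: "0 < T"
  shows "\<exists>L. L-lipschitz_on {0..T} (\<lambda>t. (y t, velocity y t))"
proof -
  have ct: "continuous_on {0..T} (velocity y)"
    using y unfolding strong_global_solution_def by (auto intro: continuous_on_subset)
  obtain L where "L-lipschitz_on {0<..<T} (velocity y)"
    using y T unfolding strong_global_solution_def by blast
  then have L: "L-lipschitz_on {0..T} (velocity y)"
    using lipschitz_on_closure[of L "{0<..<T}" "velocity y"] ct T by simp
  obtain B where B: "0 < B" "\<And>t. t \<in> {0..T} \<Longrightarrow> norm (velocity y t) \<le> B"
    using compact_imp_bounded[OF compact_continuous_image[OF ct compact_Icc]]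
    by (auto simp: bounded_pos)
  have "B-lipschitz_on {0..T} y"
  proof (rule lipschitz_on_leI)
    fix s t assume st: "s \<in> {0..T}" "t \<in> {0..T}" "s \<le> t"
    have "norm (y t - y s) \<le> B * (t - s)"
    proof (rule right_vector_derivative_bound[OF st(3)])
      have "continuous_on {0..} y"
        using has_vector_derivative_continuous[OF strong_solution_has_velocity[OF y]]
        by (simp add: continuous_on_eq_continuous_within)
      then show "continuous_on {s..t} y" by (rule continuous_on_subset) (use st in auto)
      fix r assume r: "s < r" "r < t"
      have "(y has_vector_derivative velocity y r) (at_right r)"
        by (rule has_vector_derivative_within_subset[OF strong_solution_has_velocity[OF y]])
          (use r st in auto)
      then show "\<exists>D. (y has_vector_derivative D) (at_right r) \<and> norm D \<le> B"
        using B(2)[of r] r st by auto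
    qed
    then show "dist (y s) (y t) \<le> B * dist s t" using st by (simp add: dist_norm norm_minus_commute)
  qed (use B in simp)
  then show ?thesis using lipschitz_on_Pair[OF _ L] by blast
qed

text \<open>At almost every time the derivative of the state is the element of \<open>F\<close> singled out by the subgradient
  in the inclusion.\<close>

lemma strong_solution_state_derivative:
  assumes y: "strong_global_solution \<phi> f y" and T: "0 < T"
  shows "\<exists>N. negligible N \<and> (\<forall>t. 0 < t \<longrightarrow> t < T \<longrightarrow> t \<notin> N \<longrightarrow>
    (\<exists>g\<in>subdifferential \<phi> (velocity y t).
      ((\<lambda>t. (y t, velocity y t)) has_vector_derivative velocity_field g (y t, velocity y t)) (at t)))"
proof -
  have "AE t in lebesgue_on {0<..<T}. velocity y differentiable (at t)"
    using y T by (simp add: strong_global_solution_def)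
  then have 1: "AE t in lebesgue. t \<in> {0<..<T} \<longrightarrow> velocity y differentiable (at t)"
    by (simp add: AE_restrict_space_iff)
  have "AE t in lebesgue_on {0<..}.
      0 \<in> (\<lambda>g. acceleration y t + g + gradient f (y t)) ` subdifferential \<phi> (velocity y t)"
    using y by (simp add: strong_global_solution_def)
  then have 2: "AE t in lebesgue. t \<in> {0<..} \<longrightarrow>
      0 \<in> (\<lambda>g. acceleration y t + g + gradient f (y t)) ` subdifferential \<phi> (velocity y t)"
    by (simp add: AE_restrict_space_iff)
  from 1 2 have "AE t in lebesgue. 0 < t \<and> t < T \<longrightarrow> velocity y differentiable (at t) \<and>
      0 \<in> (\<lambda>g. acceleration y t + g + gradient f (y t)) ` subdifferential \<phi> (velocity y t)"
    by eventually_elim simp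
  then obtain N where N: "N \<in> null_sets lebesgue" "{t \<in> space lebesgue. \<not> (0 < t \<and> t < T \<longrightarrow>
      velocity y differentiable (at t) \<and>
      0 \<in> (\<lambda>g. acceleration y t + g + gradient f (y t)) ` subdifferential \<phi> (velocity y t))} \<subseteq> N"
    unfolding eventually_ae_filter by blast
  have "\<exists>g\<in>subdifferential \<phi> (velocity y t).
      ((\<lambda>t. (y t, velocity y t)) has_vector_derivative velocity_field g (y t, velocity y t)) (at t)"
    if t: "0 < t" "t < T" "t \<notin> N" for t
  proof -
    have df: "velocity y differentiable (at t)" and
      "0 \<in> (\<lambda>g. acceleration y t + g + gradient f (y t)) ` subdifferential \<phi> (velocity y t)"
      using N(2) t by auto
    then obtain g where g: "g \<in> subdifferential \<phi> (velocity y t)" "acceleration y t + g + gradient f (y t) = 0"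
      by auto
    have "acceleration y t = - (g + gradient f (y t))"
      using g(2) by (metis add.assoc eq_neg_iff_add_eq_0)
    then have "(velocity y has_vector_derivative - (g + gradient f (y t))) (at t)"
      using df vector_derivative_works unfolding acceleration_def by metis
    moreover have "(y has_vector_derivative velocity y t) (at t)"
      using strong_solution_has_velocity[OF y, of t] t at_within_interior[of t "{0..}"]
      by (simp add: interior_real_atLeast)
    ultimately have "((\<lambda>t. (y t, velocity y t)) has_vector_derivative velocity_field g (y t, velocity y t)) (at t)"
      using has_vector_derivative_Pair by (force simp: velocity_field_def)
    then show ?thesis using g(1) by blast
  qed
  then show ?thesis using N(1) by (auto simp: negligible_iff_null_sets)
qed

lemma strong_solution_unique:
  assumes y1: "strong_global_solution \<phi> f y1" and y2: "strong_global_solution \<phi> f y2"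
    and init: "y1 0 = y2 0" "velocity y1 0 = velocity y2 0" and t: "0 \<le> T"
  shows "y1 T = y2 T"
proof (cases "T = 0")
  case False
  with t have T: "0 < T" by simp
  define z1 z2 where "z1 t = (y1 t, velocity y1 t)" and "z2 t = (y2 t, velocity y2 t)" for t
  obtain L1 where L1: "L1-lipschitz_on {0..T} z1"
    using strong_solution_state_lipschitz[OF y1 T] unfolding z1_def by blast
  obtain L2 where L2: "L2-lipschitz_on {0..T} z2"
    using strong_solution_state_lipschitz[OF y2 T] unfolding z2_def by blast
  obtain N1 where N1: "negligible N1" "\<And>t. 0 < t \<Longrightarrow> t < T \<Longrightarrow> t \<notin> N1 \<Longrightarrow>
      \<exists>g\<in>subdifferential \<phi> (snd (z1 t)). (z1 has_vector_derivative velocity_field g (z1 t)) (at t)"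
    using strong_solution_state_derivative[OF y1 T] unfolding z1_def snd_conv by blast
  obtain N2 where N2: "negligible N2" "\<And>t. 0 < t \<Longrightarrow> t < T \<Longrightarrow> t \<notin> N2 \<Longrightarrow>
      \<exists>g\<in>subdifferential \<phi> (snd (z2 t)). (z2 has_vector_derivative velocity_field g (z2 t)) (at t)"
    using strong_solution_state_derivative[OF y2 T] unfolding z2_def snd_conv by blast
  obtain B1 B2 where B: "0 < B1" "0 < B2" "\<And>t. t \<in> {0..T} \<Longrightarrow> norm (z1 t) \<le> B1"
      "\<And>t. t \<in> {0..T} \<Longrightarrow> norm (z2 t) \<le> B2"
    using compact_imp_bounded[OF compact_continuous_image[OF lipschitz_on_continuous_on[OF L1] compact_Icc]]
      compact_imp_bounded[OF compact_continuous_image[OF lipschitz_on_continuous_on[OF L2] compact_Icc]]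
    by (auto simp: bounded_pos)
  define R where "R = B1 + B2 + 1"
  have "1 \<le> R" using B by (simp add: R_def)
  then obtain K where RK: "controlled_on_ball R K" using controlled_on_ball_exists by blast
  have K: "1 \<le> K" by (rule controlled_on_ballD(2)[OF RK])
  have zR: "norm (z1 t) \<le> R" "norm (z2 t) \<le> R" if "t \<in> {0..T}" for t
    using B(1,2) B(3,4)[OF that] by (auto simp: R_def)
  define q where "q t = exp (- (4 * K) * t) * (norm (z1 t - z2 t))\<^sup>2" for t
  obtain L where L: "L-lipschitz_on {0..T} q"
  proof -
    have "(L1 + L2)-lipschitz_on {0..T} (\<lambda>t. z1 t - z2 t)" by (rule lipschitz_on_diff[OF L1 L2])
    then show ?thesis
      using lipschitz_exp_neg_norm_square[of "L1 + L2" T "\<lambda>t. z1 t - z2 t" "R + R" "4 * K"] that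
        zR K \<open>1 \<le> R\<close> norm_triangle_ineq4 unfolding q_def
      by (smt (verit, best))
  qed
  \<comment> \<open>The weight 4 K compensates the growth rate 2 * (2 K) of the squared distance.\<close>
  have "q T \<le> q 0"
  proof (rule lipschitz_derivative_nonpos_ae_imp_le[OF t L negligible_Un[OF N1(1) N2(1)]])
    fix s assume s: "0 < s" "s < T" "s \<notin> N1 \<union> N2"
    obtain g1 where g1: "g1 \<in> subdifferential \<phi> (snd (z1 s))"
      "(z1 has_vector_derivative velocity_field g1 (z1 s)) (at s)" using N1(2)[of s] s by blast
    obtain g2 where g2: "g2 \<in> subdifferential \<phi> (snd (z2 s))"
      "(z2 has_vector_derivative velocity_field g2 (z2 s)) (at s)" using N2(2)[of s] s by blast
    define I where "I = inner (velocity_field g1 (z1 s) - velocity_field g2 (z2 s)) (z1 s - z2 s)"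
    have "((\<lambda>s. (norm (z1 s - z2 s - 0))\<^sup>2) has_real_derivative 2 * inner
        (velocity_field g1 (z1 s) - velocity_field g2 (z2 s)) (z1 s - z2 s - 0)) (at s)"
      by (intro has_real_derivative_norm_square has_vector_derivative_diff g1 g2)
    then have n: "((\<lambda>s. (norm (z1 s - z2 s))\<^sup>2) has_real_derivative 2 * I) (at s)" by (simp add: I_def)
    have "(q has_real_derivative (exp (- (4 * K) * s) * (2 * I - 4 * K * (norm (z1 s - z2 s))\<^sup>2))) (at s)"
    proof -
      have "((\<lambda>s. exp (- (4 * K) * s)) has_real_derivative exp (- (4 * K) * s) * (- (4 * K))) (at s)"
        by (auto intro!: derivative_eq_intros)
      from DERIV_mult[OF this n] show ?thesis
        unfolding q_def by (rule DERIV_cong) (simp add: algebra_simps)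
    qed
    moreover have "I \<le> 2 * K * (norm (z1 s - z2 s))\<^sup>2"
      unfolding I_def using s by (intro velocity_field_one_sided_lipschitz[OF RK] zR g1 g2) auto
    then have "exp (- (4 * K) * s) * (2 * I - 4 * K * (norm (z1 s - z2 s))\<^sup>2) \<le> 0"
      by (intro mult_nonneg_nonpos) auto
    ultimately show "\<exists>D. (q has_real_derivative D) (at s) \<and> D \<le> 0" by blast
  qed
  moreover have "q 0 = 0" using init by (simp add: q_def z1_def z2_def)
  ultimately have "exp (- (4 * K) * T) * (norm (z1 T - z2 T))\<^sup>2 \<le> 0" by (simp only: q_def)
  then have "z1 T = z2 T" by (simp add: mult_le_0_iff)
  then show ?thesis by (simp add: z1_def z2_def)
qed (use init in simp)

end

theorem theorem3p3:
  fixes f \<phi> :: "'h::{real_inner, complete_space} \<Rightarrow> real"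
    and x0 x1 :: 'h
  assumes "\<forall>u. f differentiable (at u)"
    and "\<forall>B. bounded B \<longrightarrow> (\<exists>L. L-lipschitz_on B (gradient f))"
    and "bdd_below (range f)"
    and "damping_potential \<phi>"
  shows "\<exists>x. (strong_global_solution \<phi> f x \<and> x 0 = x0 \<and> velocity x 0 = x1) \<and>
             (\<forall>y. strong_global_solution \<phi> f y \<and> y 0 = x0 \<and> velocity y 0 = x1 \<longrightarrow>
                  (\<forall>t\<ge>0. y t = x t))"
proof -
  interpret damped_inertial_system f \<phi> x0 x1 by standard (rule assms)+
  have x: "strong_global_solution \<phi> f X" "X 0 = x0" "velocity X 0 = x1"
    by (simp_all add: limit_is_strong_solution velocity_X trajectory_0)
  show ?thesis
  proof (intro exI[of _ X] conjI allI impI x)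
    fix y and t :: real
    assume "strong_global_solution \<phi> f y \<and> y 0 = x0 \<and> velocity y 0 = x1" and t: "0 \<le> t"
    then have y: "strong_global_solution \<phi> f y" "y 0 = x0" "velocity y 0 = x1" by blast+
    have "y 0 = X 0" "velocity y 0 = velocity X 0" unfolding y x by (rule refl)+
    then show "y t = X t" by (rule strong_solution_unique[OF y(1) x(1) _ _ t])
  qed
qed

end
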